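(* Let $\mathcal P$ be the Pareigis Hopf algebra over $k$. Then its cyclic homology is, as $k$-vector spaces, $$HC_n(\mathcal P)\cong\begin{cases}T&\text{for }n=0,\\ T_{od}\oplus k&\text{for }n>0.\end{cases}$$
   Context: $k$ is a field containing $\mathbb{Q}$. $\mathcal P$ is the quotient of the free $k$-algebra $k\langle s,t,t^{-1}\rangle$ by the two-sided ideal generated by $tt^{-1}-1,\ t^{-1}t-1,\ s^2,\ st+ts$. (It is a Hopf algebra with $\Delta(t)=t\otimes t$, $\varepsilon(t)=1$, $S(t)=t^{-1}$, $\Delta(s)=s\otimes1+t^{-1}\otimes s$, $\varepsilon(s)=0$, $S(s)=st$.) $T=k[t,t^{-1}]$ is the Laurent polynomial ring and $T_{od}\subset T$ is the span of the $t^r$ with $r$ odd. $HC_n$ denotes the usual cyclic homology of a $k$-algebra. *)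

theory Defs
  imports "HOL-Library.Poly_Mapping" "HOL-Library.FuncSet" "HOL.Hull" "HOL.Vector_Spaces"
begin

section \<open>Vector spaces on a carrier\<close>

record ('k, 'v) vspace =
  vcarrier :: "'v set"
  vadd :: "'v \<Rightarrow> 'v \<Rightarrow> 'v"
  vzero :: "'v"
  vsmult :: "'k \<Rightarrow> 'v \<Rightarrow> 'v"

definition vspace_iso :: "('k, 'v) vspace \<Rightarrow> ('k, 'w) vspace \<Rightarrow> bool" where
  "vspace_iso V W \<longleftrightarrow> (\<exists>f. bij_betw f (vcarrier V) (vcarrier W) \<and>
     (\<forall>x\<in>vcarrier V. \<forall>y\<in>vcarrier V. f (vadd V x y) = vadd W (f x) (f y)) \<and>
     (\<forall>c. \<forall>x\<in>vcarrier V. f (vsmult V c x) = vsmult W c (f x)))"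

definition sub_vspace :: "('k \<Rightarrow> 'v \<Rightarrow> 'v) \<Rightarrow> 'v::ab_group_add set \<Rightarrow> ('k, 'v) vspace" where
  "sub_vspace scale U = \<lparr>vcarrier = U, vadd = (+), vzero = 0, vsmult = scale\<rparr>"

text \<open>The quotient of \<open>V\<close> by a subspace \<open>W\<close>, with cosets as elements. The summand from \<open>W\<close> in the
  scalar multiple only matters for the scalar 0.\<close>

definition quotient_vspace :: "('k, 'v) vspace \<Rightarrow> 'v set \<Rightarrow> ('k, 'v set) vspace" where
  "quotient_vspace V W =
    \<lparr>vcarrier = {{vadd V x w | w. w \<in> W} | x. x \<in> vcarrier V},
     vadd = (\<lambda>X Y. {vadd V x y | x y. x \<in> X \<and> y \<in> Y}),
     vzero = W,
     vsmult = (\<lambda>c X. {vadd V (vsmult V c x) w | x w. x \<in> X \<and> w \<in> W})\<rparr>"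

definition sum_vspace :: "('k, 'v) vspace \<Rightarrow> ('k, 'w) vspace \<Rightarrow> ('k, 'v \<times> 'w) vspace" where
  "sum_vspace V W =
    \<lparr>vcarrier = vcarrier V \<times> vcarrier W,
     vadd = (\<lambda>(x, y) (x', y'). (vadd V x x', vadd W y y')),
     vzero = (vzero V, vzero W),
     vsmult = (\<lambda>c (x, y). (vsmult V c x, vsmult W c y))\<rparr>"

definition Sum_vspace :: "'i set \<Rightarrow> ('i \<Rightarrow> ('k, 'v) vspace) \<Rightarrow> ('k, 'i \<Rightarrow> 'v) vspace" where
  "Sum_vspace I V =
    \<lparr>vcarrier = (\<Pi>\<^sub>E i\<in>I. vcarrier (V i)),
     vadd = (\<lambda>x y. \<lambda>i\<in>I. vadd (V i) (x i) (y i)),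
     vzero = (\<lambda>i\<in>I. vzero (V i)),
     vsmult = (\<lambda>c x. \<lambda>i\<in>I. vsmult (V i) c (x i))\<rparr>"


section \<open>Free vector spaces\<close>

text \<open>\<open>'x \<Rightarrow>\<^sub>0 'k\<close> is the \<open>'k\<close>-vector space with basis \<open>Poly_Mapping.single x 1\<close>.\<close>

definition fscale :: "'k::field \<Rightarrow> ('x \<Rightarrow>\<^sub>0 'k) \<Rightarrow> ('x \<Rightarrow>\<^sub>0 'k)" where
  "fscale c f = Poly_Mapping.map ((*) c) f"

lemma lookup_fscale [simp]:
  "Poly_Mapping.lookup (fscale c f) x = c * Poly_Mapping.lookup f x"
  by (simp add: fscale_def Poly_Mapping.map.rep_eq when_def)

interpretation free_vs: vector_space "fscale :: 'k::field \<Rightarrow> ('x \<Rightarrow>\<^sub>0 'k) \<Rightarrow> ('x \<Rightarrow>\<^sub>0 'k)"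
  by unfold_locales (auto intro!: poly_mapping_eqI simp: lookup_add algebra_simps)

lemma poly_mapping_expand:
  "f = (\<Sum>x\<in>Poly_Mapping.keys f. Poly_Mapping.single x (Poly_Mapping.lookup f x))"
  by (rule poly_mapping_eqI)
    (auto simp: lookup_sum lookup_single when_def sum.If_cases in_keys_iff)

definition lin_ext :: "('x \<Rightarrow> ('y \<Rightarrow>\<^sub>0 'k::field)) \<Rightarrow> ('x \<Rightarrow>\<^sub>0 'k) \<Rightarrow> ('y \<Rightarrow>\<^sub>0 'k)" where
  "lin_ext h f = (\<Sum>x\<in>Poly_Mapping.keys f. fscale (Poly_Mapping.lookup f x) (h x))"


section \<open>Cyclic homology of an algebra\<close>

text \<open>A \<open>'k\<close>-algebra is a ring \<open>'a\<close> together with a scalar multiplication \<open>scale\<close>. Its tensor power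
  with \<open>n\<close> factors is the free vector space on the lists \<open>[a\<^sub>1, \<dots>, a\<^sub>n]\<close>, modulo multilinearity.\<close>

definition tensor_relators :: "('k::field \<Rightarrow> 'a::ring_1 \<Rightarrow> 'a) \<Rightarrow> nat \<Rightarrow> ('a list \<Rightarrow>\<^sub>0 'k) set" where
  "tensor_relators scale n =
    {Poly_Mapping.single (us @ (x + y) # vs) 1
       - Poly_Mapping.single (us @ x # vs) 1 - Poly_Mapping.single (us @ y # vs) 1
     | us x y vs. length us + 1 + length vs = n} \<union>
    {Poly_Mapping.single (us @ scale c x # vs) 1 - fscale c (Poly_Mapping.single (us @ x # vs) 1)
     | us c x vs. length us + 1 + length vs = n}"

definition tensor_null :: "('k::field \<Rightarrow> 'a::ring_1 \<Rightarrow> 'a) \<Rightarrow> nat \<Rightarrow> ('a list \<Rightarrow>\<^sub>0 'k) set" where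
  "tensor_null scale n = free_vs.span (tensor_relators scale n)"

definition tensor_power ::
    "('k::field \<Rightarrow> 'a::ring_1 \<Rightarrow> 'a) \<Rightarrow> nat \<Rightarrow> ('k, ('a list \<Rightarrow>\<^sub>0 'k) set) vspace" where
  "tensor_power scale n =
    quotient_vspace (sub_vspace fscale {f. \<forall>as\<in>Poly_Mapping.keys f. length as = n})
      (tensor_null scale n)"

text \<open>The map into the tensor power with \<open>n\<close> factors that a linear map \<open>F\<close> of the free vector spaces
  induces on cosets.\<close>

definition induced ::
    "('k::field \<Rightarrow> 'a::ring_1 \<Rightarrow> 'a) \<Rightarrow> nat \<Rightarrow> (('a list \<Rightarrow>\<^sub>0 'k) \<Rightarrow> ('a list \<Rightarrow>\<^sub>0 'k)) \<Rightarrow>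
     ('a list \<Rightarrow>\<^sub>0 'k) set \<Rightarrow> ('a list \<Rightarrow>\<^sub>0 'k) set" where
  "induced scale n F X = {F f + r | f r. f \<in> X \<and> r \<in> tensor_null scale n}"

text \<open>The operators of the cyclic bicomplex (Loday, Cyclic Homology, Section 2.1). A list
  \<open>[a\<^sub>0, \<dots>, a\<^sub>n]\<close> has length \<open>n + 1\<close>; \<open>face i\<close> multiplies \<open>a\<^sub>i\<close> and \<open>a\<^bsub>i+1\<^esub>\<close>, for \<open>i < n\<close>, and
  \<open>last_face\<close> gives \<open>[a\<^sub>n a\<^sub>0, a\<^sub>1, \<dots>, a\<^bsub>n-1\<^esub>]\<close>.\<close>

definition face :: "nat \<Rightarrow> 'a::ring_1 list \<Rightarrow> 'a list" where
  "face i as = take i as @ (as ! i * as ! Suc i) # drop (i + 2) as"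

definition last_face :: "'a::ring_1 list \<Rightarrow> 'a list" where
  "last_face as = (last as * hd as) # tl (butlast as)"

definition op_b' :: "('a::ring_1 list \<Rightarrow>\<^sub>0 'k::field) \<Rightarrow> ('a list \<Rightarrow>\<^sub>0 'k)" where
  "op_b' = lin_ext (\<lambda>as. \<Sum>i<length as - 1. Poly_Mapping.single (face i as) ((-1) ^ i))"

definition op_b :: "('a::ring_1 list \<Rightarrow>\<^sub>0 'k::field) \<Rightarrow> ('a list \<Rightarrow>\<^sub>0 'k)" where
  "op_b = lin_ext (\<lambda>as. (\<Sum>i<length as - 1. Poly_Mapping.single (face i as) ((-1) ^ i))
                        + Poly_Mapping.single (last_face as) ((-1) ^ (length as - 1)))"

definition op_t :: "('a list \<Rightarrow>\<^sub>0 'k::field) \<Rightarrow> ('a list \<Rightarrow>\<^sub>0 'k)" where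
  "op_t = lin_ext (\<lambda>as. Poly_Mapping.single (last as # butlast as) ((-1) ^ (length as - 1)))"

definition op_N :: "('a list \<Rightarrow>\<^sub>0 'k::field) \<Rightarrow> ('a list \<Rightarrow>\<^sub>0 'k)" where
  "op_N = lin_ext (\<lambda>as. \<Sum>i<length as. (op_t ^^ i) (Poly_Mapping.single as 1))"

text \<open>Column \<open>p\<close> of the bicomplex has the tensor power with \<open>q + 1\<close> factors in row \<open>q\<close>. The vertical
  maps in even and odd columns are \<open>b\<close> and \<open>-b'\<close>; the horizontal maps out of odd and (positive) even
  columns are \<open>1 - t\<close> and \<open>N\<close>.\<close>

definition vertical :: "nat \<Rightarrow> ('a::ring_1 list \<Rightarrow>\<^sub>0 'k::field) \<Rightarrow> ('a list \<Rightarrow>\<^sub>0 'k)" where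
  "vertical p f = (if even p then op_b f else - op_b' f)"

definition horizontal :: "nat \<Rightarrow> ('a list \<Rightarrow>\<^sub>0 'k::field) \<Rightarrow> ('a list \<Rightarrow>\<^sub>0 'k)" where
  "horizontal p f = (if even p then op_N f else f - op_t f)"

text \<open>In total degree \<open>n\<close>, the component with index \<open>p \<le> n\<close> is the one in column \<open>p\<close> and row
  \<open>n - p\<close>.\<close>

definition Tot :: "('k::field \<Rightarrow> 'a::ring_1 \<Rightarrow> 'a) \<Rightarrow> nat \<Rightarrow>
    ('k, nat \<Rightarrow> ('a list \<Rightarrow>\<^sub>0 'k) set) vspace" where
  "Tot scale n = Sum_vspace {..n} (\<lambda>p. tensor_power scale (n - p + 1))"

definition Tot_boundary :: "('k::field \<Rightarrow> 'a::ring_1 \<Rightarrow> 'a) \<Rightarrow> nat \<Rightarrow>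
    (nat \<Rightarrow> ('a list \<Rightarrow>\<^sub>0 'k) set) \<Rightarrow> (nat \<Rightarrow> ('a list \<Rightarrow>\<^sub>0 'k) set)" where
  "Tot_boundary scale n x = (\<lambda>p\<in>{..<n}. vadd (tensor_power scale (n - p))
     (induced scale (n - p) (vertical p) (x p))
     (induced scale (n - p) (horizontal (p + 1)) (x (p + 1))))"

definition Tot_cycles :: "('k::field \<Rightarrow> 'a::ring_1 \<Rightarrow> 'a) \<Rightarrow> nat \<Rightarrow>
    (nat \<Rightarrow> ('a list \<Rightarrow>\<^sub>0 'k) set) set" where
  "Tot_cycles scale n = {x \<in> vcarrier (Tot scale n).
     \<forall>p<n. Tot_boundary scale n x p = vzero (tensor_power scale (n - p))}"

definition cyclic_homology :: "('k::field \<Rightarrow> 'a::ring_1 \<Rightarrow> 'a) \<Rightarrow> nat \<Rightarrow>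
    ('k, (nat \<Rightarrow> ('a list \<Rightarrow>\<^sub>0 'k) set) set) vspace" where
  "cyclic_homology scale n =
     quotient_vspace ((Tot scale n)\<lparr>vcarrier := Tot_cycles scale n\<rparr>)
       (Tot_boundary scale (Suc n) ` vcarrier (Tot scale (Suc n)))"


section \<open>The Pareigis Hopf algebra\<close>

text \<open>Words in an alphabet form a monoid under concatenation, so that the convolution product makes
  \<open>'x fword \<Rightarrow>\<^sub>0 'k\<close> the free associative \<open>'k\<close>-algebra on \<open>'x\<close>.\<close>

datatype 'x fword = FWord (letters: "'x list")

instantiation fword :: (type) monoid_add
begin

definition zero_fword :: "'a fword" where "0 = FWord []"
definition plus_fword :: "'a fword \<Rightarrow> 'a fword \<Rightarrow> 'a fword" where
  "u + v = FWord (letters u @ letters v)"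

instance
  by standard (simp_all add: zero_fword_def plus_fword_def)

end

definition fgen :: "'x \<Rightarrow> ('x fword \<Rightarrow>\<^sub>0 'k::field)" where
  "fgen x = Poly_Mapping.single (FWord [x]) 1"

definition two_sided_ideal :: "'a::ring_1 set \<Rightarrow> bool" where
  "two_sided_ideal I \<longleftrightarrow> 0 \<in> I \<and> (\<forall>x\<in>I. \<forall>y\<in>I. x + y \<in> I) \<and>
     (\<forall>a. \<forall>x\<in>I. a * x \<in> I \<and> x * a \<in> I)"

datatype pareigis_gen = Gen_s | Gen_t | Gen_tinv

definition pareigis_relators :: "(pareigis_gen fword \<Rightarrow>\<^sub>0 'k::field) set" where
  "pareigis_relators =
    {fgen Gen_t * fgen Gen_tinv - 1, fgen Gen_tinv * fgen Gen_t - 1,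
     fgen Gen_s * fgen Gen_s, fgen Gen_s * fgen Gen_t + fgen Gen_t * fgen Gen_s}"

definition pareigis_ideal :: "(pareigis_gen fword \<Rightarrow>\<^sub>0 'k::field) set" where
  "pareigis_ideal = two_sided_ideal hull pareigis_relators"

lemma two_sided_ideal_pareigis_ideal: "two_sided_ideal pareigis_ideal"
  unfolding pareigis_ideal_def by (rule hull_in) (auto simp: two_sided_ideal_def)

lemma pareigis_ideal_zero: "0 \<in> pareigis_ideal"
  and pareigis_ideal_add: "x \<in> pareigis_ideal \<Longrightarrow> y \<in> pareigis_ideal \<Longrightarrow> x + y \<in> pareigis_ideal"
  and pareigis_ideal_mult_left: "x \<in> pareigis_ideal \<Longrightarrow> a * x \<in> pareigis_ideal"
  and pareigis_ideal_mult_right: "x \<in> pareigis_ideal \<Longrightarrow> x * a \<in> pareigis_ideal"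
  using two_sided_ideal_pareigis_ideal by (auto simp: two_sided_ideal_def)

lemma pareigis_ideal_minus: "x \<in> pareigis_ideal \<Longrightarrow> - x \<in> pareigis_ideal"
  using pareigis_ideal_mult_left[of x "- 1"] by simp

definition pareigis_rel ::
    "(pareigis_gen fword \<Rightarrow>\<^sub>0 'k::field) \<Rightarrow> (pareigis_gen fword \<Rightarrow>\<^sub>0 'k) \<Rightarrow> bool" where
  "pareigis_rel x y \<longleftrightarrow> x - y \<in> pareigis_ideal"

quotient_type (overloaded) 'k pareigis = "pareigis_gen fword \<Rightarrow>\<^sub>0 'k::field" / pareigis_rel
proof (rule equivpI)
  show "reflp (pareigis_rel :: (_ \<Rightarrow>\<^sub>0 'k) \<Rightarrow> _)"
    by (rule reflpI) (simp add: pareigis_rel_def pareigis_ideal_zero)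
  show "symp (pareigis_rel :: (_ \<Rightarrow>\<^sub>0 'k) \<Rightarrow> _)"
  proof (rule sympI)
    fix x y :: "pareigis_gen fword \<Rightarrow>\<^sub>0 'k"
    assume "pareigis_rel x y"
    then show "pareigis_rel y x"
      using pareigis_ideal_minus[of "x - y"] by (simp add: pareigis_rel_def)
  qed
  show "transp (pareigis_rel :: (_ \<Rightarrow>\<^sub>0 'k) \<Rightarrow> _)"
  proof (rule transpI)
    fix x y z :: "pareigis_gen fword \<Rightarrow>\<^sub>0 'k"
    assume "pareigis_rel x y" "pareigis_rel y z"
    then show "pareigis_rel x z"
      using pareigis_ideal_add[of "x - y" "y - z"] by (simp add: pareigis_rel_def)
  qed
qed

text \<open>The quotient is nonzero: the linear functional given by the algebra map \<open>s \<mapsto> 0\<close>,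
  \<open>t \<mapsto> 1\<close>, \<open>t\<inverse> \<mapsto> 1\<close> kills the ideal.\<close>

definition pareigis_aug :: "(pareigis_gen fword \<Rightarrow>\<^sub>0 'k::field) \<Rightarrow> 'k" where
  "pareigis_aug f =
    (\<Sum>w\<in>Poly_Mapping.keys f. Poly_Mapping.lookup f w * (if Gen_s \<in> set (letters w) then 0 else 1))"

lemma pareigis_aug_superset:
  assumes "finite A" "Poly_Mapping.keys f \<subseteq> A"
  shows "pareigis_aug f =
    (\<Sum>w\<in>A. Poly_Mapping.lookup f w * (if Gen_s \<in> set (letters w) then 0 else 1))"
  unfolding pareigis_aug_def
  using assms by (intro sum.mono_neutral_left) (auto simp: in_keys_iff)

lemma pareigis_aug_zero [simp]: "pareigis_aug 0 = 0"
  by (simp add: pareigis_aug_def)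

lemma pareigis_aug_add: "pareigis_aug (f + g) = pareigis_aug f + pareigis_aug g"
proof -
  let ?A = "Poly_Mapping.keys f \<union> Poly_Mapping.keys g"
  have "Poly_Mapping.keys (f + g) \<subseteq> ?A"
    by (rule Poly_Mapping.keys_add)
  then show ?thesis
    by (subst (1 2 3) pareigis_aug_superset[of ?A])
      (auto simp: lookup_add algebra_simps sum.distrib)
qed

lemma pareigis_aug_sum: "pareigis_aug (sum h A) = (\<Sum>x\<in>A. pareigis_aug (h x))"
  by (induction A rule: infinite_finite_induct) (simp_all add: pareigis_aug_add)

lemma pareigis_aug_single:
  "pareigis_aug (Poly_Mapping.single w c) = c * (if Gen_s \<in> set (letters w) then 0 else 1)"
  by (subst pareigis_aug_superset[of "{w}"]) auto

lemma pareigis_aug_mult: "pareigis_aug (f * g) = pareigis_aug f * pareigis_aug g"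
proof -
  have *: "pareigis_aug (Poly_Mapping.single u c * Poly_Mapping.single v d) =
      pareigis_aug (Poly_Mapping.single u c) * pareigis_aug (Poly_Mapping.single v d)"
    for u v and c d :: 'a
    by (simp add: mult_single pareigis_aug_single plus_fword_def)
  show ?thesis
    by (subst (1 2) poly_mapping_expand[of f], subst (1 2) poly_mapping_expand[of g])
      (simp only: sum_product pareigis_aug_sum *)
qed

lemma one_notin_pareigis_ideal: "(1 :: pareigis_gen fword \<Rightarrow>\<^sub>0 'k::field) \<notin> pareigis_ideal"
proof
  have "set (letters (0 :: pareigis_gen fword)) = {}"
    by (simp add: zero_fword_def)
  then have one: "pareigis_aug (1 :: pareigis_gen fword \<Rightarrow>\<^sub>0 'k) = 1"
    using pareigis_aug_single[of 0 "1::'k"] by simp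
  have gen: "pareigis_aug (fgen x :: _ \<Rightarrow>\<^sub>0 'k) = (if x = Gen_s then 0 else 1)" for x
    by (auto simp: fgen_def pareigis_aug_single)
  have diff: "pareigis_aug (f - g) = pareigis_aug f - pareigis_aug g"
    for f g :: "pareigis_gen fword \<Rightarrow>\<^sub>0 'k"
    using pareigis_aug_add[of "f - g" g] by simp
  have "two_sided_ideal {f :: pareigis_gen fword \<Rightarrow>\<^sub>0 'k. pareigis_aug f = 0}"
    by (auto simp: two_sided_ideal_def pareigis_aug_add pareigis_aug_mult)
  moreover have "pareigis_relators \<subseteq> {f :: pareigis_gen fword \<Rightarrow>\<^sub>0 'k. pareigis_aug f = 0}"
    by (auto simp: pareigis_relators_def pareigis_aug_add pareigis_aug_mult diff one gen)
  ultimately have "pareigis_ideal \<subseteq> {f :: pareigis_gen fword \<Rightarrow>\<^sub>0 'k. pareigis_aug f = 0}"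
    unfolding pareigis_ideal_def by (rule hull_minimal[rotated])
  moreover assume "(1 :: pareigis_gen fword \<Rightarrow>\<^sub>0 'k) \<in> pareigis_ideal"
  ultimately show False using one by auto
qed

instantiation pareigis :: (field) ring_1
begin

lift_definition zero_pareigis :: "'a pareigis" is 0 .
lift_definition one_pareigis :: "'a pareigis" is 1 .
lift_definition plus_pareigis :: "'a pareigis \<Rightarrow> 'a pareigis \<Rightarrow> 'a pareigis" is "(+)"
  unfolding pareigis_rel_def by (drule (1) pareigis_ideal_add) (simp add: algebra_simps)
lift_definition uminus_pareigis :: "'a pareigis \<Rightarrow> 'a pareigis" is uminus
  unfolding pareigis_rel_def by (drule pareigis_ideal_minus) (simp add: algebra_simps)
lift_definition minus_pareigis :: "'a pareigis \<Rightarrow> 'a pareigis \<Rightarrow> 'a pareigis" is "(-)"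
proof -
  fix a b c d :: "pareigis_gen fword \<Rightarrow>\<^sub>0 'a"
  assume "pareigis_rel a b" "pareigis_rel c d"
  then have "(a - b) + - (c - d) \<in> pareigis_ideal"
    unfolding pareigis_rel_def by (intro pareigis_ideal_add pareigis_ideal_minus)
  then show "pareigis_rel (a - c) (b - d)"
    by (simp add: pareigis_rel_def algebra_simps)
qed
lift_definition times_pareigis :: "'a pareigis \<Rightarrow> 'a pareigis \<Rightarrow> 'a pareigis" is "(*)"
proof -
  fix a b c d :: "pareigis_gen fword \<Rightarrow>\<^sub>0 'a"
  assume "pareigis_rel a b" "pareigis_rel c d"
  then have "(a - b) * c + b * (c - d) \<in> pareigis_ideal"
    unfolding pareigis_rel_def
    by (intro pareigis_ideal_add pareigis_ideal_mult_left pareigis_ideal_mult_right)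
  then show "pareigis_rel (a * c) (b * d)"
    by (simp add: pareigis_rel_def algebra_simps)
qed

instance
proof
  show "(0 :: 'a pareigis) \<noteq> 1"
    by transfer
      (use one_notin_pareigis_ideal pareigis_ideal_minus in \<open>fastforce simp: pareigis_rel_def\<close>)
qed (transfer; simp add: pareigis_rel_def pareigis_ideal_zero algebra_simps)+

end

lemma fscale_eq_mult_left: "fscale c f = Poly_Mapping.single 0 c * f"
  for f :: "'x fword \<Rightarrow>\<^sub>0 'k::field"
  by (simp add: fscale_def mult_map_scale_conv_mult)

lift_definition pareigis_scale :: "'k::field \<Rightarrow> 'k pareigis \<Rightarrow> 'k pareigis" is fscale
  unfolding pareigis_rel_def fscale_eq_mult_left
  by (simp add: pareigis_ideal_mult_left flip: right_diff_distrib)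

lemma vector_space_pareigis_scale: "vector_space pareigis_scale"
  by unfold_locales
    (transfer; simp add: pareigis_rel_def pareigis_ideal_zero
       free_vs.scale_right_distrib free_vs.scale_left_distrib)+

lemma fscale_mult_left: "fscale c (f * g) = fscale c f * g"
  for f g :: "'x fword \<Rightarrow>\<^sub>0 'k::field"
  by (simp add: fscale_eq_mult_left mult.assoc)

lemma fscale_mult_right: "fscale c (f * g) = f * fscale c g"
  for f g :: "'x fword \<Rightarrow>\<^sub>0 'k::field"
proof -
  have "fscale c f = f * Poly_Mapping.single 0 c"
  proof -
    show ?thesis unfolding fscale_eq_mult_left
      by (subst (1 2) poly_mapping_expand[of f]) (simp add: sum_distrib_left sum_distrib_right mult_single mult.commute)
  qed
  then show ?thesis
    by (metis fscale_eq_mult_left mult.assoc)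
qed

lemma pareigis_scale_mult:
  "pareigis_scale c (x * y) = pareigis_scale c x * y"
  "pareigis_scale c (x * y) = x * pareigis_scale c y"
  by (transfer; simp add: pareigis_rel_def pareigis_ideal_zero flip: fscale_mult_left
        fscale_mult_right)+


section \<open>Laurent polynomials\<close>

text \<open>\<open>int \<Rightarrow>\<^sub>0 'k\<close> with the convolution product is \<open>k[t, t\<inverse>]\<close>; the power \<open>t\<^sup>r\<close> is
  \<open>Poly_Mapping.single r 1\<close>.\<close>

definition laurent :: "('k::field, int \<Rightarrow>\<^sub>0 'k) vspace" where
  "laurent = sub_vspace fscale UNIV"

definition laurent_odd :: "('k::field, int \<Rightarrow>\<^sub>0 'k) vspace" where
  "laurent_odd = sub_vspace fscale (free_vs.span {Poly_Mapping.single r 1 | r. odd r})"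

definition ground_field :: "('k::field, 'k) vspace" where
  "ground_field = sub_vspace (*) UNIV"

end

theory Submission
  imports Defs "HOL-Library.Product_Plus"
begin

text \<open>
  The monomials \<open>s\<^sup>j t\<^sup>x\<close> with \<open>j \<le> 1\<close> are a basis of the algebra, and the product of two of them is
  zero or, up to sign, a third one. So the tensor powers have words of monomials as bases, and the
  cyclic bicomplex becomes a complex of words (\<open>Tot_boundary_Theta\<close>). Every operator preserves the
  number \<open>m\<close> of factors \<open>s\<close> in a word, its weight, and the weights can be treated one at a time.

  For weight \<open>m > 0\<close>: the rows of the bicomplex are exact in characteristic 0, so only column 0 modulo
  \<open>b\<close> and \<open>1 - t\<close> matters (\<open>zigzag\<close>). Since \<open>s\<^sup>2 = 0\<close>, the words that begin with an \<open>s\<close> span a subcomplex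
  of the Hochschild complex. If \<open>z\<close> is a cycle modulo \<open>1 - t\<close>, then the part of the norm \<open>N z\<close> in this
  subcomplex is a genuine Hochschild cycle (\<open>hoch_head_part\<close>), and it is congruent to \<open>m z\<close>
  (\<open>head_part_N_cong\<close>). Inside the subcomplex, the powers of \<open>t\<close> between two factors \<open>s\<close> form a bar
  resolution of \<open>T\<close> and can be contracted, one gap after the other. This leaves the Hochschild complex
  of \<open>T\<close> with coefficients in a bimodule on which left and right multiplication by \<open>t\<close> differ by the
  sign \<open>(-1)\<^sup>m\<close>. It is acyclic for odd \<open>m\<close>; for even \<open>m\<close> its homology is \<open>T\<close> in each of the degrees
  \<open>m - 1\<close> and \<open>m\<close> and is detected by the functional \<open>phi\<close> (\<open>hochschild_boundary\<close>). Rotating the word by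
  one factor \<open>s\<close> multiplies the class \<open>t\<^sup>r\<close> by \<open>- (-1)\<^sup>r\<close>. So in cyclic homology the classes with even
  \<open>r\<close> die (\<open>even_representative\<close>) and those with odd \<open>r\<close> survive (\<open>monomial_odd_cycle\<close>). In degree
  \<open>n > 0\<close> exactly one weight contributes, the even one of \<open>n\<close> and \<open>n + 1\<close>, and it contributes
  \<open>T\<^sub>o\<^sub>d\<close>.

  Weight 0 is the cyclic homology of \<open>T\<close>. The Hochschild homology of \<open>T\<close> vanishes above degree 1, so
  deleting the first two columns does not change the homology in large degrees (\<open>periodicity_inj\<close>,
  \<open>periodicity_surj\<close>). In degrees 1 and 2 the classes of \<open>t\<^sup>r\<close> with \<open>r \<noteq> 0\<close> disappear because Connes'
  operator multiplies them by \<open>r\<close>. This leaves \<open>T\<close> in degree 0 and \<open>k\<close> in every positive degree.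
\<close>

section \<open>Linear maps of free vector spaces\<close>

abbreviation lin :: "(('x \<Rightarrow>\<^sub>0 'k::field) \<Rightarrow> ('y \<Rightarrow>\<^sub>0 'k)) \<Rightarrow> bool" where
  "lin \<equiv> Vector_Spaces.linear fscale fscale"

abbreviation sg :: "'x \<Rightarrow> ('x \<Rightarrow>\<^sub>0 'k::field)" where
  "sg x \<equiv> Poly_Mapping.single x 1"

lemma linI:
  assumes "\<And>f g. F (f + g) = F f + F g" "\<And>c f. F (fscale c f) = fscale c (F f)"
  shows "lin F"
  using assms by (simp add: Vector_Spaces.linear_iff free_vs.vector_space_axioms)

lemma lin_module_hom: "lin F \<Longrightarrow> module_hom fscale fscale F"
  by (simp add: Vector_Spaces.linear_iff_module_hom)

lemmas lin_0 = module_hom.zero[OF lin_module_hom]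
  and lin_add = module_hom.add[OF lin_module_hom]
  and lin_diff = module_hom.diff[OF lin_module_hom]
  and lin_uminus = module_hom.neg[OF lin_module_hom]
  and lin_scale = module_hom.scale[OF lin_module_hom]
  and lin_sum = module_hom.sum[OF lin_module_hom]

named_theorems lin_intros

lemma fscale_single: "fscale c (Poly_Mapping.single x d) = Poly_Mapping.single x (c * d)"
  by (rule poly_mapping_eqI) (simp add: lookup_single when_def)

lemma lin_ident [lin_intros]: "lin (\<lambda>f. f)"
  and lin_zero [lin_intros]: "lin (\<lambda>f. 0)"
  by (auto intro!: linI)

lemma lin_comp: "lin F \<Longrightarrow> lin G \<Longrightarrow> lin (\<lambda>f. F (G f))"
  by (auto intro!: linI simp: lin_add lin_scale)

lemma lin_plus [lin_intros]: "lin F \<Longrightarrow> lin G \<Longrightarrow> lin (\<lambda>f. F f + G f)"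
  and lin_minus [lin_intros]: "lin F \<Longrightarrow> lin G \<Longrightarrow> lin (\<lambda>f. F f - G f)"
  and lin_neg [lin_intros]: "lin F \<Longrightarrow> lin (\<lambda>f. - F f)"
  and lin_fscale [lin_intros]: "lin F \<Longrightarrow> lin (\<lambda>f. fscale c (F f))"
  by (auto intro!: linI simp: lin_add lin_scale free_vs.scale_right_distrib
      free_vs.scale_right_diff_distrib free_vs.scale_left_commute)

lemma lin_Sum [lin_intros]: "(\<And>i. i \<in> I \<Longrightarrow> lin (F i)) \<Longrightarrow> lin (\<lambda>f. \<Sum>i\<in>I. F i f)"
  by (induction I rule: infinite_finite_induct) (auto intro: lin_zero lin_plus)

lemma lin_funpow: "lin F \<Longrightarrow> lin (F ^^ i)"
  for F :: "('x \<Rightarrow>\<^sub>0 'k::field) \<Rightarrow> ('x \<Rightarrow>\<^sub>0 'k)"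
  by (induction i) (auto intro!: linI simp: lin_add lin_scale)

lemma lin_if [lin_intros]: "lin F \<Longrightarrow> lin G \<Longrightarrow> lin (\<lambda>f. if P then F f else G f)"
  by (cases P) simp_all

lemma lin_ext_superset:
  assumes "finite A" "Poly_Mapping.keys f \<subseteq> A"
  shows "lin_ext h f = (\<Sum>x\<in>A. fscale (Poly_Mapping.lookup f x) (h x))"
  unfolding lin_ext_def
  using assms by (intro sum.mono_neutral_left) (auto simp: in_keys_iff)

lemma lin_lin_ext: "lin (lin_ext h)" for h :: "'x \<Rightarrow> ('y \<Rightarrow>\<^sub>0 'k::field)"
proof (rule linI)
  fix f g :: "'x \<Rightarrow>\<^sub>0 'k"
  let ?A = "Poly_Mapping.keys f \<union> Poly_Mapping.keys g"
  have "Poly_Mapping.keys (f + g) \<subseteq> ?A"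
    by (rule Poly_Mapping.keys_add)
  then show "lin_ext h (f + g) = lin_ext h f + lin_ext h g"
    by (subst (1 2 3) lin_ext_superset[of ?A])
      (auto simp: lookup_add free_vs.scale_left_distrib sum.distrib)
next
  fix c :: 'k and f :: "'x \<Rightarrow>\<^sub>0 'k"
  have "Poly_Mapping.keys (fscale c f) \<subseteq> Poly_Mapping.keys f"
    by (auto simp: in_keys_iff)
  then show "lin_ext h (fscale c f) = fscale c (lin_ext h f)"
    by (subst (1 2) lin_ext_superset[of "Poly_Mapping.keys f"])
      (auto simp: free_vs.scale_sum_right)
qed

lemma lin_ext_single [simp]: "lin_ext h (Poly_Mapping.single x c) = fscale c (h x)"
  by (subst lin_ext_superset[of "{x}"]) auto

lemma lin_single: "lin F \<Longrightarrow> F (Poly_Mapping.single x c) = fscale c (F (sg x))"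
  using lin_scale[of F c "sg x"] by (simp add: fscale_single)

lemma lin_expand:
  assumes "lin F"
  shows "F f = (\<Sum>x\<in>Poly_Mapping.keys f. fscale (Poly_Mapping.lookup f x) (F (sg x)))"
proof -
  have "F f = F (\<Sum>x\<in>Poly_Mapping.keys f. Poly_Mapping.single x (Poly_Mapping.lookup f x))"
    by (rule arg_cong[OF poly_mapping_expand])
  also have "\<dots> = (\<Sum>x\<in>Poly_Mapping.keys f. fscale (Poly_Mapping.lookup f x) (F (sg x)))"
    unfolding lin_sum[OF assms] by (intro sum.cong refl lin_single assms)
  finally show ?thesis .
qed

lemma lin_eqI:
  assumes "lin F" "lin G" "\<And>x. x \<in> Poly_Mapping.keys f \<Longrightarrow> F (sg x) = G (sg x)"
  shows "F f = G f"
  unfolding lin_expand[OF assms(1), of f] lin_expand[OF assms(2), of f]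
  by (intro sum.cong refl) (simp add: assms(3))

lemma lin_eq_0I:
  assumes "lin F" "\<And>x. x \<in> Poly_Mapping.keys f \<Longrightarrow> F (sg x) = 0"
  shows "F f = 0"
  unfolding lin_expand[OF assms(1), of f]
  by (intro sum.neutral) (simp add: assms(2))

lemma lin_in_subspace:
  assumes "lin F" "free_vs.subspace S" "\<And>x. x \<in> Poly_Mapping.keys f \<Longrightarrow> F (sg x) \<in> S"
  shows "F f \<in> S"
  by (subst lin_expand[OF assms(1)])
    (intro free_vs.subspace_sum free_vs.subspace_scale assms)

text \<open>The coordinate subspace on a set of basis elements; all chain groups have this form.\<close>

definition supp :: "'x set \<Rightarrow> ('x \<Rightarrow>\<^sub>0 'k::field) set" where
  "supp S = {f. Poly_Mapping.keys f \<subseteq> S}"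

lemma subspace_supp: "free_vs.subspace (supp S)"
  unfolding free_vs.subspace_def supp_def subset_iff mem_Collect_eq in_keys_iff
  by (auto simp: lookup_add) (metis add.right_neutral)

lemmas supp_0 [simp] = free_vs.subspace_0[OF subspace_supp]
  and supp_add = free_vs.subspace_add[OF subspace_supp]
  and supp_diff = free_vs.subspace_diff[OF subspace_supp]
  and supp_neg = free_vs.subspace_neg[OF subspace_supp]
  and supp_scale = free_vs.subspace_scale[OF subspace_supp]
  and supp_sum = free_vs.subspace_sum[OF subspace_supp]

lemma supp_single: "x \<in> S \<Longrightarrow> Poly_Mapping.single x c \<in> supp S"
  by (simp add: supp_def)

lemma supp_mono: "f \<in> supp S \<Longrightarrow> S \<subseteq> T \<Longrightarrow> f \<in> supp T"
  by (auto simp: supp_def)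

lemma lin_eq_on_supp:
  assumes "f \<in> supp S" "lin F" "lin G" "\<And>x. x \<in> S \<Longrightarrow> F (sg x) = G (sg x)"
  shows "F f = G f"
proof (rule lin_eqI[OF assms(2,3)])
  show "F (sg x) = G (sg x)" if "x \<in> Poly_Mapping.keys f" for x
    using that assms(1,4) by (auto simp: supp_def)
qed

lemma lin_0_on_supp:
  assumes "f \<in> supp S" "lin F" "\<And>x. x \<in> S \<Longrightarrow> F (sg x) = 0"
  shows "F f = 0"
  using lin_eq_on_supp[OF assms(1,2) lin_zero assms(3)] by simp

lemma lin_maps_supp:
  assumes "f \<in> supp S" "lin F" "\<And>x. x \<in> S \<Longrightarrow> F (sg x) \<in> V" "free_vs.subspace V"
  shows "F f \<in> V"
proof (rule lin_in_subspace[OF assms(2,4)])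
  show "F (sg x) \<in> V" if "x \<in> Poly_Mapping.keys f" for x
    using that assms(1,3) by (auto simp: supp_def)
qed

lemma supp_empty: "f \<in> supp {} \<Longrightarrow> f = 0"
  by (simp add: supp_def)

section \<open>The Hochschild operators on words\<close>

text \<open>The letter \<open>(j, x)\<close> stands for \<open>s\<^sub>j t\<^sup>x\<close>. The algebra itself needs only \<open>s\<^sub>0 = 1\<close> and \<open>s\<^sub>1 = s\<close>; larger \<open>j\<close> occur
  when factors \<open>s\<close> are merged, \<open>s\<^sub>j\<close> being a formal product of \<open>j\<close> of them, with \<open>t s\<^sub>j = (-1)\<^sup>j s\<^sub>j t\<close>.
  A letter is called pure if \<open>j = 0\<close>.\<close>

type_synonym letter = "nat \<times> int"

type_synonym 'k chain = "letter list \<Rightarrow>\<^sub>0 'k"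

definition parity :: "int \<Rightarrow> 'k::field" where
  "parity z = (if even z then 1 else - 1)"

lemma parity_add: "parity (x + y) = parity x * parity y"
  and parity_0 [simp]: "parity 0 = 1"
  and parity_square [simp]: "parity x * parity x = 1" "parity x * (parity x * z) = z"
  and parity_nonzero [simp]: "parity x \<noteq> 0"
  by (auto simp: parity_def)

text \<open>The sign that arises when the power of \<open>t\<close> in the first letter moves past the \<open>s\<^sub>j\<close> of the second.\<close>

definition twist :: "letter \<Rightarrow> letter \<Rightarrow> 'k::field" where
  "twist a c = parity (snd a * int (fst c))"

text \<open>The product of two letters is their componentwise sum times this coefficient; it is zero on two
  nonpure letters because \<open>s\<^sup>2 = 0\<close>.\<close>

definition coef :: "letter \<Rightarrow> letter \<Rightarrow> 'k::field" where
  "coef a c = (if fst a > 0 \<and> fst c > 0 then 0 else twist a c)"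

lemma twist_add_left: "twist (a + c) d = twist a d * twist c d"
  and twist_add_right: "twist a (c + d) = twist a c * twist a d"
  by (simp_all add: twist_def distrib_right distrib_left parity_add)

lemma twist_pure [simp]: "fst c = 0 \<Longrightarrow> twist a c = 1"
  and twist_no_t [simp]: "snd a = 0 \<Longrightarrow> twist a c = 1"
  by (simp_all add: twist_def)

lemma coef_assoc: "coef a c * coef (a + c) d = coef c d * coef a (c + d)"
  by (auto simp: coef_def twist_add_left twist_add_right)

lemma coef_unit [simp]: "coef (0, 0) c = 1" "coef a (0, 0) = 1"
  by (simp_all add: coef_def)

definition cons :: "'x \<Rightarrow> ('x list \<Rightarrow>\<^sub>0 'k::field) \<Rightarrow> ('x list \<Rightarrow>\<^sub>0 'k)" where
  "cons a = lin_ext (\<lambda>w. sg (a # w))"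

definition snoc :: "'x \<Rightarrow> ('x list \<Rightarrow>\<^sub>0 'k::field) \<Rightarrow> ('x list \<Rightarrow>\<^sub>0 'k)" where
  "snoc a = lin_ext (\<lambda>w. sg (w @ [a]))"

fun lmul_list :: "letter \<Rightarrow> letter list \<Rightarrow> 'k::field chain" where
  "lmul_list a [] = 0"
| "lmul_list a (c # w) = Poly_Mapping.single ((a + c) # w) (coef a c)"

definition lmul :: "letter \<Rightarrow> 'k::field chain \<Rightarrow> 'k chain" where
  "lmul a = lin_ext (lmul_list a)"

text \<open>This is \<open>b'\<close>. The recursion on the word, in place of a sum over faces, turns the identities below
  into inductions on words.\<close>

fun bar_list :: "letter list \<Rightarrow> 'k::field chain" where
  "bar_list [] = 0"
| "bar_list [a] = 0"
| "bar_list (a # c # w) = lmul_list a (c # w) - cons a (bar_list (c # w))"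

definition bar :: "'k::field chain \<Rightarrow> 'k chain" where
  "bar = lin_ext bar_list"

text \<open>The cyclic face. On words of length one it is set to 0, so that the Hochschild boundary vanishes in
  degree 0 and being a cycle is no condition there.\<close>

definition wrap_list :: "letter list \<Rightarrow> 'k::field chain" where
  "wrap_list as = (if length as < 2 then 0 else lmul_list (last as) (butlast as))"

definition wrap :: "'k::field chain \<Rightarrow> 'k chain" where
  "wrap = lin_ext wrap_list"

definition hoch :: "'k::field chain \<Rightarrow> 'k chain" where
  "hoch = lin_ext (\<lambda>as. bar_list as + fscale ((- 1) ^ (length as - 1)) (wrap_list as))"

lemma lin_ops: "lin (cons a)" "lin (snoc a)" "lin (lmul l)" "lin bar" "lin wrap" "lin hoch"
  "lin op_t" "lin op_N"
  by (simp_all add: cons_def snoc_def lmul_def bar_def wrap_def hoch_def op_t_def op_N_def lin_lin_ext)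

lemmas [lin_intros] = lin_ops[THEN lin_comp] lin_lin_ext[THEN lin_comp]

lemma fscale_1 [simp]: "fscale 1 f = f"
  and fscale_0 [simp]: "fscale 0 f = 0"
  and fscale_fscale [simp]: "fscale c (fscale d f) = fscale (c * d) f"
  and fscale_m1: "fscale (- 1) f = - f"
  and fscale_neg: "fscale (- c) f = - fscale c f"
  by simp_all

lemma cons_single [simp]: "cons a (Poly_Mapping.single w c) = Poly_Mapping.single (a # w) c"
  and snoc_single [simp]: "snoc a (Poly_Mapping.single w c) = Poly_Mapping.single (w @ [a]) c"
  by (simp_all add: cons_def snoc_def fscale_single)

lemma lmul_Cons: "lmul a (Poly_Mapping.single (c # w) d) = Poly_Mapping.single ((a + c) # w) (d * coef a c)"
  and lmul_Nil: "lmul a (Poly_Mapping.single [] d) = 0"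
  by (simp_all add: lmul_def fscale_single)

lemma bar_Nil: "bar (Poly_Mapping.single [] d) = 0"
  and bar_singleton: "bar (Poly_Mapping.single [a] d) = 0"
  by (simp_all add: bar_def)

lemmas cons_add = lin_add[OF lin_ops(1)]
  and cons_diff = lin_diff[OF lin_ops(1)]
  and cons_scale = lin_scale[OF lin_ops(1)]
  and cons_sum = lin_sum[OF lin_ops(1)]
  and cons_uminus = lin_uminus[OF lin_ops(1)]
  and cons_zero = lin_0[OF lin_ops(1)]

lemma bar_cons: "bar (cons a f) = lmul a f - cons a (bar f)"
proof (rule lin_eqI[where f = f])
  fix w show "bar (cons a (sg w)) = (lmul a (sg w) - cons a (bar (sg w)) :: 'a chain)"
    by (cases w) (simp_all add: bar_def lmul_def cons_zero cons_def[symmetric])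
qed (intro lin_intros)+

lemma bar_Cons: "bar (sg (a # w)) = lmul a (sg w) - cons a (bar (sg w))"
  using bar_cons[of a "sg w"] by simp

lemma cons_lmul: "lmul a (cons c f) = fscale (coef a c) (cons (a + c) f)"
proof (rule lin_eqI[where f = f])
  show "lmul a (cons c (sg w)) = fscale (coef a c) (cons (a + c) (sg w))" for w
    by (simp add: lmul_Cons fscale_single)
qed (intro lin_intros)+

lemmas bar_diff = lin_diff[OF lin_ops(4)]
  and bar_scale = lin_scale[OF lin_ops(4)]
  and bar_uminus = lin_uminus[OF lin_ops(4)]
  and bar_zero = lin_0[OF lin_ops(4)]

lemmas lmul_diff = lin_diff[OF lin_ops(3)]
  and lmul_zero = lin_0[OF lin_ops(3)]

lemma bar_lmul: "bar (lmul a (sg (c # w))) = lmul a (bar (sg (c # w)))"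
proof (cases w)
  case w: (Cons d v)
  have lm: "lmul a (lmul c (sg w)) = fscale (coef a c) (lmul (a + c) (sg w))"
    by (simp add: w lmul_Cons fscale_single add.assoc coef_assoc)
  have "bar (lmul a (sg (c # w))) = fscale (coef a c) (bar (cons (a + c) (sg w)))"
    by (simp add: lmul_Cons fscale_single flip: bar_scale)
  also have "\<dots> = lmul a (bar (cons c (sg w)))"
    unfolding bar_cons lmul_diff cons_lmul free_vs.scale_right_diff_distrib lm ..
  finally show ?thesis by simp
qed (simp add: lmul_Cons bar_singleton lmul_zero)

lemma bar_bar: "bar (bar f) = 0"
proof (rule lin_eq_0I[where f = f])
  fix w show "bar (bar (sg w)) = (0 :: 'a chain)"
  proof (induction w)
    case (Cons a w)
    note IH = Cons.IH
    show ?case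
    proof (cases w)
      case (Cons c v)
      have "bar (bar (sg (a # w)) :: 'a chain) = bar (lmul a (sg w)) - (lmul a (bar (sg w)) - cons a (bar (bar (sg w))))"
        by (simp add: bar_Cons[of a w] bar_diff bar_cons)
      then show ?thesis
        unfolding IH cons_zero by (simp add: bar_lmul Cons)
    qed (simp add: bar_singleton bar_zero)
  qed (simp add: bar_Nil bar_zero)
qed (intro lin_intros)+

lemma cons_snoc: "cons a (snoc y f) = snoc y (cons a f)"
proof (rule lin_eqI[where f = f])
  show "cons a (snoc y (sg w)) = snoc y (cons a (sg w))" for w
    by simp
qed (intro lin_intros)+

lemmas snoc_diff = lin_diff[OF lin_ops(2)]
  and snoc_zero = lin_0[OF lin_ops(2)]

text \<open>The counterpart at the right end of the recursion that defines \<open>b'\<close>. Rotation and the cyclic face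
  act at this end.\<close>

lemma bar_snoc: "bar (sg (w @ [z, y])) =
   snoc y (bar (sg (w @ [z]))) + Poly_Mapping.single (w @ [z + y]) ((- 1) ^ length w * coef z y)"
proof (induction w)
  case Nil
  show ?case
    by (simp add: bar_Cons lmul_Cons lmul_Nil bar_Nil bar_singleton cons_zero snoc_zero)
next
  case (Cons a w)
  have "lmul a (sg (w @ [z, y])) = snoc y (lmul a (sg (w @ [z])) :: 'a chain)"
    by (cases w) (simp_all add: lmul_Cons)
  then show ?case
    by (simp add: bar_Cons Cons.IH cons_snoc cons_add snoc_diff algebra_simps
       single_uminus)
qed

lemma wrap_snoc: "wrap (sg ((a # w) @ [y])) = Poly_Mapping.single ((y + a) # w) (coef y a)"
  and wrap_singleton: "wrap (sg [a]) = 0"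
  by (simp_all add: wrap_def wrap_list_def)

lemma wrap_snoc': "wrap (snoc y f) = lmul y f" if "f \<in> supp {w. w \<noteq> []}"
proof (rule lin_eq_on_supp[OF that])
  show "wrap (snoc y (sg w)) = lmul y (sg w)" if "w \<in> {w. w \<noteq> []}" for w
    using that by (cases w) (simp_all add: wrap_def wrap_list_def lmul_Cons)
qed (intro lin_intros)+

lemma hoch_single: "hoch (sg w) = bar (sg w) + fscale ((- 1) ^ (length w - 1)) (wrap (sg w))"
  by (simp add: hoch_def bar_def wrap_def)

section \<open>Hochschild and cyclic identities\<close>

abbreviation Len :: "nat \<Rightarrow> 'x list set" where
  "Len n \<equiv> {w. length w = n}"

lemma hoch_Len: "f \<in> supp (Len (Suc n)) \<Longrightarrow> hoch f = bar f + fscale ((- 1) ^ n) (wrap f)"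
  by (rule lin_eq_on_supp[where F = hoch and S = "Len (Suc n)"])
    (assumption | intro lin_intros | simp add: hoch_single)+

lemma supp_lin_ext:
  assumes "f \<in> supp S" "lin F" "\<And>w. w \<in> S \<Longrightarrow> F (sg w) \<in> supp T"
  shows "F f \<in> supp T"
  by (rule lin_maps_supp[OF assms(1,2) _ subspace_supp]) (rule assms(3))

text \<open>Adjacent letters for which the coefficient of the product is not forced to be zero.\<close>

definition mergeable :: "letter \<Rightarrow> letter \<Rightarrow> bool" where
  "mergeable a c \<longleftrightarrow> fst a = 0 \<or> fst c = 0"

lemma lmul_supp:
  "lmul a (sg w) \<in> supp {w'. \<exists>c v. w = c # v \<and> w' = (a + c) # v \<and> mergeable a c}"
  by (cases w) (auto simp: lmul_Cons lmul_Nil supp_def mergeable_def coef_def)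

lemma bar_supp:
  "bar (sg w) \<in> supp {w'. \<exists>u a c v. w = u @ a # c # v \<and> w' = u @ (a + c) # v \<and> mergeable a c}"
    (is "_ \<in> supp (?S w)")
proof (induction w)
  case (Cons a w)
  have "cons a (bar (sg w)) \<in> (supp (?S (a # w)) :: 'a chain set)"
  proof (rule supp_lin_ext[OF Cons.IH lin_ops(1)])
    fix w' assume "w' \<in> ?S w"
    then obtain u b c v where "w = u @ b # c # v" "w' = u @ (b + c) # v" "mergeable b c"
      by auto
    then have "a # w = (a # u) @ b # c # v \<and> a # w' = (a # u) @ (b + c) # v \<and> mergeable b c"
      by simp
    then have "a # w' \<in> ?S (a # w)" by blast
    then show "cons a (sg w') \<in> supp (?S (a # w))"
      by (simp add: supp_single)
  qed
  moreover have "lmul a (sg w) \<in> (supp (?S (a # w)) :: 'a chain set)"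
  proof (rule supp_mono[OF lmul_supp], safe)
    fix c v assume "mergeable a c"
    then have "a # c # v = [] @ a # c # v \<and> (a + c) # v = [] @ (a + c) # v \<and> mergeable a c"
      by simp
    then show "\<exists>u b d v'. a # c # v = u @ b # d # v' \<and> (a + c) # v = u @ (b + d) # v' \<and> mergeable b d"
      by blast
  qed
  ultimately show ?case
    unfolding bar_Cons by (intro supp_diff)
qed (simp add: bar_Nil)

lemma wrap_supp:
  "wrap (sg w) \<in> supp {w'. \<exists>a c v. w = c # v @ [a] \<and> w' = (a + c) # v \<and> mergeable a c}"
proof (cases "length w < 2")
  case False
  then obtain v a where w: "w = v @ [a]"
    by (cases w rule: rev_cases) auto
  with False obtain c u where "v = c # u"
    by (cases v) auto
  then show ?thesis
    using lmul_supp[of a v, where 'a='a] by (auto simp: w wrap_def wrap_list_def lmul_def elim!: supp_mono)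
qed (simp add: wrap_def wrap_list_def)

lemma hoch_supp:
  "hoch (sg w) \<in> supp ({w'. \<exists>u a c v. w = u @ a # c # v \<and> w' = u @ (a + c) # v \<and> mergeable a c}
    \<union> {w'. \<exists>a c v. w = c # v @ [a] \<and> w' = (a + c) # v \<and> mergeable a c})"
  unfolding hoch_single
  by (intro supp_add supp_scale supp_mono[OF bar_supp] supp_mono[OF wrap_supp]) auto

lemma bar_Len: "f \<in> supp (Len (Suc n)) \<Longrightarrow> bar f \<in> supp (Len n)"
  by (erule supp_lin_ext, rule lin_ops, rule supp_mono[OF bar_supp]) auto

lemma wrap_Len: "f \<in> supp (Len (Suc n)) \<Longrightarrow> wrap f \<in> supp (Len n)"
  by (erule supp_lin_ext, rule lin_ops, rule supp_mono[OF wrap_supp]) auto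

lemma wrap_snoc_sg: "v \<noteq> [] \<Longrightarrow> wrap (sg (v @ [y])) = lmul y (sg v)"
  using wrap_snoc'[of "sg v" y] by (simp add: supp_def)

lemma bar_0: "f \<in> supp (Len (Suc 0)) \<Longrightarrow> bar f = 0"
  and wrap_0: "f \<in> supp (Len (Suc 0)) \<Longrightarrow> wrap f = 0"
proof -
  assume f: "f \<in> supp (Len (Suc 0))"
  show "bar f = 0"
    by (rule lin_0_on_supp[OF f lin_ops(4)]) (auto simp: length_Suc_conv bar_singleton)
  show "wrap f = 0"
    by (rule lin_0_on_supp[OF f lin_ops(5)]) (auto simp: length_Suc_conv wrap_singleton)
qed

lemma hoch_0: "f \<in> supp (Len (Suc 0)) \<Longrightarrow> hoch f = 0"
  by (simp add: hoch_Len[of f 0] bar_0 wrap_0)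

lemmas wrap_add = lin_add[OF lin_ops(5)]
  and wrap_diff = lin_diff[OF lin_ops(5)]
  and wrap_scale = lin_scale[OF lin_ops(5)]
  and wrap_zero = lin_0[OF lin_ops(5)]

lemmas hoch_add = lin_add[OF lin_ops(6)]
  and hoch_diff = lin_diff[OF lin_ops(6)]
  and hoch_scale = lin_scale[OF lin_ops(6)]
  and hoch_sum = lin_sum[OF lin_ops(6)]
  and hoch_uminus = lin_uminus[OF lin_ops(6)]
  and hoch_zero = lin_0[OF lin_ops(6)]

text \<open>Faces that do not involve the last letter commute with appending it. What remains is associativity at
  the three places where the last letter is involved.\<close>

lemma hoch_hoch_single: "hoch (hoch (sg w)) = 0"
proof -
  consider "w = []" | a where "w = [a]" | a c where "w = [a, c]" | a v z y where "w = a # v @ [z, y]"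
  proof (cases w)
    case (Cons a u)
    then show ?thesis using that
      by (cases u rule: rev_cases; cases "butlast u" rule: rev_cases) auto
  qed
  then show ?thesis
  proof cases
    case 4
    let ?n = "length v + 2"
    have w: "sg w \<in> (supp (Len (Suc ?n)) :: 'a chain set)"
      by (simp add: 4 supp_single)
    define f where "f = (sg (a # v @ [z]) :: 'a chain)"
    define q where "q = (Poly_Mapping.single ((z + y + a) # v) 1 :: 'a chain)"
    have f: "sg w = snoc y f" by (simp add: f_def 4)
    have bpf: "bar (snoc y f) = snoc y (bar f) +
        Poly_Mapping.single ((a # v) @ [z + y]) ((- 1) ^ Suc (length v) * coef z y)"
      unfolding f_def using bar_snoc[of "a # v" z y, where 'a='a] by simp
    have ne: "bar f \<in> supp {w. w \<noteq> []}"
      unfolding f_def by (rule supp_mono[OF bar_supp]) auto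
    have wr1: "wrap (snoc y f) = lmul y f"
      by (rule wrap_snoc') (simp add: f_def supp_def)
    have comm: "bar (lmul y f) = lmul y (bar f)"
      unfolding f_def by (rule bar_lmul)
    have wrwr: "wrap (lmul y f) = fscale (coef (z + y) a * coef z y) q"
    proof -
      have "wrap (lmul y f) = fscale (coef y a) (wrap (sg (((y + a) # v) @ [z])))"
        using lin_single[OF lin_ops(5), of "((y + a) # v) @ [z]" "coef y a"]
        by (simp add: f_def lmul_Cons)
      also have "\<dots> = fscale (coef y a * coef z (y + a)) q"
        unfolding wrap_snoc by (simp add: q_def fscale_single add.assoc)
      finally show ?thesis by (simp add: coef_assoc mult.commute)
    qed
    have wr2: "wrap (Poly_Mapping.single ((a # v) @ [z + y]) c) = fscale (c * coef (z + y) a) q" for c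
      using lin_single[OF lin_ops(5), of "(a # v) @ [z + y]" c]
      unfolding wrap_snoc by (simp add: q_def fscale_single)
    have "wrap (bar (snoc y f)) = lmul y (bar f) + fscale ((- 1) ^ Suc (length v) * coef z y * coef (z + y) a) q"
      unfolding bpf wrap_add wrap_snoc'[OF ne] wr2 ..
    then have wrbp: "wrap (bar (snoc y f)) = lmul y (bar f) - fscale ((- 1) ^ length v * (coef (z + y) a * coef z y)) q"
      by (simp add: fscale_neg mult_ac)
    let ?s = "(- 1) ^ length v :: 'a"
    have bh1: "hoch (snoc y f) = bar (snoc y f) + fscale ?s (lmul y f)"
      using hoch_Len[of "snoc y f" ?n] w by (simp add: f wr1)
    have bh2: "hoch g = bar g - fscale ?s (wrap g)" if "g \<in> supp (Len (Suc (Suc (length v))))" for g :: "'a chain"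
      using hoch_Len[OF that] by (simp add: fscale_neg)
    have "bar (snoc y f) \<in> supp (Len (Suc (Suc (length v))))" "wrap (snoc y f) \<in> supp (Len (Suc (Suc (length v))))"
      using w by (auto simp: f intro!: bar_Len wrap_Len)
    then have "hoch (hoch (snoc y f)) = 0"
      unfolding bh1 by (simp add: wr1 hoch_add hoch_scale bh2 bar_bar comm wrbp wrwr
        free_vs.scale_right_diff_distrib flip: mult.assoc power_mult_distrib)
    then show ?thesis by (simp add: f)
  qed (auto simp: hoch_single bar_Cons lmul_Cons bar_Nil lmul_Nil bar_singleton wrap_singleton wrap_def wrap_list_def
       cons_zero hoch_zero hoch_add hoch_0 supp_single supp_diff)
qed

lemma hoch_hoch: "hoch (hoch f) = 0"
  by (rule lin_eq_0I[where f = f], intro lin_intros) (rule hoch_hoch_single)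

subsection \<open>Cyclic rotation\<close>

lemma op_t_snoc: "op_t (sg (w @ [y])) = fscale ((- 1) ^ length w) (sg (y # w))"
  by (simp add: op_t_def fscale_single)

lemma op_t_Len: "f \<in> supp (Len (Suc n)) \<Longrightarrow> op_t f \<in> supp (Len (Suc n))"
  by (erule supp_lin_ext, rule lin_ops) (auto simp: op_t_def supp_def)

lemmas op_t_add = lin_add[OF lin_ops(7)]
  and op_t_diff = lin_diff[OF lin_ops(7)]
  and op_t_scale = lin_scale[OF lin_ops(7)]
  and op_t_sum = lin_sum[OF lin_ops(7)]
  and op_t_uminus = lin_uminus[OF lin_ops(7)]
  and op_t_zero = lin_0[OF lin_ops(7)]

text \<open>Rotation turns the cyclic face into the first face and commutes with the other faces, up to the sign
  that \<open>op_t\<close> carries.\<close>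

lemma hoch_op_t_single: 
  assumes "length w \<ge> 2"
  shows "hoch (sg w) - hoch (op_t (sg w)) = bar (sg w) - op_t (bar (sg w) :: 'k::field chain)"
proof -
  obtain v y where w: "w = v @ [y]"
    using assms by (cases w rule: rev_cases) auto
  with assms have "v \<noteq> []" by auto
  then obtain u z where v: "v = u @ [z]"
    by (cases v rule: rev_cases) auto
  let ?s = "(- 1) ^ length v :: 'k"
  have t: "op_t (snoc y (bar (sg v))) = fscale ((- 1) ^ length u) (cons y (bar (sg v)) :: 'k chain)"
  proof (rule lin_eq_on_supp[where F = "\<lambda>f. op_t (snoc y f)" and S = "Len (length u)"
        and G = "\<lambda>f. fscale ((- 1) ^ length u) (cons y f)"])
    show "bar (sg v) \<in> (supp (Len (length u)) :: 'k chain set)"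
      by (rule bar_Len) (simp add: v supp_single)
    show "op_t (snoc y (sg x)) = fscale ((- 1) ^ length u) (cons y (sg x) :: 'k chain)" if "x \<in> Len (length u)" for x
      using that by (simp add: op_t_snoc fscale_single)
  qed (intro lin_intros)+
  have t2: "op_t (Poly_Mapping.single (u @ [z + y]) c) = fscale ((- 1) ^ length u * c) (sg ((z + y) # u) :: 'k chain)" for c
    using lin_single[OF lin_ops(7), of "u @ [z + y]" c]
    by (simp add: op_t_snoc mult.commute)
  have bpw: "bar (sg w) = snoc y (bar (sg v)) + (Poly_Mapping.single (u @ [z + y]) ((- 1) ^ length u * coef z y) :: 'k chain)"
    by (simp add: w v bar_snoc)
  have tbp: "op_t (bar (sg w)) = fscale ((- 1) ^ length u) (cons y (bar (sg v))) + fscale (coef z y) (sg ((z + y) # u) :: 'k chain)"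
    by (simp add: bpw op_t_add t t2 flip: mult.assoc)
  have wrt: "wrap (sg (y # v)) = (fscale (coef z y) (sg ((z + y) # u)) :: 'k chain)"
    using wrap_snoc_sg[of "y # u" z, where 'a='k] by (simp add: v lmul_Cons fscale_single)
  have twist: "op_t (sg w) = fscale ?s (sg (y # v))"
    by (simp add: w op_t_snoc)
  have e1: "hoch (op_t (sg w)) = fscale ?s (lmul y (sg v) - cons y (bar (sg v)) + fscale ?s (fscale (coef z y) (sg ((z + y) # u))))"
    unfolding twist hoch_scale by (simp add: hoch_single wrt bar_Cons del: free_vs.scale_scale)
  have e2: "hoch (sg w) = bar (sg w) + fscale ?s (lmul y (sg v))"
    by (simp add: hoch_single w wrap_snoc_sg[OF \<open>v \<noteq> []\<close>])
  show ?thesis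
    unfolding e1 e2 tbp by (simp add: free_vs.scale_right_distrib free_vs.scale_right_diff_distrib v fscale_neg flip: power_mult_distrib)
qed

lemma hoch_op_t: "f \<in> supp {w. length w \<ge> 2} \<Longrightarrow> hoch (f - op_t f) = bar f - op_t (bar f)"
  unfolding hoch_diff
  by (rule lin_eq_on_supp[where S = "{w. length w \<ge> 2}"])
    (assumption | intro lin_intros | simp add: hoch_op_t_single)+

lemma op_t_pow_single:
  "i \<le> length w \<Longrightarrow> (op_t ^^ i) (sg w :: 'x list \<Rightarrow>\<^sub>0 'k::field) =
     fscale ((- 1) ^ (i * (length w - 1))) (sg (drop (length w - i) w @ take (length w - i) w))"
proof (induction i)
  case (Suc i)
  let ?m = "length w - Suc i"
  have "take (length w - i) w = take ?m w @ [w ! ?m]"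
    using Suc.prems by (simp add: take_Suc_conv_app_nth[symmetric] Suc_diff_Suc)
  moreover have "drop ?m w = w ! ?m # drop (length w - i) w"
    using Suc.prems by (subst Cons_nth_drop_Suc[symmetric]) (simp_all add: Suc_diff_Suc)
  moreover have "length (drop (length w - i) w @ take ?m w) = length w - 1"
    using Suc.prems by simp
  ultimately have "op_t (sg (drop (length w - i) w @ take (length w - i) w) :: 'x list \<Rightarrow>\<^sub>0 'k) =
      fscale ((- 1) ^ (length w - 1)) (sg (drop ?m w @ take ?m w))"
    using op_t_snoc[of "drop (length w - i) w @ take ?m w" "w ! ?m"] by simp
  moreover have "(- 1) ^ (i * (length w - 1)) * (- 1) ^ (length w - 1) = (- 1 :: 'k) ^ (Suc i * (length w - 1))"
    by (simp add: power_add)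
  ultimately show ?case
    unfolding funpow.simps o_apply Suc.IH[OF Suc_leD[OF Suc.prems]] op_t_scale
    by (simp only: fscale_fscale)
qed simp

lemma op_t_pow_length: "(op_t ^^ length w) (sg w) = sg w"
proof -
  have "even (length w * (length w - 1))" by auto
  then show ?thesis by (simp add: op_t_pow_single)
qed

lemma op_t_pow_Len: "f \<in> supp (Len n) \<Longrightarrow> (op_t ^^ n) f = f"
  by (rule lin_eq_on_supp[where F="op_t ^^ n" and G = "\<lambda>f. f" and S = "Len n"])
    (assumption | intro lin_intros lin_funpow lin_ops | auto simp: op_t_pow_length)+

lemma op_N_Len: "f \<in> supp (Len n) \<Longrightarrow> op_N f = (\<Sum>i<n. (op_t ^^ i) f)"
  by (rule lin_eq_on_supp[where F = op_N and S = "Len n"])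
    (assumption | intro lin_intros lin_funpow lin_ops | auto simp: op_N_def)+

lemma op_t_N:
  assumes "f \<in> supp (Len n)"
  shows "op_t (op_N f) = op_N f"
proof -
  have "op_t (op_N f) = (\<Sum>i<n. (op_t ^^ Suc i) f)"
    by (simp add: op_N_Len[OF assms] op_t_sum)
  also have "\<dots> + f = op_N f + f"
    using sum.lessThan_Suc_shift[of "\<lambda>i. (op_t ^^ i) f" n]
    by (simp add: op_N_Len[OF assms] op_t_pow_Len[OF assms] add.commute)
  finally show ?thesis by simp
qed

lemma op_N_t:
  assumes "f \<in> supp (Len (Suc n))"
  shows "op_N (op_t f) = op_N f"
proof -
  have "op_N (op_t f) = op_t (op_N f)"
    unfolding op_N_Len[OF assms] op_N_Len[OF op_t_Len[OF assms]] op_t_sum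
    by (simp only: funpow_swap1)
  then show ?thesis
    using op_t_N assms by simp
qed

lemma op_t_fix_pow: "op_t f = f \<Longrightarrow> (op_t ^^ i) f = f"
  by (induction i) auto

lemma fscale_of_nat: "(\<Sum>i<n. f) = fscale (of_nat n) f"
  by (induction n) (simp_all add: free_vs.scale_left_distrib)

lemma op_N_fix: "f \<in> supp (Len n) \<Longrightarrow> op_t f = f \<Longrightarrow> op_N f = fscale (of_nat n) f"
  by (simp add: op_N_Len op_t_fix_pow fscale_of_nat)

subsection \<open>The norm map\<close>

fun d_list :: "nat \<Rightarrow> letter list \<Rightarrow> 'k::field chain" where
  "d_list i [] = 0"
| "d_list 0 (a # w) = lmul_list a w"
| "d_list (Suc i) (a # w) = cons a (d_list i w)"

text \<open>The inner faces one by one. They serve to compare \<open>b'\<close> with the norm; elsewhere the recursive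
  description is enough.\<close>

definition dface :: "nat \<Rightarrow> 'k::field chain \<Rightarrow> 'k chain" where
  "dface i = lin_ext (d_list i)"

lemma lin_dface: "lin (dface i)"
  by (simp add: dface_def lin_lin_ext)

lemmas [lin_intros] = lin_dface[THEN lin_comp]

lemma dface_0_Cons: "dface 0 (sg (a # w)) = lmul a (sg w)"
  and dface_Suc_Cons: "dface (Suc i) (sg (a # w)) = cons a (dface i (sg w))"
  by (simp_all add: dface_def lmul_def)

lemma bar_dface_single: "bar (sg w) = (\<Sum>i<length w - 1. fscale ((- 1) ^ i) (dface i (sg w)))"
proof (induction w)
  case (Cons a w)
  show ?case
  proof (cases w)
    case Nil
    then show ?thesis by (simp add: bar_singleton)
  next
    case (Cons c v)
    then have "length (a # w) - 1 = Suc (length w - 1)" by simp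
    then show ?thesis
      by (simp only: bar_Cons Cons.IH sum.lessThan_Suc_shift)
        (simp add: dface_0_Cons dface_Suc_Cons
          cons_sum cons_scale fscale_neg sum_negf)
  qed
qed (simp add: bar_Nil)

lemma bar_dface:
  assumes "f \<in> supp (Len (Suc n))"
  shows "bar f = (\<Sum>i<n. fscale ((- 1) ^ i) (dface i f))"
  by (rule lin_eq_on_supp[OF assms, where F = bar])
    (intro lin_intros lin_ops lin_dface | simp add: bar_dface_single)+

lemma dface_snoc: "Suc i < length v \<Longrightarrow> dface i (sg (v @ [y])) = snoc y (dface i (sg v))"
proof (induction v arbitrary: i)
  case (Cons a v)
  show ?case
  proof (cases i)
    case 0
    then show ?thesis using Cons.prems
      by (cases v) (simp_all add: dface_0_Cons lmul_Cons)
  next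
    case (Suc j)
    then show ?thesis using Cons
      by (simp add: dface_Suc_Cons cons_snoc)
  qed
qed simp

lemma dface_Len: "Suc i < length v \<Longrightarrow> dface i (sg v) \<in> supp (Len (length v - 1))"
proof (induction v arbitrary: i)
  case (Cons a v)
  show ?case
  proof (cases i)
    case 0
    then show ?thesis using Cons.prems
      by (cases v) (simp_all add: dface_0_Cons lmul_Cons supp_single)
  next
    case (Suc j)
    then have "dface j (sg v) \<in> (supp (Len (length v - 1)) :: 'a chain set)"
      using Cons by simp
    then have "cons a (dface j (sg v)) \<in> (supp (Len (Suc (length v - 1))) :: 'a chain set)"
      by (rule supp_lin_ext) (auto intro: lin_ops simp: supp_single)
    moreover have "Suc (length v - 1) = length (a # v) - 1" using Suc Cons.prems by simp
    ultimately show ?thesis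
      by (simp only: Suc dface_Suc_Cons)
  qed
qed simp

lemmas dface_scale = lin_scale[OF lin_dface]

lemma dface_Suc_t:
  assumes f: "f \<in> supp (Len (Suc n))" and i: "Suc i < n"
  shows "dface (Suc i) (op_t f) = - op_t (dface i f)"
proof (rule lin_eq_on_supp[OF f, where F = "\<lambda>f. dface (Suc i) (op_t f)" and G = "\<lambda>f. - op_t (dface i f)"])
  fix w :: "letter list" assume w: "w \<in> Len (Suc n)"
  then obtain v y where v: "w = v @ [y]"
    by (cases w rule: rev_cases) auto
  with w have n: "length v = n" by simp
  have "op_t (snoc y (dface i (sg v))) = fscale ((- 1) ^ (n - 1)) (cons y (dface i (sg v)) :: 'a chain)"
  proof (rule lin_eq_on_supp[where F = "\<lambda>f. op_t (snoc y f)" and S = "Len (n - 1)"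
        and G = "\<lambda>f. fscale ((- 1) ^ (n - 1)) (cons y f)"])
    show "dface i (sg v) \<in> (supp (Len (n - 1)) :: 'a chain set)"
      using dface_Len[of i v] i n by simp
    show "op_t (snoc y (sg x)) = fscale ((- 1) ^ (n - 1)) (cons y (sg x) :: 'a chain)" if "x \<in> Len (n - 1)" for x
      using that by (simp add: op_t_snoc)
  qed (intro lin_intros)+
  moreover have "(- 1 :: 'a) ^ n = - ((- 1) ^ (n - 1))"
    using i by (cases n) auto
  ultimately show "dface (Suc i) (op_t (sg w)) = - op_t (dface i (sg w) :: 'a chain)"
    using i unfolding v op_t_snoc dface_scale dface_Suc_Cons
    by (simp add: n dface_snoc fscale_neg)
qed (intro lin_intros lin_dface lin_ops)+

lemma wrap_dface:
  assumes f: "f \<in> supp (Len (Suc n))" and n: "n \<ge> 1"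
  shows "wrap f = fscale ((- 1) ^ n) (dface 0 (op_t f))"
proof (rule lin_eq_on_supp[OF f, where F = wrap])
  fix w :: "letter list" assume w: "w \<in> Len (Suc n)"
  then obtain v y where v: "w = v @ [y]"
    by (cases w rule: rev_cases) auto
  with w n have "length v = n" "v \<noteq> []" by auto
  then show "wrap (sg w) = fscale ((- 1) ^ n) (dface 0 (op_t (sg w)) :: 'a chain)"
    by (simp add: v op_t_snoc dface_scale dface_0_Cons wrap_snoc_sg flip: power_mult_distrib)
qed (intro lin_intros lin_dface lin_ops)+

lemma op_N_Len': "f \<in> supp (Len (Suc n)) \<Longrightarrow> op_N f \<in> supp (Len (Suc n))"
proof -
  assume f: "f \<in> supp (Len (Suc n))"
  have "(op_t ^^ i) f \<in> supp (Len (Suc n))" for i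
    by (induction i) (auto simp: f intro: op_t_Len)
  then show ?thesis unfolding op_N_Len[OF f] by (intro supp_sum)
qed

lemma fscale_cancel: "c \<noteq> 0 \<Longrightarrow> fscale c f = fscale c g \<Longrightarrow> f = g"
  by simp

lemmas op_N_add = lin_add[OF lin_ops(8)]
  and op_N_diff = lin_diff[OF lin_ops(8)]
  and op_N_scale = lin_scale[OF lin_ops(8)]
  and op_N_sum = lin_sum[OF lin_ops(8)]
  and op_N_uminus = lin_uminus[OF lin_ops(8)]
  and op_N_zero = lin_0[OF lin_ops(8)]

lemma op_N_minus_t: "f \<in> supp (Len (Suc n)) \<Longrightarrow> op_N (f - op_t f) = 0"
  by (simp add: op_N_diff op_N_t)

text \<open>On invariants of the rotation all faces become equal up to sign after applying \<open>N\<close>, because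
  rotation shifts the index of a face. Hence \<open>N b' N\<close> and \<open>N b N\<close> are \<open>n\<close> and \<open>n + 1\<close> times the same
  map. On words of length \<open>l\<close> the norm of an invariant is \<open>l\<close> times that invariant, so in
  characteristic 0 both factors can be cancelled.\<close>

lemma bar_N:
  fixes f :: "'k::field_char_0 chain"
  assumes f: "f \<in> supp (Len (Suc n))"
  shows "bar (op_N f) = op_N (hoch f)"
proof (cases n)
  case 0
  with f op_N_Len'[OF f] show ?thesis
    by (simp add: bar_0 hoch_0 op_N_zero)
next
  case (Suc n')
  define X where "X i = op_N (dface i (op_N f))" for i
  have Nf: "op_N f \<in> supp (Len (Suc n))" "op_t (op_N f) = op_N f"
    using op_N_Len'[OF f] op_t_N[OF f] by auto
  have len2: "g \<in> supp {w. length w \<ge> 2}" if "g \<in> supp (Len (Suc n))" for g :: "'k chain"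
    using that Suc by (auto elim!: supp_mono)
  have dN: "dface i (op_N f) \<in> supp (Len n)" if "i < n" for i
  proof (rule supp_lin_ext[OF Nf(1) lin_dface])
    show "dface i (sg w) \<in> (supp (Len n) :: 'k chain set)" if "w \<in> Len (Suc n)" for w
      using dface_Len[of i w] that \<open>i < n\<close> by simp
  qed
  have bpN: "bar (op_N f) \<in> supp (Len n)"
    by (rule bar_Len[OF Nf(1)])
  have X: "X i = fscale ((- 1) ^ i) (X 0)" if "i < n" for i
    using that
  proof (induction i)
    case (Suc i)
    have "X (Suc i) = - op_N (op_t (dface i (op_N f)))"
      using dface_Suc_t[OF Nf(1) Suc.prems] by (simp add: X_def Nf(2) op_N_uminus)
    also have "\<dots> = - X i"
      using dN[of i] Suc.prems \<open>n = Suc n'\<close> by (simp add: X_def op_N_t)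
    finally show ?case using Suc by (simp add: fscale_neg)
  qed simp
  have "op_N (bar (op_N f)) = (\<Sum>i<n. fscale ((- 1) ^ i) (X i))"
    by (simp add: bar_dface[OF Nf(1)] op_N_sum op_N_scale X_def)
  also have "\<dots> = (\<Sum>i<n. X 0)"
  proof (rule sum.cong)
    show "fscale ((- 1) ^ i) (X i) = X 0" if "i \<in> {..<n}" for i
      unfolding X[of i, OF that[simplified]] by (simp flip: power_mult_distrib)
  qed simp
  finally have NbpN: "op_N (bar (op_N f)) = fscale (of_nat n) (X 0)"
    by (simp add: fscale_of_nat)
  have "op_t (bar (op_N f)) = bar (op_N f)"
    using hoch_op_t[OF len2[OF Nf(1)]] by (simp add: Nf(2) hoch_zero)
  from op_N_fix[OF bpN this] have "fscale (of_nat n) (bar (op_N f)) = fscale (of_nat n) (X 0)"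
    unfolding NbpN by (rule sym)
  then have 1: "bar (op_N f) = X 0"
    by (rule fscale_cancel[rotated]) (simp add: Suc del: of_nat_Suc)
  have Nbt: "op_N (hoch (op_t g)) = op_N (hoch g)" if "g \<in> supp (Len (Suc n))" for g :: "'k chain"
    using arg_cong[OF hoch_op_t[OF len2[OF that]], of op_N] op_N_minus_t[of "bar g" n'] bar_Len[OF that] Suc
    by (simp add: hoch_diff op_N_diff)
  have "op_N (hoch ((op_t ^^ i) f)) = op_N (hoch f) \<and> (op_t ^^ i) f \<in> supp (Len (Suc n))" for i
    by (induction i) (auto simp: f Nbt op_t_Len)
  then have "op_N (hoch (op_N f)) = fscale (of_nat (Suc n)) (op_N (hoch f))"
    by (simp only: op_N_Len[OF f] hoch_sum op_N_sum fscale_of_nat)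
  moreover have "op_N (hoch (op_N f)) = fscale (of_nat (Suc n)) (X 0)"
    unfolding hoch_Len[OF Nf(1)] op_N_add NbpN of_nat_Suc free_vs.scale_left_distrib
    using Suc by (simp add: wrap_dface[OF Nf(1)] Nf(2) op_N_scale X_def add.commute
        flip: power_mult_distrib)
  ultimately have "fscale (of_nat (Suc n)) (op_N (hoch f)) = fscale (of_nat (Suc n)) (X 0)"
    by (rule trans[OF sym])
  then have "op_N (hoch f) = X 0"
    by (rule fscale_cancel[rotated]) (simp del: of_nat_Suc)
  with 1 show ?thesis by simp
qed

lemma minus_op_t_pow:
  assumes "free_vs.subspace V" "\<And>g. g \<in> V \<Longrightarrow> op_t g \<in> V" "f \<in> V"
  shows "\<exists>g\<in>V. f - (op_t ^^ i) f = g - op_t g"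
proof (induction i)
  case 0
  then show ?case
    by (intro bexI[of _ 0]) (simp_all add: free_vs.subspace_0[OF assms(1)] op_t_zero)
next
  case (Suc i)
  then obtain g where g: "g \<in> V" "f - (op_t ^^ i) f = g - op_t g" by auto
  have "(op_t ^^ i) f \<in> V" by (induction i) (auto simp: assms)
  moreover have "f - (op_t ^^ Suc i) f = (g + (op_t ^^ i) f) - op_t (g + (op_t ^^ i) f)"
    using g(2) by (simp add: op_t_add algebra_simps)
  ultimately show ?case using free_vs.subspace_add[OF assms(1) g(1)] by (intro bexI)
qed

lemma minus_t_Sum:
  assumes "free_vs.subspace V" "\<And>i. i \<in> I \<Longrightarrow> \<exists>g\<in>V. F i = g - op_t g"
  shows "\<exists>g\<in>V. (\<Sum>i\<in>I. F i) = g - op_t g"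
proof -
  obtain g where g: "\<And>i. i \<in> I \<Longrightarrow> g i \<in> V \<and> F i = g i - op_t (g i)"
    using assms(2) by metis
  then have "(\<Sum>i\<in>I. F i) = (\<Sum>i\<in>I. g i) - op_t (\<Sum>i\<in>I. g i)"
    unfolding op_t_sum sum_subtractf[symmetric] by (intro sum.cong) auto
  moreover have "(\<Sum>i\<in>I. g i) \<in> V"
    by (rule free_vs.subspace_sum[OF assms(1)]) (simp add: g)
  ultimately show ?thesis by (rule bexI)
qed

text \<open>Every rotation of \<open>f\<close> differs from \<open>f\<close> by an element of the image of \<open>1 - t\<close>, and \<open>N f\<close> is the sum of the rotations.\<close>

lemma N_cong_mod_t:
  assumes "free_vs.subspace V" "\<And>g. g \<in> V \<Longrightarrow> op_t g \<in> V" "f \<in> V" "f \<in> supp (Len n)"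
  shows "\<exists>g\<in>V. fscale (of_nat n) f - op_N f = g - op_t g"
proof -
  have "fscale (of_nat n) f - op_N f = (\<Sum>i<n. f - (op_t ^^ i) f)"
    by (simp add: op_N_Len[OF assms(4)] sum_subtractf fscale_of_nat)
  then show ?thesis
    by (simp only:) (intro minus_t_Sum minus_op_t_pow assms)
qed

lemma ker_N:
  fixes f :: "'x list \<Rightarrow>\<^sub>0 'k::field_char_0"
  assumes V: "free_vs.subspace V" "\<And>g. g \<in> V \<Longrightarrow> op_t g \<in> V" "f \<in> V"
    and f: "f \<in> supp (Len (Suc n))" "op_N f = 0"
  shows "\<exists>g\<in>V. f = g - op_t g"
proof -
  obtain g where g: "g \<in> V" "fscale (of_nat (Suc n)) f = g - op_t g"
    using N_cong_mod_t[OF V f(1)] f(2) by auto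
  let ?c = "inverse (of_nat (Suc n)) :: 'k"
  have "f = fscale ?c (fscale (of_nat (Suc n)) f)"
    by (simp del: of_nat_Suc)
  also have "\<dots> = fscale ?c g - op_t (fscale ?c g)"
    unfolding g(2) by (simp add: op_t_scale free_vs.scale_right_diff_distrib)
  finally show ?thesis using g(1) free_vs.subspace_scale[OF V(1)] by blast
qed

lemma ker_t:
  fixes f :: "'x list \<Rightarrow>\<^sub>0 'k::field_char_0"
  assumes "f \<in> supp (Len (Suc n))" "op_t f = f"
  shows "f = op_N (fscale (inverse (of_nat (Suc n))) f)"
  using op_N_fix[OF assms] by (simp add: op_N_scale del: of_nat_Suc)

text \<open>Prefixing the unit is the usual contraction of the bar complex.\<close>

lemma bar_cons_unit: "f \<in> supp {w. w \<noteq> []} \<Longrightarrow> bar (cons (0, 0) f) = f - cons (0, 0) (bar f)"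
proof -
  assume f: "f \<in> supp {w. w \<noteq> []}"
  have "lmul (0, 0) f = f"
    by (rule lin_eq_on_supp[OF f, where F = "lmul (0, 0)" and G = "\<lambda>f. f"])
      (auto simp: neq_Nil_conv lmul_Cons intro: lin_ops lin_ident)
  then show ?thesis by (simp add: bar_cons)
qed

subsection \<open>Chain groups and the total complex\<close>

definition chains :: "nat \<Rightarrow> 'k::field chain set" where
  "chains n = supp {w. length w = Suc n \<and> list_all (\<lambda>a. fst a \<le> 1) w}"

lemma subspace_chains: "free_vs.subspace (chains n)"
  by (simp add: chains_def subspace_supp)

lemmas chains_0 [simp] = free_vs.subspace_0[OF subspace_chains]
  and chains_add = free_vs.subspace_add[OF subspace_chains]
  and chains_diff = free_vs.subspace_diff[OF subspace_chains]
  and chains_neg = free_vs.subspace_neg[OF subspace_chains]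
  and chains_scale = free_vs.subspace_scale[OF subspace_chains]
  and chains_sum = free_vs.subspace_sum[OF subspace_chains]

lemma chains_Len: "f \<in> chains n \<Longrightarrow> f \<in> supp (Len (Suc n))"
  by (auto simp: chains_def elim: supp_mono)

lemma bar_chains: "f \<in> chains (Suc n) \<Longrightarrow> bar f \<in> chains n"
  unfolding chains_def
  by (erule supp_lin_ext, rule lin_ops, rule supp_mono[OF bar_supp]) (auto simp: mergeable_def)

lemma hoch_chains: "f \<in> chains (Suc n) \<Longrightarrow> hoch f \<in> chains n"
  unfolding chains_def
  by (erule supp_lin_ext, rule lin_ops, rule supp_mono[OF hoch_supp]) (auto simp: mergeable_def)

lemma op_t_chains: "f \<in> chains n \<Longrightarrow> op_t f \<in> chains n"
  unfolding chains_def
  by (erule supp_lin_ext, rule lin_ops) (case_tac w rule: rev_cases, auto simp: op_t_snoc intro!: supp_scale supp_single)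

lemma op_t_pow_chains: "f \<in> chains n \<Longrightarrow> (op_t ^^ i) f \<in> chains n"
  by (induction i) (auto simp: op_t_chains)

lemma op_N_chains: "f \<in> chains n \<Longrightarrow> op_N f \<in> chains n"
  unfolding op_N_Len[OF chains_Len] by (intro chains_sum op_t_pow_chains)

text \<open>The vertical maps of the bicomplex of words. The horizontal maps are the ones of the given bicomplex,
  since these do not involve the multiplication.\<close>

definition vertM :: "nat \<Rightarrow> 'k::field chain \<Rightarrow> 'k chain" where
  "vertM p f = (if even p then hoch f else - bar f)"

lemma lin_vertM: "lin (vertM p)" and lin_horizontal: "lin (horizontal p)"
  unfolding vertM_def[abs_def] horizontal_def[abs_def]
  by (cases "even p"; simp; intro lin_intros lin_ops)+

lemma vertM_chains: "f \<in> chains (Suc n) \<Longrightarrow> vertM p f \<in> chains n"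
  and horizontal_chains: "f \<in> chains n \<Longrightarrow> horizontal p f \<in> chains n"
  by (auto simp: vertM_def horizontal_def hoch_chains bar_chains chains_neg chains_diff op_t_chains op_N_chains)

lemma vertM_vertM: "vertM p (vertM p f) = 0"
  by (simp add: vertM_def hoch_hoch bar_uminus bar_bar)

lemma horizontal_exact:
  fixes f :: "'k::field_char_0 chain"
  assumes "f \<in> chains n" "horizontal p f = 0" "p > 0"
  shows "\<exists>g\<in>chains n. f = horizontal (Suc p) g"
proof (cases "even p")
  case True
  then show ?thesis
    using ker_N[OF subspace_chains op_t_chains assms(1) chains_Len] assms by (auto simp: horizontal_def)
next
  case False
  then show ?thesis
    using ker_t[of f n] assms chains_Len[of f n] by (auto simp: horizontal_def intro!: chains_scale bexI)
qed

lemma horizontal_vertM: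
  fixes f :: "'k::field_char_0 chain"
  assumes "f \<in> chains (Suc n)" "p > 0"
  shows "horizontal p (vertM p f) = - vertM (p - 1) (horizontal p f)"
proof -
  have "f \<in> supp {w. length w \<ge> 2}"
    using assms(1) by (auto simp: chains_def elim: supp_mono)
  then show ?thesis
    using assms(2) bar_N[OF chains_Len[OF assms(1)]]
    by (auto simp: horizontal_def vertM_def hoch_op_t op_t_uminus dest: gr0_implies_Suc)
qed

text \<open>Chains of total degree \<open>n\<close>, column by column; columns beyond \<open>n\<close> hold 0.\<close>

definition TotM :: "nat \<Rightarrow> (nat \<Rightarrow> 'k::field chain) set" where
  "TotM n = {x. (\<forall>p\<le>n. x p \<in> chains (n - p)) \<and> (\<forall>p>n. x p = 0)}"

definition dM :: "nat \<Rightarrow> (nat \<Rightarrow> 'k::field chain) \<Rightarrow> nat \<Rightarrow> 'k chain" where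
  "dM n x = (\<lambda>p. if p < n then vertM p (x p) + horizontal (Suc p) (x (Suc p)) else 0)"

definition cycM :: "nat \<Rightarrow> (nat \<Rightarrow> 'k::field chain) set" where
  "cycM n = {x \<in> TotM n. dM n x = (\<lambda>_. 0)}"

lemma cycM_eq: "x \<in> cycM n \<Longrightarrow> p < n \<Longrightarrow> vertM p (x p) = - horizontal (Suc p) (x (Suc p))"
  by (auto simp: cycM_def dM_def eq_neg_iff_add_eq_0 dest!: fun_cong[of _ _ p])

definition bounds :: "nat \<Rightarrow> (nat \<Rightarrow> 'k::field chain) set" where
  "bounds n = dM (Suc n) ` TotM (Suc n)"

lemmas horizontal_add = lin_add[OF lin_horizontal]
  and horizontal_diff = lin_diff[OF lin_horizontal]
  and horizontal_scale = lin_scale[OF lin_horizontal]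
  and horizontal_zero = lin_0[OF lin_horizontal]

lemmas vertM_add = lin_add[OF lin_vertM]
  and vertM_diff = lin_diff[OF lin_vertM]
  and vertM_scale = lin_scale[OF lin_vertM]
  and vertM_zero = lin_0[OF lin_vertM]

text \<open>The rows are exact in the positive columns. So once column 0 of a cycle is accounted for, a diagram
  chase accounts for columns \<open>1, 2, \<dots>\<close> one after the other.\<close>

lemma zigzag:
  fixes x :: "nat \<Rightarrow> 'k::field_char_0 chain"
  assumes x: "x \<in> cycM n" and x0: "x 0 = hoch g + (h - op_t h)" "g \<in> chains (Suc n)" "h \<in> chains n"
  shows "x \<in> bounds n"
proof -
  have xC: "x p \<in> chains (n - p)" if "p \<le> n" for p
    using x that by (auto simp: cycM_def TotM_def)
  have "\<exists>y. (\<forall>q\<le>Suc p. y q \<in> chains (Suc n - q)) \<and>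
      (\<forall>q\<le>p. x q = vertM q (y q) + horizontal (Suc q) (y (Suc q)))" if "p \<le> n" for p
    using that
  proof (induction p)
    case 0
    show ?case
      using x0 by (intro exI[of _ "\<lambda>q. if q = 0 then g else h"]) (auto simp: vertM_def horizontal_def le_Suc_eq)
  next
    case (Suc p)
    then obtain y where y: "\<And>q. q \<le> Suc p \<Longrightarrow> y q \<in> chains (Suc n - q)"
      "\<And>q. q \<le> p \<Longrightarrow> x q = vertM q (y q) + horizontal (Suc q) (y (Suc q))" by auto
    let ?u = "x (Suc p) - vertM (Suc p) (y (Suc p))"
    have yp: "y (Suc p) \<in> chains (Suc (n - Suc p))"
      using y(1)[of "Suc p"] Suc.prems by (simp add: Suc_diff_Suc)
    have "horizontal (Suc p) ?u = - vertM p (x p - horizontal (Suc p) (y (Suc p)))"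
      using horizontal_vertM[OF yp] cycM_eq[OF x, of p] Suc.prems
      by (simp add: horizontal_diff vertM_diff)
    also have "\<dots> = 0"
      by (subst y(2)) (simp_all add: vertM_vertM)
    finally have "horizontal (Suc p) ?u = 0" .
    moreover have "?u \<in> chains (n - Suc p)"
      using xC[of "Suc p"] Suc.prems yp by (intro chains_diff vertM_chains) auto
    ultimately obtain z where z: "z \<in> chains (n - Suc p)" "?u = horizontal (Suc (Suc p)) z"
      using horizontal_exact by blast
    have "x (Suc p) = vertM (Suc p) (y (Suc p)) + horizontal (Suc (Suc p)) z"
      using z(2) by (simp add: algebra_simps)
    then show ?case
      using y(2) z(1) y(1)[of "Suc p"] y(1) by (intro exI[of _ "y(Suc (Suc p) := z)"]) (auto simp: le_Suc_eq simp del: Suc_diff_le diff_Suc_Suc)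
  qed
  from this[of n] obtain y where y: "\<And>q. q \<le> Suc n \<Longrightarrow> y q \<in> chains (Suc n - q)"
      "\<And>q. q \<le> n \<Longrightarrow> x q = vertM q (y q) + horizontal (Suc q) (y (Suc q))" by auto
  let ?y = "\<lambda>q. if q \<le> Suc n then y q else 0"
  have "?y \<in> TotM (Suc n)" using y(1) by (auto simp: TotM_def)
  moreover have "dM (Suc n) ?y = x"
    using y(2) x by (auto simp: dM_def fun_eq_iff cycM_def TotM_def)
  ultimately show ?thesis unfolding bounds_def by blast
qed

section \<open>Hochschild cycles with a distinguished first letter\<close>

text \<open>The head letter has weight \<open>j\<close>, and the tail has \<open>l\<close> factors \<open>s\<close>. The weight of the head is kept
  separate because merging increases it at the expense of the tail.\<close>

definition words :: "nat \<Rightarrow> nat \<Rightarrow> nat \<Rightarrow> letter list set" where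
  "words j l n = {w. \<exists>x v. w = (j, x) # v \<and> length v = n \<and>
     list_all (\<lambda>a. fst a \<le> 1) v \<and> sum_list (map fst v) = l}"

abbreviation head_chains :: "nat \<Rightarrow> nat \<Rightarrow> nat \<Rightarrow> 'k::field chain set" where
  "head_chains j l n \<equiv> supp (words j l n)"

lemma head_chains_Len: "f \<in> head_chains j l n \<Longrightarrow> f \<in> supp (Len (Suc n))"
  by (erule supp_mono) (auto simp: words_def)

lemma words_Cons: "(j', x) # v \<in> words j l n \<longleftrightarrow> j' = j \<and> length v = n \<and>
    list_all (\<lambda>a. fst a \<le> 1) v \<and> sum_list (map fst v) = l"
  by (auto simp: words_def)

lemma words_bar:
  assumes "j > 0 \<or> l = 0" "w \<in> words j l (Suc n)"
  shows "bar (sg w) \<in> head_chains j l n"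
proof (rule supp_mono[OF bar_supp], safe)
  fix u a b c d v
  assume *: "w = u @ (a, b) # (c, d) # v" "mergeable (a, b) (c, d)"
  show "u @ ((a, b) + (c, d)) # v \<in> words j l n"
    using assms * by (cases u) (auto simp: words_Cons mergeable_def sum_list_eq_0_iff)
qed

lemma words_wrap:
  assumes "j > 0 \<or> l = 0" "w \<in> words j l (Suc n)"
  shows "wrap (sg w) \<in> head_chains j l n"
proof (rule supp_mono[OF wrap_supp], safe)
  fix a b c d v
  assume *: "w = (c, d) # v @ [(a, b)]" "mergeable (a, b) (c, d)"
  show "((a, b) + (c, d)) # v \<in> words j l n"
    using assms * by (auto simp: words_Cons mergeable_def sum_list_eq_0_iff)
qed

lemma bar_head_chains: "j > 0 \<or> l = 0 \<Longrightarrow> f \<in> head_chains j l (Suc n) \<Longrightarrow> bar f \<in> head_chains j l n"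
  by (rule supp_lin_ext) (auto intro: lin_ops words_bar)

lemma wrap_head_chains: "j > 0 \<or> l = 0 \<Longrightarrow> f \<in> head_chains j l (Suc n) \<Longrightarrow> wrap f \<in> head_chains j l n"
  by (rule supp_lin_ext) (auto intro: lin_ops words_wrap)

lemma hoch_head_chains: "j > 0 \<or> l = 0 \<Longrightarrow> f \<in> head_chains j l (Suc n) \<Longrightarrow> hoch f \<in> head_chains j l n"
  unfolding hoch_Len[OF head_chains_Len] by (intro supp_add supp_scale bar_head_chains wrap_head_chains)

text \<open>On words whose tail is pure this is the Hochschild class for \<open>T\<close>: a letter in degree 0 gives its power of
  \<open>t\<close>, and \<open>[a, t\<^sup>y]\<close> in degree 1 gives \<open>y\<close> times the power of \<open>t\<close> in \<open>a t\<^sup>y\<close>, as for \<open>a d(t\<^sup>y)\<close>. In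
  general the nonpure letters are first merged into the head, with the sign of moving \<open>t\<close> past them.\<close>

fun phi_list :: "letter list \<Rightarrow> (int \<Rightarrow>\<^sub>0 'k::field)" where
  "phi_list [] = 0"
| "phi_list [a] = sg (snd a)"
| "phi_list (a # c # w) = (if fst c = 0
     then (if w = [] then Poly_Mapping.single (snd a + snd c) (of_int (snd c)) else 0)
     else fscale (twist a c) (phi_list ((a + c) # w)))"

definition phi :: "'k::field chain \<Rightarrow> (int \<Rightarrow>\<^sub>0 'k)" where
  "phi = lin_ext phi_list"

lemma lin_phi: "lin phi"
  by (simp add: phi_def lin_lin_ext)

lemmas [lin_intros] = lin_phi[THEN lin_comp]

lemma phi_sg: "phi (sg w) = phi_list w"
  by (simp add: phi_def)

subsection \<open>Hochschild homology of the Laurent polynomials\<close>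

text \<open>The sum over \<open>0 \<le> l < y\<close>, continued to negative \<open>y\<close> in the only way for which \<open>isum_add_1\<close> holds for
  all \<open>y\<close>.\<close>

definition isum :: "(int \<Rightarrow> 'a::ab_group_add) \<Rightarrow> int \<Rightarrow> 'a" where
  "isum F y = (\<Sum>l\<in>{0..<y}. F l) - (\<Sum>l\<in>{y..<0}. F l)"

lemma isum_0 [simp]: "isum F 0 = 0"
  by (simp add: isum_def)

lemma isum_add_1: "isum F (y + 1) = isum F y + F y"
proof (cases "y \<ge> 0")
  case True
  then have "{0..<y + 1} = insert y {0..<y}" by auto
  then show ?thesis using True by (simp add: isum_def)
next
  case False
  then have "{y..<0} = insert y {y + 1..<0}" by auto
  then show ?thesis using False by (simp add: isum_def)
qed

text \<open>The difference equation determines the sum, for negative arguments as well; this replaces case distinctions on the sign.\<close>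

lemma isum_induct:
  assumes "f 0 = (0 :: 'a::ab_group_add)" "\<And>y. f (y + 1) = f y + F y"
  shows "isum F y = f y"
proof (induction y rule: int_induct[of _ 0])
  case (step1 i)
  then show ?case by (simp add: isum_add_1 assms(2))
next
  case (step2 i)
  then show ?case using isum_add_1[of F "i - 1"] assms(2)[of "i - 1"] by simp
qed (simp add: assms(1))

lemma isum_telescope: "isum (\<lambda>l. f (l + 1) - f l) y = f y - f 0"
  by (rule isum_induct) (auto simp: algebra_simps)

lemma isum_shift: "isum F (y + z) = isum F y + isum (\<lambda>l. F (l + y)) z"
proof -
  have "isum (\<lambda>l. F (l + y)) z = isum F (y + z) - isum F y"
  proof (rule isum_induct[where f = "\<lambda>z. isum F (y + z) - isum F y"])
    show "isum F (y + (z + 1)) - isum F y = isum F (y + z) - isum F y + F (z + y)" for z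
      using isum_add_1[of F "y + z"] by (simp add: add.assoc add.commute[of z y])
  qed simp
  then show ?thesis by simp
qed

lemma isum_1: "isum (\<lambda>l. 1) y = (of_int y :: 'k::field)"
  by (rule isum_induct) auto

lemma isum_cong: "(\<And>l. F l = G l) \<Longrightarrow> isum F y = isum G y"
  by (simp add: isum_def)

lemma isum_add: "isum (\<lambda>l. F l + G l) y = isum F y + isum G y"
  and isum_diff: "isum (\<lambda>l. F l - G l) y = isum F y - isum G y"
  by (simp_all add: isum_def sum.distrib sum_subtractf)

lemma lin_isum: "lin T \<Longrightarrow> T (isum F y) = isum (\<lambda>l. T (F l)) y"
  by (simp add: isum_def lin_diff lin_sum)

lemma isum_fscale: "isum (\<lambda>l. fscale (F l) q) y = fscale (isum F y) q"
  by (simp add: isum_def free_vs.scale_left_diff_distrib free_vs.scale_sum_left)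

lemma isum_fscale': "fscale c (isum F y) = isum (\<lambda>l. fscale c (F l)) y"
  by (simp add: isum_def free_vs.scale_right_diff_distrib free_vs.scale_sum_right)

lemma isum_supp: "(\<And>l. F l \<in> supp S) \<Longrightarrow> isum F y \<in> supp S"
  by (simp add: isum_def supp_diff supp_sum)

lemma lin_isum' [lin_intros]: "(\<And>l. lin (F l)) \<Longrightarrow> lin (\<lambda>f. isum (\<lambda>l. F l f) y)"
  unfolding isum_def by (intro lin_intros)

text \<open>The algebra \<open>T\<close> has a bimodule resolution of length 1, generated by \<open>1\<close> and \<open>t\<close>. This is the homotopy
  onto it, built on \<open>t\<^sup>y \<otimes> 1 - 1 \<otimes> t\<^sup>y = \<Sum> t\<^sup>l (t \<otimes> 1 - 1 \<otimes> t) t\<^sup>y\<^sup>-\<^sup>1\<^sup>-\<^sup>l\<close>.\<close>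

fun hom_G_list :: "letter list \<Rightarrow> 'k::field chain" where
  "hom_G_list (a # c # w) =
     isum (\<lambda>l. sg ((a + (0, l)) # (0, 1) # (0, snd c - 1 - l) # w)) (snd c)"
| "hom_G_list _ = 0"

text \<open>It removes the degenerate words with a unit in second position that \<open>hom_G\<close> leaves behind.\<close>

fun hom_I_list :: "letter list \<Rightarrow> 'k::field chain" where
  "hom_I_list (a # c # w) = sg ((a + c) # (0, 0) # (0, 0) # w)"
| "hom_I_list _ = 0"

definition hom_G :: "'k::field chain \<Rightarrow> 'k chain" where "hom_G = lin_ext hom_G_list"

definition hom_I :: "'k::field chain \<Rightarrow> 'k chain" where "hom_I = lin_ext hom_I_list"

lemma lin_hom: "lin hom_G" "lin hom_I"
  by (simp_all add: hom_G_def hom_I_def lin_lin_ext)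

lemmas [lin_intros] = lin_hom[THEN lin_comp]

lemma hom_G_single: "hom_G (sg w) = hom_G_list w"
  and hom_I_single: "hom_I (sg w) = hom_I_list w"
  by (simp_all add: hom_G_def hom_I_def)

lemma hom_G_cons: "hom_G (cons a (cons c u)) =
    isum (\<lambda>l. cons (a + (0, l)) (cons (0, 1) (cons (0, snd c - 1 - l) u))) (snd c)"
proof (rule lin_eqI[where f = u])
  show "hom_G (cons a (cons c (sg w))) =
    isum (\<lambda>l. cons (a + (0, l)) (cons (0, 1) (cons (0, snd c - 1 - l) (sg w)))) (snd c)" for w
    by (simp add: hom_G_single)
qed (intro lin_intros)+

lemma hom_I_cons: "hom_I (cons a (cons c u)) = cons (a + c) (cons (0, 0) (cons (0, 0) u))"
proof (rule lin_eqI[where f = u])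
  show "hom_I (cons a (cons c (sg w))) = cons (a + c) (cons (0, 0) (cons (0, 0) (sg w)))" for w
    by (simp add: hom_I_single)
qed (intro lin_intros)+

lemma letter_add_unit [simp]: "a + (0, 0) = a" "(0, 0) + a = (a :: letter)"
  by (simp_all flip: zero_prod_def)

lemma coef_pure: "fst c = 0 \<Longrightarrow> coef a c = 1"
  by (simp add: coef_def)

lemma lmul_sg_Cons: "lmul a (sg (c # w)) = fscale (coef a c) (cons (a + c) (sg w))"
  by (simp add: lmul_Cons fscale_single)

lemmas hom_G_add = lin_add[OF lin_hom(1)]
  and hom_G_diff = lin_diff[OF lin_hom(1)]
  and hom_G_scale = lin_scale[OF lin_hom(1)]

text \<open>The first two faces of the summands telescope. The other faces cancel, since the sum belonging to
  \<open>t\<^sup>y\<^sup>+\<^sup>z\<close> splits at \<open>y\<close> (\<open>isum_shift\<close>).\<close>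

lemma bar_hom_G:
  assumes "fst c = 0" "list_all (\<lambda>a. fst a = 0) w"
  shows "bar (hom_G (sg (a # c # w))) + hom_G (bar (sg (a # c # w))) =
    sg ((a + c) # (0, 0) # w) - (sg (a # c # w) :: 'k::field chain)"
proof -
  obtain y where c: "c = (0, y)" using assms(1) by (cases c) auto
  define f where "f l = (sg ((a + (0, l)) # (0, y - l) # w) :: 'k chain)" for l
  define g where "g l = (cons (a + (0, l)) (cons (0, 1) (bar (sg ((0, y - 1 - l) # w)))) :: 'k chain)" for l
  have "bar (sg ((a + (0, l)) # (0, 1) # (0, y - 1 - l) # w)) = f (l + 1) - f l + g l" for l
  proof -
    have "bar (sg ((a + (0, l)) # (0, 1) # (0, y - 1 - l) # w)) =
       lmul (a + (0, l)) (sg ((0, 1) # (0, y - 1 - l) # w)) -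
       cons (a + (0, l)) (lmul (0, 1) (sg ((0, y - 1 - l) # w)) - cons (0, 1) (bar (sg ((0, y - 1 - l) # w))))"
      by (simp only: bar_Cons)
    then show ?thesis
      by (simp add: f_def g_def lmul_Cons coef_pure cons_diff add.assoc algebra_simps)
  qed
  then have "bar (hom_G (sg (a # c # w))) = isum (\<lambda>l. (f (l + 1) - f l) + g l) y"
    by (simp add: hom_G_single c lin_isum[OF lin_ops(4)])
  also have "\<dots> = f y - f 0 + isum g y"
    by (simp only: isum_add isum_telescope)
  finally have 1: "bar (hom_G (sg (a # c # w))) = f y - f 0 + isum g y" .
  have "hom_G (bar (sg (a # c # w))) = - isum g y"
  proof (cases w)
    case Nil
    then show ?thesis
      by (simp add: bar_Cons lmul_Cons bar_singleton cons_zero g_def isum_def coef_pure assms(1)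
        hom_G_single lmul_Nil bar_Nil)
  next
    case (Cons d v)
    then obtain z where d: "d = (0, z)" using assms(2) by (cases d) auto
    let ?u = "bar (sg (d # v)) :: 'k chain"
    have "g l = sg ((a + (0, l)) # (0, 1) # (0, y + z - 1 - l) # v)
        - cons (a + (0, l)) (cons (0, 1) (cons (0, y - 1 - l) ?u))" for l
    proof -
      have "bar (sg ((0, y - 1 - l) # w)) = (sg ((0, y + z - 1 - l) # v) - cons (0, y - 1 - l) ?u :: 'k chain)"
        unfolding Cons bar_Cons[of _ "d # v"] by (simp add: d lmul_Cons coef_pure algebra_simps)
      then show ?thesis by (simp add: g_def cons_diff)
    qed
    then have gsum: "isum g y = isum (\<lambda>l. sg ((a + (0, l)) # (0, 1) # (0, y + z - 1 - l) # v)) y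
        - hom_G (cons a (cons c ?u))"
      unfolding hom_G_cons c snd_conv isum_diff[symmetric] by (rule isum_cong)
    have "bar (sg (a # c # w)) = sg ((a + c) # w) - sg (a # (c + d) # v) + cons a (cons c ?u)"
      unfolding bar_Cons[of a] bar_Cons[of c] Cons
      by (simp add: lmul_Cons coef_pure assms(1) d cons_diff)
    then have "hom_G (bar (sg (a # c # w))) =
        hom_G (sg ((a + c) # w)) - hom_G (sg (a # (c + d) # v)) + hom_G (cons a (cons c ?u))"
      by (simp add: hom_G_add hom_G_diff)
    also have "hom_G (sg (a # (c + d) # v)) =
        isum (\<lambda>l. sg ((a + (0, l)) # (0, 1) # (0, y + z - 1 - l) # v)) y + hom_G (sg ((a + c) # w))"
      by (simp add: hom_G_single c d Cons isum_shift add.assoc algebra_simps)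
    finally show ?thesis by (simp add: gsum)
  qed
  then show ?thesis unfolding 1 by (simp add: f_def c)
qed

lemmas hom_I_add = lin_add[OF lin_hom(2)]
  and hom_I_diff = lin_diff[OF lin_hom(2)]
  and hom_I_scale = lin_scale[OF lin_hom(2)]

lemma bar_hom_I:
  assumes "fst c = 0" "list_all (\<lambda>a. fst a = 0) w"
  shows "bar (hom_I (sg (a # c # w))) + hom_I (bar (sg (a # c # w))) =
    (if w = [] then 0 else sg ((a + c) # (0, 0) # w) :: 'k::field chain)"
proof -
  have "bar (hom_I (sg (a # c # w))) = (cons (a + c) (cons (0, 0) (bar (sg ((0, 0) # w)))) :: 'k chain)"
    by (simp add: hom_I_single bar_Cons[of _ "_ # _ # _"] bar_Cons[of "(0, 0)" "_ # _"] lmul_Cons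
       cons_diff)
  moreover have "bar (sg (a # c # w)) = sg ((a + c) # w) - cons a (bar (sg (c # w)))"
    by (simp add: bar_Cons[of a] lmul_Cons coef_pure assms(1))
  ultimately show ?thesis
  proof (cases w)
    case Nil
    then show ?thesis
      by (simp add: bar_Cons lmul_Cons bar_singleton cons_zero coef_pure assms(1)
        hom_I_single lmul_Nil bar_Nil)
  next
    case (Cons d v)
    let ?u = "bar (sg (d # v)) :: 'k chain"
    have d: "fst d = 0" using assms(2) Cons by simp
    have 1: "bar (hom_I (sg (a # c # w))) = sg ((a + c) # (0, 0) # w) - cons (a + c) (cons (0, 0) (cons (0, 0) ?u))"
      by (simp add: hom_I_single bar_Cons[of _ "_ # _ # _"] bar_Cons[of "(0, 0)" "_ # _"] lmul_Cons
         cons_diff Cons)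
    have "bar (sg (a # c # w)) = sg ((a + c) # w) - sg (a # (c + d) # v) + cons a (cons c ?u)"
      unfolding bar_Cons[of a] bar_Cons[of c] Cons
      by (simp add: lmul_Cons coef_pure assms(1) d cons_diff)
    then have "hom_I (bar (sg (a # c # w))) = cons (a + c) (cons (0, 0) (cons (0, 0) ?u))"
      by (simp add: hom_I_add hom_I_diff hom_I_cons hom_I_single Cons add.assoc)
    with 1 show ?thesis by (simp add: Cons)
  qed
qed

definition hom_H :: "'k::field chain \<Rightarrow> 'k chain" where
  "hom_H f = hom_I f - hom_G f"

lemma lin_hom_H: "lin hom_H"
  unfolding hom_H_def[abs_def] by (intro lin_intros lin_hom)

lemmas [lin_intros] = lin_hom_H[THEN lin_comp]

lemma words_0: "w \<in> words j 0 n \<longleftrightarrow> (\<exists>x v. w = (j, x) # v \<and> length v = n \<and> list_all (\<lambda>a. fst a = 0) v)"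
  by (auto simp: words_def sum_list_eq_0_iff list_all_iff)

lemma hom_H_head_chains: "f \<in> head_chains j 0 n \<Longrightarrow> hom_H f \<in> head_chains j 0 (Suc n)"
proof (rule supp_lin_ext[OF _ lin_hom_H])
  fix w assume "w \<in> words j 0 n"
  then show "hom_H (sg w) \<in> (head_chains j 0 (Suc n) :: 'a chain set)"
    by (cases w rule: hom_I_list.cases)
      (auto simp: words_0 hom_H_def hom_I_single hom_G_single intro!: supp_diff supp_single isum_supp)
qed

text \<open>The homotopy changes the head only by multiplication from the right, and the cyclic face multiplies it from the left.\<close>

lemma wrap_hom_H:
  assumes "w \<noteq> []" "list_all (\<lambda>a. fst a = 0) (c # w)"
  shows "wrap (hom_H (sg (a # c # w))) = hom_H (wrap (sg (a # c # w)))"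
proof -
  obtain v d where w: "w = v @ [d]" using assms(1) by (cases w rule: rev_cases) auto
  have "wrap (sg (a' # c' # d' # v @ [d])) = fscale (coef d a') (sg ((d + a') # c' # d' # v) :: 'a chain)" for a' c' d'
    using wrap_snoc[of a' "c' # d' # v" d] by (simp add: fscale_single)
  moreover have "wrap (sg (a # c # v @ [d])) = fscale (coef d a) (sg ((d + a) # c # v) :: 'a chain)"
    using wrap_snoc[of a "c # v" d] by (simp add: fscale_single)
  moreover have "coef d (a + (0, l)) = (coef d a :: 'a)" "coef d (a + c) = (coef d a :: 'a)" for l
    using assms(2) by (simp_all add: coef_def twist_def)
  moreover have "fst d = 0" "fst c = 0" using assms(2) w by auto
  ultimately show ?thesis
    by (simp add: w hom_H_def hom_I_single hom_G_single wrap_diff lin_isum[OF lin_ops(5)]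
        hom_G_scale hom_I_scale isum_fscale' add.assoc
       free_vs.scale_right_diff_distrib)
qed

lemmas hom_H_add = lin_add[OF lin_hom_H]
  and hom_H_scale = lin_scale[OF lin_hom_H]
  and hom_H_zero = lin_0[OF lin_hom_H]

lemma hom_H_contract:
  assumes "f \<in> head_chains j 0 (Suc (Suc n))"
  shows "hoch (hom_H f) + hom_H (hoch f) = f"
proof (rule lin_eq_on_supp[OF assms, where F = "\<lambda>f. hoch (hom_H f) + hom_H (hoch f)" and G = "\<lambda>f. f"])
  fix w assume w: "w \<in> words j 0 (Suc (Suc n))"
  then obtain x c v where wv: "w = (j, x) # c # v" "length v = Suc n" "fst c = 0" "list_all (\<lambda>a. fst a = 0) v"
    by (auto simp: words_0 length_Suc_conv)
  then have "v \<noteq> []" by auto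
  have sw: "sg w \<in> (head_chains j 0 (Suc (Suc n)) :: 'a chain set)" using w by (rule supp_single)
  have "hoch (hom_H (sg w)) = bar (hom_H (sg w)) + fscale ((- 1) ^ Suc (Suc (Suc n))) (wrap (hom_H (sg w)) :: 'a chain)"
    using hoch_Len[OF head_chains_Len[OF hom_H_head_chains[OF sw]]] .
  moreover have "hom_H (hoch (sg w)) = hom_H (bar (sg w)) + fscale ((- 1) ^ Suc (Suc n)) (hom_H (wrap (sg w)) :: 'a chain)"
    using hoch_Len[OF head_chains_Len[OF sw]] by (simp add: hom_H_add hom_H_scale)
  moreover have "wrap (hom_H (sg w)) = (hom_H (wrap (sg w)) :: 'a chain)"
    unfolding wv(1) by (rule wrap_hom_H) (use wv \<open>v \<noteq> []\<close> in auto)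
  moreover have "bar (hom_H (sg w)) + hom_H (bar (sg w)) = (sg w :: 'a chain)"
    using bar_hom_G[OF wv(3,4), of "(j, x)", where 'k = 'a] bar_hom_I[OF wv(3,4), of "(j, x)", where 'k = 'a] \<open>v \<noteq> []\<close>
    by (simp add: hom_H_def wv(1) bar_diff algebra_simps)
  ultimately show "hoch (hom_H (sg w)) + hom_H (hoch (sg w)) = (sg w :: 'a chain)"
    by (simp add: fscale_neg)
qed (intro lin_intros)+

text \<open>In degree 1 the second letter is also the last one, so the cyclic face does not commute with
  \<open>hom_G\<close>. The remainder is a combination of words \<open>[a, t]\<close>.\<close>

lemma hom_H_degree_1:
  assumes "z \<in> head_chains j 0 1"
  shows "z = hoch (hom_H z) + wrap (hom_G z)"
proof (rule sym, rule lin_eq_on_supp[OF assms, where F = "\<lambda>z. hoch (hom_H z) + wrap (hom_G z)" and G = "\<lambda>f. f"])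
  fix w assume w: "w \<in> words j 0 1"
  then obtain x c where wc: "w = [(j, x), c]" "fst c = 0"
    by (auto simp: words_0 length_Suc_conv)
  have sw: "sg w \<in> (head_chains j 0 1 :: 'a chain set)" using w by (rule supp_single)
  have len: "hom_H (sg w) \<in> (supp (Len (Suc 2)) :: 'a chain set)"
    using head_chains_Len[OF hom_H_head_chains[OF sw]] by (simp add: numeral_2_eq_2)
  let ?a = "(j, x) :: letter"
  have I: "bar (hom_I (sg w)) = (0 :: 'a chain)" "wrap (hom_I (sg w)) = (sg [?a + c, (0, 0)] :: 'a chain)"
    using bar_hom_I[OF wc(2), of "[]" ?a, where 'k = 'a] wrap_snoc[of "?a + c" "[(0, 0)]" "(0, 0)", where 'a='a]
    by (simp_all add: wc hom_I_single bar_Cons lmul_Cons lmul_Nil bar_Nil bar_singleton cons_zero)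
  have G: "bar (hom_G (sg w)) = (sg [?a + c, (0, 0)] - sg w :: 'a chain)"
    using bar_hom_G[OF wc(2), of "[]" ?a, where 'k = 'a]
    by (simp add: wc bar_Cons lmul_Cons lmul_Nil bar_Nil cons_zero coef_pure hom_G_single)
  have H: "bar (hom_H (sg w)) = (sg w - sg [?a + c, (0, 0)] :: 'a chain)"
    "wrap (hom_H (sg w)) = (sg [?a + c, (0, 0)] - wrap (hom_G (sg w)) :: 'a chain)"
    by (simp_all add: hom_H_def bar_diff wrap_diff I G)
  show "hoch (hom_H (sg w)) + wrap (hom_G (sg w)) = (sg w :: 'a chain)"
    unfolding hoch_Len[OF len] H by simp
qed (intro lin_intros lin_hom)+

lemma wrap_hom_G:
  "wrap (hom_G (sg [(j, x), (0, y)]) :: 'k::field chain) =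
    fscale (isum (\<lambda>l. parity ((y - 1 - l) * int j)) y) (sg [(j, x + y - 1), (0, 1)])"
proof -
  have "wrap (sg [(j, x) + (0, l), (0, 1), (0, y - 1 - l)] :: 'k chain) =
      fscale (parity ((y - 1 - l) * int j)) (sg [(j, x + y - 1), (0, 1)])" for l
    using wrap_snoc[of "(j, x) + (0, l)" "[(0, 1)]" "(0, y - 1 - l)", where 'a = 'k]
    by (simp add: coef_def twist_def fscale_single add.commute add_diff_eq)
  then show ?thesis
    by (simp add: hom_G_single lin_isum[OF lin_ops(5)] isum_fscale)
qed

lemma hoch_pair: "hoch (sg [(j, x), (0, y)]) = Poly_Mapping.single [(j, x + y)] (1 - parity (y * int j))"
proof -
  have "wrap (sg ([(j, x)] @ [(0, y)])) = Poly_Mapping.single [(j, x + y)] (parity (y * int j) :: 'a)"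
    using wrap_snoc[of "(j, x)" "[]" "(0, y)", where 'a = 'a] by (simp add: coef_def twist_def add.commute)
  then show ?thesis
    by (simp add: hoch_single bar_Cons lmul_Cons lmul_Nil bar_Nil cons_zero coef_pure
        single_diff fscale_m1)
qed

text \<open>Degrees above 1 are contracted by \<open>hom_H\<close>. In degree 1 only the words \<open>[a, t]\<close> remain. Their boundary
  is \<open>a t - t a\<close>, which is \<open>2 a t\<close> for odd \<open>j\<close> and 0 for even \<open>j\<close>. In the latter case \<open>phi\<close> determines the
  coefficients of these words.\<close>

lemma laurent_boundary:
  fixes z :: "'k::field_char_0 chain"
  assumes z: "z \<in> head_chains j 0 n" and cyc: "hoch z = 0" and phi: "even j \<Longrightarrow> phi z = 0"
  shows "\<exists>y\<in>head_chains j 0 (Suc n). z = hoch y"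
proof -
  consider "n = 0" | "n = 1" | m where "n = Suc (Suc m)"
    by (metis One_nat_def not0_implies_Suc)
  then show ?thesis
  proof cases
    case 1
    show ?thesis
    proof (cases "even j")
      case True
      have "z = lin_ext (\<lambda>r. sg [(j, r)]) (phi z)"
        by (rule lin_eq_on_supp[OF z, where F = "\<lambda>f. f" and G = "\<lambda>z. lin_ext (\<lambda>r. sg [(j, r)]) (phi z)"])
          (intro lin_intros lin_phi | auto simp: 1 words_0 phi_sg)+
      then have "z = 0" using phi[OF True] by (simp add: lin_0[OF lin_lin_ext])
      then show ?thesis by (intro bexI[of _ 0]) (simp_all add: hoch_zero)
    next
      case False
      let ?K = "lin_ext (\<lambda>w. Poly_Mapping.single [(j, snd (hd w) - 1), (0, 1)] (1 / 2)) :: 'k chain \<Rightarrow> 'k chain"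
      have "hoch (?K z) = z"
      proof (rule lin_eq_on_supp[OF z, where F = "\<lambda>z. hoch (?K z)" and G = "\<lambda>f. f"])
        fix w assume "w \<in> words j 0 n"
        then obtain x where w: "w = [(j, x)]" by (auto simp: 1 words_0)
        have "hoch (?K (sg w)) = fscale (1 / 2) (hoch (sg [(j, x - 1), (0, 1)]))"
          by (simp add: w fscale_single flip: hoch_scale)
        then show "hoch (?K (sg w)) = (sg w :: 'k chain)"
          using False by (simp add: w hoch_pair fscale_single parity_def)
      qed (intro lin_intros)+
      moreover have "?K z \<in> head_chains j 0 (Suc n)"
        by (rule supp_lin_ext[OF z lin_lin_ext]) (auto simp: 1 words_0 intro!: supp_single)
      ultimately show ?thesis by metis
    qed
  next
    case 2
    have split: "z = hoch (hom_H z) + wrap (hom_G z)"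
      using hom_H_degree_1 z 2 by simp
    have w1: "\<exists>x y. w = [(j, x), (0, y)]" if "w \<in> words j 0 n" for w
      using that by (auto simp: 2 words_0 length_Suc_conv)
    have "wrap (hom_G z) = 0"
    proof (cases "even j")
      case True
      have "wrap (hom_G z) = lin_ext (\<lambda>r. sg [(j, r - 1), (0, 1)]) (phi z)"
      proof (rule lin_eq_on_supp[OF z, where F = "\<lambda>z. wrap (hom_G z)"
            and G = "\<lambda>z. lin_ext (\<lambda>r. sg [(j, r - 1), (0, 1)]) (phi z)"])
        fix w assume "w \<in> words j 0 n"
        then obtain x y where w: "w = [(j, x), (0, y)]" using w1 by blast
        have "(\<lambda>l. parity ((y - 1 - l) * int j)) = (\<lambda>l. 1 :: 'k)"
          using True by (auto simp: parity_def)
        then show "wrap (hom_G (sg w)) = lin_ext (\<lambda>r. sg [(j, r - 1), (0, 1)]) (phi (sg w) :: int \<Rightarrow>\<^sub>0 'k)"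
          by (simp add: w wrap_hom_G phi_sg isum_1)
      qed (intro lin_intros lin_hom lin_phi)+
      then show ?thesis using phi[OF True] by (simp add: lin_0[OF lin_lin_ext])
    next
      case False
      let ?K = "lin_ext (\<lambda>w. Poly_Mapping.single [(j, snd (hd w) - 1), (0, 1)] (1 / 2)) :: 'k chain \<Rightarrow> 'k chain"
      have "wrap (hom_G z) = ?K (hoch (wrap (hom_G z)))"
      proof (rule lin_eq_on_supp[OF z, where F = "\<lambda>z. wrap (hom_G z)" and G = "\<lambda>z. ?K (hoch (wrap (hom_G z)))"])
        fix w assume "w \<in> words j 0 n"
        then obtain x y where w: "w = [(j, x), (0, y)]" using w1 by blast
        show "wrap (hom_G (sg w)) = ?K (hoch (wrap (hom_G (sg w))))"
          unfolding w wrap_hom_G hoch_scale lin_scale[OF lin_lin_ext] hoch_pair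
          using False by (simp add: fscale_single parity_def)
      qed (intro lin_intros lin_hom)+
      also have "hoch (wrap (hom_G z)) = 0"
        using arg_cong[OF split, of hoch] by (simp add: cyc hoch_add hoch_hoch)
      finally show ?thesis by (simp add: lin_0[OF lin_lin_ext])
    qed
    with split have "z = hoch (hom_H z)" by simp
    then show ?thesis using hom_H_head_chains[OF z] by blast
  next
    case 3
    have "z = hoch (hom_H z)"
      using hom_H_contract[of z j m] z cyc 3 by (simp add: hom_H_zero)
    then show ?thesis using hom_H_head_chains[OF z] by blast
  qed
qed

lemma phi_long: "w \<in> words j 0 (Suc (Suc n)) \<Longrightarrow> phi_list w = 0"
  by (auto simp: words_0 length_Suc_conv)

lemma phi_long_0: "f \<in> head_chains j 0 (Suc (Suc n)) \<Longrightarrow> phi f = 0"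
  by (erule lin_0_on_supp) (auto intro: lin_phi simp: phi_sg phi_long)

lemmas phi_add = lin_add[OF lin_phi]
  and phi_diff = lin_diff[OF lin_phi]
  and phi_scale = lin_scale[OF lin_phi]
  and phi_sum = lin_sum[OF lin_phi]
  and phi_uminus = lin_uminus[OF lin_phi]
  and phi_zero = lin_0[OF lin_phi]

lemma phi_hoch_laurent:
  assumes f: "f \<in> head_chains j 0 n" and j: "even j"
  shows "phi (hoch f) = 0"
proof (rule lin_0_on_supp[OF f, where F = "\<lambda>f. phi (hoch f)"])
  fix w assume w: "w \<in> words j 0 n"
  have sw: "sg w \<in> (head_chains j 0 n :: 'a chain set)" using w by (rule supp_single)
  have parity: "parity (y * int j) = (1 :: 'a)" "coef (0, y) (j, x) = (1 :: 'a)" for x y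
    using j by (auto simp: parity_def coef_def twist_def)
  consider "n = 0" | "n = 1" | "n = 2" | m where "n = Suc (Suc (Suc m))"
    by (metis One_nat_def not0_implies_Suc numeral_2_eq_2)
  then show "phi (hoch (sg w)) = (0 :: int \<Rightarrow>\<^sub>0 'a)"
  proof cases
    case 1
    then have "hoch (sg w) = (0 :: 'a chain)" using head_chains_Len[OF sw] by (intro hoch_0) simp
    then show ?thesis by (simp add: phi_zero)
  next
    case 2
    then obtain x y where "w = [(j, x), (0, y)]" using w by (auto simp: words_0 length_Suc_conv)
    then show ?thesis by (simp add: hoch_pair parity phi_zero)
  next
    case 3
    then obtain x y z where wz: "w = [(j, x), (0, y), (0, z)]"
      using w by (auto simp: words_0 length_Suc_conv numeral_2_eq_2)
    have "wrap (sg w) = (sg [(j, x + z), (0, y)] :: 'a chain)"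
      using wrap_snoc[of "(j, x)" "[(0, y)]" "(0, z)", where 'a = 'a] by (simp add: wz parity add.commute)
    then have B: "hoch (sg w) = (sg [(j, x + y), (0, z)] - sg [(j, x), (0, y + z)] + sg [(j, x + z), (0, y)] :: 'a chain)"
      by (simp add: hoch_single wz bar_Cons lmul_Cons lmul_Nil bar_Nil cons_zero coef_pure)
    show ?thesis
      unfolding B by (simp add: phi_add phi_diff phi_sg single_add add_ac)
  next
    case 4
    then show ?thesis using hoch_head_chains[of j 0 "sg w" "Suc (Suc m)"] sw phi_long_0 by blast
  qed
qed (intro lin_intros lin_phi lin_ops)+

subsection \<open>Merging the first two nonpure letters\<close>

text \<open>Passing from \<open>s\<^sub>i\<close>, powers of \<open>t\<close>, and \<open>s\<close> to \<open>s\<^sub>i\<^sub>+\<^sub>1\<close>. The powers of \<open>t\<close> in between form a bar resolution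
  of \<open>T\<close>, and this map is its augmentation; the lemmas on \<open>split_hd\<close> show that it loses no homology.\<close>

fun merge_list :: "letter list \<Rightarrow> 'k::field chain" where
  "merge_list (a # c # w) = (if fst c = 0 then 0 else Poly_Mapping.single ((a + c) # w) (twist a c))"
| "merge_list _ = 0"

definition merge :: "'k::field chain \<Rightarrow> 'k chain" where "merge = lin_ext merge_list"

definition unmerge :: "'k::field chain \<Rightarrow> 'k chain" where
  "unmerge = lin_ext (\<lambda>w. sg ((fst (hd w) - 1, 0) # (1, snd (hd w)) # tl w))"

text \<open>The extra degeneracy that splits the head \<open>s\<^sub>j t\<^sup>x\<close> into \<open>s\<^sub>j\<close> and \<open>t\<^sup>x\<close>.\<close>

definition split_hd :: "'k::field chain \<Rightarrow> 'k chain" where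
  "split_hd = lin_ext (\<lambda>w. sg ((fst (hd w), 0) # (0, snd (hd w)) # tl w))"

lemma lin_merge: "lin merge" "lin unmerge" "lin split_hd"
  by (simp_all add: merge_def unmerge_def split_hd_def lin_lin_ext)

lemmas [lin_intros] = lin_merge[THEN lin_comp]

lemma merge_sg: "merge (sg w) = merge_list w"
  and unmerge_Cons: "unmerge (sg ((j, x) # w)) = sg ((j - 1, 0) # (1, x) # w)"
  and split_hd_Cons: "split_hd (sg ((j, x) # w)) = sg ((j, 0) # (0, x) # w)"
  by (simp_all add: merge_def unmerge_def split_hd_def)

lemma words_Suc_cases:
  assumes "w \<in> words j (Suc l) n"
  obtains x i y v where "w = (j, x) # (i, y) # v" "i \<le> 1" "list_all (\<lambda>a. fst a \<le> 1) v"
    "i + sum_list (map fst v) = Suc l" "n = Suc (length v)"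
proof -
  obtain x u where u: "w = (j, x) # u" "length u = n" "list_all (\<lambda>a. fst a \<le> 1) u" "sum_list (map fst u) = Suc l"
    using assms by (auto simp: words_def)
  then obtain a v where "u = a # v" by (cases u) auto
  with u that[of x "fst a" "snd a" v] show ?thesis by auto
qed

lemma words_Suc_0: "words j (Suc l) 0 = {}"
  by (auto simp: words_def)

lemma merge_head_chains: "f \<in> head_chains j (Suc l) (Suc n) \<Longrightarrow> merge f \<in> head_chains (Suc j) l n"
  by (erule supp_lin_ext, rule lin_merge, erule words_Suc_cases)
    (auto simp: merge_sg words_Cons le_Suc_eq intro!: supp_single)

lemma unmerge_head_chains: "f \<in> head_chains (Suc j) l n \<Longrightarrow> unmerge f \<in> head_chains j (Suc l) (Suc n)"
  by (erule supp_lin_ext, rule lin_merge)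
    (auto simp: words_def unmerge_Cons intro!: supp_single)

lemma split_hd_head_chains: "f \<in> head_chains j l n \<Longrightarrow> split_hd f \<in> head_chains j l (Suc n)"
  by (erule supp_lin_ext, rule lin_merge)
    (auto simp: words_def split_hd_Cons intro!: supp_single)

lemma merge_unmerge: "f \<in> head_chains (Suc j) l n \<Longrightarrow> merge (unmerge f) = f"
  by (rule lin_eq_on_supp[where F = "\<lambda>f. merge (unmerge f)" and G = "\<lambda>f. f"])
    (assumption | intro lin_intros lin_merge | auto simp: words_def unmerge_Cons merge_sg)+

lemma merge_split_hd: "f \<in> head_chains j l n \<Longrightarrow> merge (split_hd f) = 0"
  by (rule lin_0_on_supp[where F = "\<lambda>f. merge (split_hd f)"])
    (assumption | intro lin_intros lin_merge | auto simp: words_def split_hd_Cons merge_sg)+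

lemma phi_merge: "f \<in> head_chains j (Suc l) n \<Longrightarrow> phi (merge f) = phi f"
proof (erule lin_eq_on_supp[where F = "\<lambda>f. phi (merge f)" and G = phi])
  fix w assume "w \<in> words j (Suc l) n"
  then show "phi (merge (sg w)) = (phi (sg w) :: int \<Rightarrow>\<^sub>0 'a)"
    by (rule words_Suc_cases)
      (auto simp: merge_sg phi_sg phi_def fscale_single lin_0[OF lin_lin_ext])
qed (intro lin_intros lin_phi lin_merge)+

lemma merge_cons2: "merge (cons a (cons c f)) = (if fst c = 0 then 0 else fscale (twist a c) (cons (a + c) f))"
proof (rule lin_eqI[where f = f])
  show "merge (cons a (cons c (sg w))) = (if fst c = 0 then 0 else fscale (twist a c) (cons (a + c) (sg w)))" for w
    by (simp add: merge_sg fscale_single)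
qed (intro lin_intros)+

lemmas merge_add = lin_add[OF lin_merge(1)]
  and merge_diff = lin_diff[OF lin_merge(1)]
  and merge_scale = lin_scale[OF lin_merge(1)]
  and merge_uminus = lin_uminus[OF lin_merge(1)]
  and merge_zero = lin_0[OF lin_merge(1)]

lemma bar_merge:
  assumes "fst a > 0"
  shows "bar (merge (sg (a # c # w))) = - merge (bar (sg (a # c # w)) :: 'k::field chain)"
proof -
  have bp2: "bar (sg (a # c # w)) = lmul a (sg (c # w)) - cons a (lmul c (sg w)) + cons a (cons c (bar (sg w) :: 'k chain))"
    by (simp only: bar_Cons cons_diff) simp
  show ?thesis
  proof (cases "fst c = 0")
    case True
    have "merge (lmul a (sg (c # w))) = (merge (cons a (lmul c (sg w))) :: 'k chain)"
    proof (cases w)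
      case (Cons d v)
      have "twist (a + c) d = (twist c d * twist a d :: 'k)" "twist a (c + d) = (twist a d :: 'k)"
        using True by (simp_all add: twist_add_left twist_add_right)
      moreover have "coef c d = (twist c d :: 'k)" using True by (simp add: coef_def)
      ultimately show ?thesis
        using lin_single[OF lin_merge(1), of "a # (c + d) # v" "coef c d :: 'k"] True
        by (simp add: Cons lmul_Cons coef_pure merge_sg fscale_single add.assoc)
    qed (simp add: lmul_Cons lmul_Nil coef_pure True merge_sg cons_zero merge_zero)
    then show ?thesis
      unfolding bp2
      by (simp add: True merge_sg merge_diff merge_add merge_cons2
        bar_zero del: cons_single)
  next
    case False
    have "merge (cons a (lmul c (sg w))) = (fscale (twist a c) (lmul (a + c) (sg w)) :: 'k chain)"
    proof (cases w)
      case (Cons d v)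
      have "coef c d * twist a (c + d) = (twist a c * coef (a + c) d :: 'k)"
        using False assms by (auto simp: coef_def twist_add_right)
      then show ?thesis
        using lin_single[OF lin_merge(1), of "a # (c + d) # v" "coef c d :: 'k"] False
        by (simp add: Cons lmul_Cons merge_sg fscale_single add.assoc)
    qed (simp add: lmul_Nil cons_zero merge_zero)
    moreover have "lmul a (sg (c # w)) = (0 :: 'k chain)"
      using False assms by (simp add: lmul_Cons coef_def)
    moreover have "merge (sg (a # c # w)) = (fscale (twist a c) (cons (a + c) (sg w)) :: 'k chain)"
      using False by (simp add: merge_sg fscale_single)
    ultimately show ?thesis
      unfolding bp2 using False
      by (simp add: merge_diff merge_add merge_cons2 merge_uminus
         bar_scale bar_cons free_vs.scale_right_diff_distrib del: cons_single)
  qed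
qed

lemma wrap_merge:
  assumes "fst a > 0"
  shows "wrap (merge (sg (a # c # w))) = (merge (wrap (sg (a # c # w))) :: 'k::field chain)"
proof (cases w rule: rev_cases)
  case Nil
  have "wrap (sg (a # [c])) = (Poly_Mapping.single [c + a] (coef c a) :: 'k chain)"
    using wrap_snoc[of a "[]" c, where 'a = 'k] by simp
  moreover have "wrap (Poly_Mapping.single [a + c] (twist a c)) = (0 :: 'k chain)"
    using lin_single[OF lin_ops(5), of "[a + c]" "twist a c :: 'k"] by (simp add: wrap_singleton)
  moreover have "merge (Poly_Mapping.single [c + a] (coef c a)) = (0 :: 'k chain)"
    by (simp add: merge_def)
  ultimately show ?thesis by (simp add: Nil merge_sg wrap_zero)
next
  case (snoc v d)
  have 1: "wrap (sg (a # c # w)) = fscale (coef d a) (sg ((d + a) # c # v) :: 'k chain)"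
    using wrap_snoc[of a "c # v" d, where 'a = 'k] by (simp add: snoc fscale_single)
  have 2: "wrap (sg ((a + c) # w)) = fscale (coef d (a + c)) (sg ((d + (a + c)) # v) :: 'k chain)"
    using wrap_snoc[of "a + c" v d, where 'a = 'k] by (simp add: snoc fscale_single)
  have 3: "merge (sg (a # c # w)) = (if fst c = 0 then 0 else fscale (twist a c) (sg ((a + c) # w) :: 'k chain))"
    by (simp add: merge_sg fscale_single)
  have "twist a c * coef d (a + c) = (coef d a * twist (d + a) c :: 'k)"
    using assms by (auto simp: coef_def twist_add_left twist_add_right)
  moreover have "merge (sg ((d + a) # c # v)) =
      (if fst c = 0 then 0 else fscale (twist (d + a) c) (sg ((d + a + c) # v) :: 'k chain))"
    by (simp add: merge_sg fscale_single)
  ultimately show ?thesis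
    unfolding 3 1
    by (auto simp: 2 wrap_zero merge_scale wrap_scale add.assoc)
qed

text \<open>The face that would multiply the two merged letters is zero, since the head is nonpure. The sign comes
  from the loss of one letter.\<close>

lemma hoch_merge:
  assumes f: "f \<in> head_chains j (Suc l) n" and j: "j > 0"
  shows "hoch (merge f) = - merge (hoch f)"
proof (rule lin_eq_on_supp[OF f, where F = "\<lambda>f. hoch (merge f)" and G = "\<lambda>f. - merge (hoch f)"])
  fix w assume w: "w \<in> words j (Suc l) n"
  then obtain a c v where wv: "w = a # c # v" "fst a = j" "n = Suc (length v)"
    by (rule words_Suc_cases) auto
  then have sw: "sg w \<in> (head_chains j (Suc l) (Suc (length v)) :: 'a chain set)"
    using w by (auto intro: supp_single)
  have "hoch (merge (sg w)) = bar (merge (sg w)) + fscale ((- 1) ^ length v) (wrap (merge (sg w)) :: 'a chain)"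
    by (rule hoch_Len[OF head_chains_Len[OF merge_head_chains[OF sw]]])
  moreover have "hoch (sg w) = bar (sg w) + fscale ((- 1) ^ Suc (length v)) (wrap (sg w) :: 'a chain)"
    by (rule hoch_Len[OF head_chains_Len[OF sw]])
  ultimately show "hoch (merge (sg w)) = - merge (hoch (sg w) :: 'a chain)"
    using bar_merge[of a c v, where 'k = 'a] wrap_merge[of a c v, where 'k = 'a] j
    by (simp add: wv merge_add merge_scale fscale_neg merge_uminus merge_diff)
qed (intro lin_intros lin_merge lin_ops)+

lemma split_hd_cons: "split_hd (cons (j, x) f) = cons (j, 0) (cons (0, x) f)"
proof (rule lin_eqI[where f = f])
  show "split_hd (cons (j, x) (sg w)) = cons (j, 0) (cons (0, x) (sg w))" for w
    by (simp add: split_hd_Cons)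
qed (intro lin_intros)+

lemmas split_hd_add = lin_add[OF lin_merge(3)]
  and split_hd_diff = lin_diff[OF lin_merge(3)]
  and split_hd_scale = lin_scale[OF lin_merge(3)]
  and split_hd_zero = lin_0[OF lin_merge(3)]

text \<open>Away from the cyclic face, the extra degeneracy contracts the gap between the head and the next
  nonpure letter. It leaves the words in which this gap is empty, normalised to have no \<open>t\<close> in the
  head.\<close>

lemma bar_split_hd:
  assumes f: "f \<in> head_chains j (Suc l) n" and j: "j > 0"
  shows "bar (split_hd f) + split_hd (bar f) = f - unmerge (merge f)"
proof (rule lin_eq_on_supp[OF f, where F = "\<lambda>f. bar (split_hd f) + split_hd (bar f)" and G = "\<lambda>f. f - unmerge (merge f)"])
  fix w assume "w \<in> words j (Suc l) n"
  then obtain x i y v where w: "w = (j, x) # (i, y) # v" and i: "i \<le> 1"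
    by (rule words_Suc_cases) auto
  let ?u = "bar (sg ((i, y) # v)) :: 'a chain"
  have "bar (split_hd (sg w)) = lmul (j, 0) (sg ((0, x) # (i, y) # v)) - cons (j, 0) (lmul (0, x) (sg ((i, y) # v)) - cons (0, x) ?u)"
    unfolding w split_hd_Cons by (simp only: bar_Cons)
  then have 1: "bar (split_hd (sg w)) = sg w - fscale (coef (0, x) (i, y)) (sg ((j, 0) # (i, x + y) # v)) + cons (j, 0) (cons (0, x) ?u)"
    by (simp add: w lmul_Cons coef_pure cons_diff fscale_single)
  have "split_hd (bar (sg w)) = split_hd (lmul (j, x) (sg ((i, y) # v))) - cons (j, 0) (cons (0, x) ?u)"
    by (simp only: w bar_Cons[of "(j, x)"] split_hd_diff split_hd_cons)
  moreover have "split_hd (lmul (j, x) (sg ((i, y) # v))) = (if i = 0 then sg ((j, 0) # (0, x + y) # v) else 0 :: 'a chain)"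
    using j by (auto simp: lmul_sg_Cons split_hd_scale coef_def split_hd_Cons)
  moreover have "unmerge (merge (sg w)) = (if i = 0 then 0 else fscale (twist (j, x) (i, y)) (sg ((j, 0) # (1, x + y) # v)) :: 'a chain)"
    using i by (auto simp: w merge_sg lin_0[OF lin_lin_ext] le_Suc_eq unmerge_def)
  ultimately show "bar (split_hd (sg w)) + split_hd (bar (sg w)) = (sg w - unmerge (merge (sg w)) :: 'a chain)"
    using i 1 by (auto simp: le_Suc_eq coef_def twist_def)
qed (intro lin_intros lin_ops)+

text \<open>The cyclic face multiplies the head from the left, with which the extra degeneracy does not
  commute.\<close>

definition wrap_defect :: "'k::field chain \<Rightarrow> 'k chain" where
  "wrap_defect f = split_hd (wrap f) - wrap (split_hd f)"

lemma lin_wrap_defect: "lin wrap_defect"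
  unfolding wrap_defect_def[abs_def] by (intro lin_intros)

lemma hoch_split_hd:
  assumes f: "f \<in> head_chains j (Suc l) n" and j: "j > 0"
  shows "hoch (split_hd f) + split_hd (hoch f) = f - unmerge (merge f) + fscale ((- 1) ^ n) (wrap_defect f)"
proof -
  have 1: "hoch (split_hd f) = bar (split_hd f) + fscale ((- 1) ^ Suc n) (wrap (split_hd f))"
    by (rule hoch_Len[OF head_chains_Len[OF split_hd_head_chains[OF f]]])
  have 2: "split_hd (hoch f) = split_hd (bar f) + fscale ((- 1) ^ n) (split_hd (wrap f))"
    unfolding hoch_Len[OF head_chains_Len[OF f]] by (simp add: split_hd_add split_hd_scale)
  have "hoch (split_hd f) + split_hd (hoch f) = (bar (split_hd f) + split_hd (bar f)) + fscale ((- 1) ^ n) (wrap_defect f)"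
    unfolding 1 2 wrap_defect_def free_vs.scale_right_diff_distrib by (simp add: fscale_neg)
  then show ?thesis unfolding bar_split_hd[OF f j] .
qed

text \<open>The filtration: the number of pure letters behind the second nonpure letter.\<close>

definition pure_after :: "letter list \<Rightarrow> nat" where
  "pure_after w = length (filter (\<lambda>a. fst a = 0) (dropWhile (\<lambda>a. fst a = 0) (tl w)))"

text \<open>If the cyclic face is not zero, the last letter is pure. It lies behind the second nonpure letter, and
  the cyclic face moves it to the head.\<close>

lemma wrap_defect_lowers:
  assumes f: "f \<in> supp {w \<in> words j (Suc l) n. pure_after w < Suc Q}" and j: "j > 0"
  shows "wrap_defect f \<in> supp {w \<in> words j (Suc l) n. pure_after w < Q}" (is "_ \<in> supp ?K")
proof (rule supp_lin_ext[OF f lin_wrap_defect])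
  fix w assume *: "w \<in> {w \<in> words j (Suc l) n. pure_after w < Suc Q}"
  then obtain x u where u: "w = (j, x) # u" "length u = n" "list_all (\<lambda>a. fst a \<le> 1) u"
    "sum_list (map fst u) = Suc l"
    by (auto simp: words_def)
  from u(4) have "u \<noteq> []" by auto
  then obtain v d where v: "u = v @ [d]"
    by (cases u rule: rev_cases) auto
  have wr1: "wrap (sg w) = Poly_Mapping.single ((d + (j, x)) # v) (coef d (j, x) :: 'a)"
    using wrap_snoc[of "(j, x)" v d, where 'a = 'a] by (simp add: u v)
  have wr2: "wrap (split_hd (sg w)) = Poly_Mapping.single ((d + (j, 0)) # (0, x) # v) (coef d (j, 0) :: 'a)"
    using wrap_snoc[of "(j, 0)" "(0, x) # v" d, where 'a = 'a] by (simp add: u v split_hd_Cons)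
  show "wrap_defect (sg w) \<in> (supp ?K :: 'a chain set)"
  proof (cases "fst d = 0")
    case False
    then show ?thesis using j by (simp add: wrap_defect_def wr1 wr2 coef_def split_hd_zero)
  next
    case True
    then obtain z where d: "d = (0, z)" by (cases d) auto
    have "\<exists>a\<in>set v. fst a \<noteq> 0"
      using u(4) by (rule_tac ccontr) (auto simp: v d sum_list_eq_0_iff[THEN iffD2])
    then have "dropWhile (\<lambda>a. fst a = 0) (v @ [d]) = dropWhile (\<lambda>a. fst a = 0) v @ [d]"
      by (auto intro: dropWhile_append1)
    then have pa: "pure_after w = Suc (length (filter (\<lambda>a. fst a = 0) (dropWhile (\<lambda>a. fst a = 0) v)))"
      by (simp add: pure_after_def u v d)
    have sp: "split_hd (wrap (sg w)) = Poly_Mapping.single ((j, 0) # (0, z + x) # v) (coef d (j, x) :: 'a)"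
      unfolding wr1 by (simp add: split_hd_def d fscale_single)
    show ?thesis
      unfolding wrap_defect_def sp wr2
      using * pa u by (auto simp: d pure_after_def words_Cons v intro!: supp_diff supp_single)
  qed
qed

lemmas unmerge_zero = lin_0[OF lin_merge(2)]

text \<open>By \<open>hoch_split_hd\<close>, a cycle in the kernel of \<open>merge\<close> is up to sign homologous to its wrap defect, which
  is again such a cycle, of lower filtration.\<close>

lemma ker_merge_boundary:
  assumes "f \<in> supp {w \<in> words j (Suc l) n. pure_after w < Q}" "hoch f = 0" "merge f = 0" "j > 0"
  shows "\<exists>y\<in>head_chains j (Suc l) (Suc n). f = hoch y"
  using assms
proof (induction Q arbitrary: f)
  case 0
  then have "f = 0" using supp_empty by simp
  then show ?case by (intro bexI[of _ 0]) (simp_all add: hoch_zero)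
next
  case (Suc Q)
  have fC: "f \<in> head_chains j (Suc l) n" using Suc.prems(1) by (auto elim: supp_mono)
  define s :: 'a where "s = (- 1) ^ n"
  define g where "g = wrap_defect f"
  have s: "s * s = 1" by (simp add: s_def flip: power_mult_distrib)
  have hf: "split_hd f \<in> head_chains j (Suc l) (Suc n)" by (rule split_hd_head_chains[OF fC])
  have eq: "hoch (split_hd f) = f + fscale s g"
    using hoch_split_hd[OF fC Suc.prems(4)] Suc.prems(2,3)
    by (simp add: split_hd_zero unmerge_zero s_def g_def)
  then have "fscale s (hoch (split_hd f) - f) = g"
    by (simp add: s)
  then have g: "g = fscale s (hoch (split_hd f) - f)" by simp
  have "hoch g = 0"
    unfolding g by (simp add: hoch_scale hoch_diff hoch_hoch Suc.prems(2))
  moreover have "merge (hoch (split_hd f)) = 0"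
    using hoch_merge[OF hf Suc.prems(4)] merge_split_hd[OF fC] by (simp add: hoch_zero)
  then have "merge g = 0"
    unfolding g by (simp add: merge_scale merge_diff Suc.prems(3))
  ultimately obtain y where y: "y \<in> head_chains j (Suc l) (Suc n)" "g = hoch y"
    using Suc.IH[of g] wrap_defect_lowers[OF Suc.prems(1,4)] Suc.prems(4) unfolding g_def by blast
  have "f = hoch (split_hd f - fscale s y)"
    using eq by (simp add: hoch_diff hoch_scale y(2))
  then show ?case using supp_diff[OF hf supp_scale[OF y(1)]] by blast
qed

text \<open>Merging the factors \<open>s\<close> into the head, one at a time, reduces everything to Laurent polynomials. A
  chain bounding the merged cycle lifts along \<open>unmerge\<close>, and correcting the cycle by the boundary of the
  lift moves it into the kernel of \<open>merge\<close>.\<close>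

theorem hochschild_boundary:
  fixes z :: "'k::field_char_0 chain"
  assumes "z \<in> head_chains j l n" "j > 0 \<or> l = 0" "hoch z = 0" "even (j + l) \<Longrightarrow> phi z = 0"
  shows "\<exists>y\<in>head_chains j l (Suc n). z = hoch y"
  using assms
proof (induction l arbitrary: j n z)
  case 0
  then show ?case using laurent_boundary[of z j n] by simp
next
  case (Suc l)
  then have j: "j > 0" by simp
  show ?case
  proof (cases n)
    case 0
    then have "z = 0" using Suc.prems(1) supp_empty by (simp add: words_Suc_0)
    then show ?thesis by (intro bexI[of _ 0]) (simp_all add: hoch_zero)
  next
    case (Suc m)
    have zm: "z \<in> head_chains j (Suc l) (Suc m)" using Suc.prems(1) Suc by simp
    have "hoch (merge z) = 0"
      using hoch_merge[OF Suc.prems(1) j] Suc.prems(3) by (simp add: merge_zero)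
    then obtain y' where y': "y' \<in> head_chains (Suc j) l (Suc m)" "merge z = hoch y'"
      using Suc.IH[OF merge_head_chains[OF zm]] phi_merge[OF zm] Suc.prems(4) by auto
    \<comment> \<open>A plus sign, since \<open>merge\<close> and the Hochschild boundary anticommute.\<close>
    let ?z = "z + hoch (unmerge y')"
    have u: "unmerge y' \<in> head_chains j (Suc l) (Suc n)" using unmerge_head_chains[OF y'(1)] Suc by simp
    have "merge (hoch (unmerge y')) = - hoch y'"
      using hoch_merge[OF u j] merge_unmerge[OF y'(1)] by simp
    then have "merge ?z = 0"
      using y'(2) by (simp add: merge_add)
    moreover have "hoch ?z = 0"
      using Suc.prems(3) by (simp add: hoch_add hoch_hoch)
    moreover have zC: "?z \<in> head_chains j (Suc l) n"
      by (intro supp_add Suc.prems(1) hoch_head_chains[OF _ u]) (simp add: j)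
    have "pure_after w < Suc n" if "w \<in> words j (Suc l) n" for w
    proof -
      have "pure_after w \<le> length (tl w)"
        unfolding pure_after_def by (rule order.trans[OF length_filter_le length_dropWhile_le])
      then show ?thesis using that by (auto simp: words_def)
    qed
    then have "?z \<in> supp {w \<in> words j (Suc l) n. pure_after w < Suc n}"
      using zC by (auto elim!: supp_mono)
    ultimately obtain y where "y \<in> head_chains j (Suc l) (Suc n)" "?z = hoch y"
      using ker_merge_boundary[of ?z j l n "Suc n"] j by blast
    then have "z = hoch (y - unmerge y')" "y - unmerge y' \<in> head_chains j (Suc l) (Suc n)"
      using supp_diff u by (auto simp: hoch_diff algebra_simps)
    then show ?thesis by blast
  qed
qed

lemma phi_hoch:
  assumes "f \<in> head_chains j l n" "j > 0 \<or> l = 0" "even (j + l)"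
  shows "phi (hoch f) = 0"
  using assms
proof (induction l arbitrary: j n f)
  case 0
  then show ?case using phi_hoch_laurent[of f j n] by simp
next
  case (Suc l)
  show ?case
  proof (cases n)
    case 0
    then have "f = 0" using Suc.prems(1) supp_empty by (simp add: words_Suc_0)
    then show ?thesis by (simp add: hoch_zero phi_zero)
  next
    case (Suc m)
    have fm: "f \<in> head_chains j (Suc l) (Suc m)" using Suc.prems(1) Suc by simp
    have j: "j > 0" using Suc.prems by simp
    have "phi (hoch f) = phi (merge (hoch f))"
      using phi_merge[OF hoch_head_chains[OF _ fm]] j by simp
    also have "\<dots> = - phi (hoch (merge f))"
      using hoch_merge[OF fm j] by (simp add: phi_uminus)
    also have "\<dots> = 0"
      using Suc.IH[OF merge_head_chains[OF fm]] Suc.prems by simp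
    finally show ?thesis .
  qed
qed

section \<open>The weight decomposition\<close>

definition wt :: "letter list \<Rightarrow> nat" where
  "wt w = sum_list (map fst w)"

definition weight_part :: "nat \<Rightarrow> 'k::field chain \<Rightarrow> 'k chain" where
  "weight_part m = lin_ext (\<lambda>w. if wt w = m then sg w else 0)"

definition head_part :: "'k::field chain \<Rightarrow> 'k chain" where
  "head_part = lin_ext (\<lambda>w. if w \<noteq> [] \<and> fst (hd w) > 0 then sg w else 0)"

lemma lin_weight_part: "lin (weight_part m)" and lin_head_part: "lin head_part"
  by (simp_all add: weight_part_def head_part_def lin_lin_ext)

lemmas [lin_intros] = lin_weight_part[THEN lin_comp] lin_head_part[THEN lin_comp]

lemma weight_part_sg: "weight_part m (sg w) = (if wt w = m then sg w else 0)"
  and head_part_sg: "head_part (sg w) = (if w \<noteq> [] \<and> fst (hd w) > 0 then sg w else 0)"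
  by (simp_all add: weight_part_def head_part_def)

definition weight_chains :: "nat \<Rightarrow> nat \<Rightarrow> 'k::field chain set" where
  "weight_chains m n = supp {w. length w = Suc n \<and> list_all (\<lambda>a. fst a \<le> 1) w \<and> wt w = m}"

lemma weight_chains_chains: "f \<in> weight_chains m n \<Longrightarrow> f \<in> chains n"
  by (auto simp: weight_chains_def chains_def elim: supp_mono)

lemma weight_part_weight_chains: "f \<in> chains n \<Longrightarrow> weight_part m f \<in> weight_chains m n"
  unfolding weight_chains_def chains_def by (erule supp_lin_ext) (auto simp: weight_part_sg lin_weight_part intro: supp_single)

lemma weight_part_id: "f \<in> weight_chains m n \<Longrightarrow> weight_part m f = f"
  unfolding weight_chains_def
  by (rule lin_eq_on_supp[where F = "weight_part m" and G = "\<lambda>f. f"]) (assumption | intro lin_intros lin_weight_part | simp add: weight_part_sg)+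

lemma weight_part_other: "f \<in> weight_chains m n \<Longrightarrow> m' \<noteq> m \<Longrightarrow> weight_part m' f = 0"
  unfolding weight_chains_def
  by (rule lin_0_on_supp[where F = "weight_part m'"]) (assumption | intro lin_weight_part | simp add: weight_part_sg)+

lemma wt_le: "list_all (\<lambda>a. fst a \<le> 1) w \<Longrightarrow> wt w \<le> length w"
  unfolding wt_def by (induction w) auto

lemma sum_weight_part: "f \<in> chains n \<Longrightarrow> (\<Sum>m\<le>Suc n. weight_part m f) = f"
  unfolding chains_def
proof (erule lin_eq_on_supp[where F = "\<lambda>f. \<Sum>m\<le>Suc n. weight_part m f" and G = "\<lambda>f. f"])
  fix w :: "letter list" assume "w \<in> {w. length w = Suc n \<and> list_all (\<lambda>a. fst a \<le> 1) w}"
  then have "wt w \<le> Suc n" using wt_le[of w] by simp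
  then show "(\<Sum>m\<le>Suc n. weight_part m (sg w)) = (sg w :: 'a chain)"
    by (simp add: weight_part_sg del: sum.atMost_Suc)
qed (intro lin_intros)+

lemma weight_part_commute_supp:
  assumes "f \<in> supp {w'. wt w' = k}"
  shows "weight_part m f = (if k = m then f else 0)"
  by (rule lin_eq_on_supp[OF assms, where F = "weight_part m" and G = "\<lambda>f. if k = m then f else 0"])
    (intro lin_intros lin_weight_part | simp add: weight_part_sg)+

lemma weight_part_commute:
  assumes F: "lin F" "\<And>w. F (sg w) \<in> supp {w'. wt w' = wt w}"
  shows "weight_part m (F f) = F (weight_part m f)"
proof (rule lin_eqI[where f = f and F = "\<lambda>f. weight_part m (F f)" and G = "\<lambda>f. F (weight_part m f)"])
  show "lin (\<lambda>f. weight_part m (F f))" "lin (\<lambda>f. F (weight_part m f))"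
    by (rule lin_comp[OF lin_weight_part F(1)], rule lin_comp[OF F(1) lin_weight_part])
  show "weight_part m (F (sg w)) = F (weight_part m (sg w))" for w
    by (simp add: weight_part_commute_supp[OF F(2)] weight_part_sg lin_0[OF F(1)])
qed

lemma weight_part_bar: "weight_part m (bar f) = bar (weight_part m f)"
  by (rule weight_part_commute[OF lin_ops(4)], rule supp_mono[OF bar_supp]) (auto simp: wt_def)

lemma weight_part_hoch: "weight_part m (hoch f) = hoch (weight_part m f)"
  by (rule weight_part_commute[OF lin_ops(6)], rule supp_mono[OF hoch_supp]) (auto simp: wt_def)

lemmas weight_part_add = lin_add[OF lin_weight_part]
  and weight_part_diff = lin_diff[OF lin_weight_part]
  and weight_part_scale = lin_scale[OF lin_weight_part]
  and weight_part_sum = lin_sum[OF lin_weight_part]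
  and weight_part_uminus = lin_uminus[OF lin_weight_part]
  and weight_part_zero = lin_0[OF lin_weight_part]

lemma weight_part_t: "f \<in> chains n \<Longrightarrow> weight_part m (op_t f) = op_t (weight_part m f)"
  unfolding chains_def
proof (erule lin_eq_on_supp[where F = "\<lambda>f. weight_part m (op_t f)" and G = "\<lambda>f. op_t (weight_part m f)"])
  fix w :: "letter list" assume "w \<in> {w. length w = Suc n \<and> list_all (\<lambda>a. fst a \<le> 1) w}"
  then show "weight_part m (op_t (sg w)) = op_t (weight_part m (sg w) :: 'a chain)"
    by (cases w rule: rev_cases)
      (auto simp: op_t_snoc weight_part_sg weight_part_scale op_t_zero wt_def)
qed (intro lin_intros lin_ops lin_weight_part)+

lemma weight_part_chains: "f \<in> chains n \<Longrightarrow> weight_part m f \<in> chains n"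
  by (rule weight_chains_chains, rule weight_part_weight_chains)

lemma weight_part_N: "f \<in> chains n \<Longrightarrow> weight_part m (op_N f) = op_N (weight_part m f)"
proof -
  assume f: "f \<in> chains n"
  have "weight_part m ((op_t ^^ i) f) = (op_t ^^ i) (weight_part m f)" for i
    by (induction i) (auto simp: weight_part_t[OF op_t_pow_chains[OF f]])
  then show ?thesis
    unfolding op_N_Len[OF chains_Len[OF f]] op_N_Len[OF chains_Len[OF weight_part_chains[OF f]]]
    by (simp add: weight_part_sum del: sum.lessThan_Suc)
qed

lemma weight_part_vertM: "weight_part m (vertM p f) = vertM p (weight_part m f)"
  by (simp add: vertM_def weight_part_hoch weight_part_bar weight_part_uminus)

lemma weight_part_horizontal: "f \<in> chains n \<Longrightarrow> weight_part m (horizontal p f) = horizontal p (weight_part m f)"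
  by (simp add: horizontal_def weight_part_N weight_part_t weight_part_diff)

lemma op_t_weight_chains: "f \<in> weight_chains m n \<Longrightarrow> op_t f \<in> weight_chains m n"
  using weight_part_weight_chains[OF op_t_chains[OF weight_chains_chains], of f m n m] weight_part_t[OF weight_chains_chains, of f m n m] weight_part_id[of f m n] by simp

lemma op_N_weight_chains: "f \<in> weight_chains m n \<Longrightarrow> op_N f \<in> weight_chains m n"
  using weight_part_weight_chains[OF op_N_chains[OF weight_chains_chains], of f m n m] weight_part_N[OF weight_chains_chains, of f m n m] weight_part_id[of f m n] by simp

lemma weight_chains_0: "weight_chains 0 n = head_chains 0 0 n"
proof -
  have "{w. length w = Suc n \<and> list_all (\<lambda>a. fst a \<le> 1) w \<and> wt w = 0} = words 0 0 n"
    by (auto simp: words_0 wt_def length_Suc_conv sum_list_eq_0_iff list_all_iff; fastforce)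
  then show ?thesis by (simp add: weight_chains_def)
qed

lemma head_chains_weight_chains: "f \<in> head_chains (Suc 0) l n \<Longrightarrow> f \<in> weight_chains (Suc l) n"
  unfolding weight_chains_def by (erule supp_mono) (auto simp: words_def wt_def)

lemma head_part_head_chains: "f \<in> weight_chains (Suc l) n \<Longrightarrow> head_part f \<in> head_chains (Suc 0) l n"
  unfolding weight_chains_def
  by (erule supp_lin_ext, rule lin_head_part) (auto simp: head_part_sg length_Suc_conv words_def wt_def le_Suc_eq intro!: supp_single)

lemma head_part_id: "f \<in> head_chains (Suc 0) l n \<Longrightarrow> head_part f = f"
  by (rule lin_eq_on_supp[where F = head_part and G = "\<lambda>f. f"])
    (assumption | intro lin_intros lin_head_part | auto simp: head_part_sg words_def)+

subsection \<open>From cyclic to Hochschild cycles\<close>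

text \<open>The first face on words \<open>[t\<^sup>x, s t\<^sup>y, \<dots>]\<close>; among the faces in \<open>b'\<close> it is the only one that produces
  words beginning with an \<open>s\<close> from other words.\<close>

definition cross :: "'k::field chain \<Rightarrow> 'k chain" where
  "cross = lin_ext (\<lambda>w. if length w \<ge> 2 \<and> fst (hd w) = 0 \<and> fst (hd (tl w)) > 0
     then lmul_list (hd w) (tl w) else 0)"

lemma lin_cross: "lin cross"
  by (simp add: cross_def lin_lin_ext)

lemmas [lin_intros] = lin_cross[THEN lin_comp]

lemma head_part_cons: "head_part (cons a f) = (if fst a > 0 then cons a f else 0)"
proof (rule lin_eqI[where f = f])
  show "head_part (cons a (sg w)) = (if fst a > 0 then cons a (sg w) else 0)" for w
    by (simp add: head_part_sg)
qed (intro lin_intros)+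

lemmas head_part_diff = lin_diff[OF lin_head_part]
  and head_part_scale = lin_scale[OF lin_head_part]
  and head_part_sum = lin_sum[OF lin_head_part]
  and head_part_uminus = lin_uminus[OF lin_head_part]
  and head_part_zero = lin_0[OF lin_head_part]

lemma head_part_bar: "head_part (bar f) = bar (head_part f) + cross f"
proof (rule lin_eqI[where f = f])
  fix w show "head_part (bar (sg w)) = bar (head_part (sg w)) + (cross (sg w) :: 'a chain)"
  proof (cases w rule: bar_list.cases)
    case (3 a c v)
    have 1: "head_part (lmul a (sg (c # v))) = (if fst a > 0 \<or> fst c > 0 then lmul a (sg (c # v)) else 0 :: 'a chain)"
      by (auto simp: lmul_sg_Cons head_part_scale head_part_sg)
    have "head_part (bar (sg w)) = head_part (lmul a (sg (c # v))) - (if fst a > 0 then cons a (bar (sg (c # v))) else 0 :: 'a chain)"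
      unfolding 3 bar_Cons[of a] by (simp only: head_part_diff head_part_cons)
    then show ?thesis
      unfolding 1 by (auto simp: 3 head_part_sg bar_Cons[of a] cross_def lmul_def bar_zero)
  qed (auto simp: bar_Nil bar_singleton head_part_sg cross_def head_part_zero bar_zero)
qed (intro lin_intros lin_ops lin_cross)+

lemmas cross_scale = lin_scale[OF lin_cross]

lemma wrap_head_part: 
  assumes f: "f \<in> supp (Len (Suc n))"
  shows "fscale ((- 1) ^ n) (wrap (head_part f)) = cross (op_t f)"
proof (rule lin_eq_on_supp[OF f, where F = "\<lambda>f. fscale ((- 1) ^ n) (wrap (head_part f))" and G = "\<lambda>f. cross (op_t f)"])
  fix w :: "letter list" assume w: "w \<in> Len (Suc n)"
  then obtain v d where v: "w = v @ [d]" "length v = n" by (cases w rule: rev_cases) auto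
  show "fscale ((- 1) ^ n) (wrap (head_part (sg w))) = (cross (op_t (sg w)) :: 'a chain)"
  proof (cases v)
    case Nil
    then show ?thesis
      by (auto simp: v head_part_sg wrap_singleton wrap_zero cross_def lin_0[OF lin_lin_ext] op_t_def)
  next
    case (Cons a u)
    then have "wrap (sg w) = (lmul d (sg v) :: 'a chain)" using v wrap_snoc_sg[of v d, where 'a = 'a] by simp
    moreover have "op_t (sg w) = (fscale ((- 1) ^ n) (sg (d # v)) :: 'a chain)"
      using v by (simp add: op_t_snoc)
    moreover have "cross (sg (d # v)) = (if fst d = 0 \<and> fst a > 0 then lmul d (sg v) else 0 :: 'a chain)"
      using Cons by (simp add: cross_def lmul_def)
    moreover have "head_part (sg w) = (if fst a > 0 then sg w else 0 :: 'a chain)"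
      using v Cons by (simp add: head_part_sg)
    moreover have "fst d > 0 \<Longrightarrow> fst a > 0 \<Longrightarrow> lmul d (sg v) = (0 :: 'a chain)"
      using Cons by (simp add: lmul_Cons coef_def)
    ultimately show ?thesis
      by (auto simp: cross_scale wrap_zero)
  qed
qed (intro lin_intros lin_ops lin_cross)+

text \<open>The missing cyclic face on words \<open>[s, \<dots>, t\<^sup>x]\<close> equals the first face on the rotated words
  \<open>[t\<^sup>x, s, \<dots>]\<close>, and a rotation invariant chain contains both with matching coefficients.\<close>

lemma hoch_head_part:
  assumes f: "f \<in> chains n" "op_t f = f"
  shows "hoch (head_part f) = head_part (bar f)"
proof -
  have "head_part f \<in> supp (Len (Suc n))"
    by (rule supp_lin_ext[OF chains_Len[OF f(1)] lin_head_part]) (auto simp: head_part_sg intro: supp_single)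
  then have "hoch (head_part f) = bar (head_part f) + fscale ((- 1) ^ n) (wrap (head_part f))"
    by (rule hoch_Len)
  then show ?thesis by (simp add: wrap_head_part[OF chains_Len[OF f(1)]] f(2) head_part_bar)
qed

lemma subspace_im_t: "free_vs.subspace {h. \<exists>g\<in>chains n. h = g - op_t g}"
  unfolding free_vs.subspace_def
proof (intro conjI ballI allI)
  show "0 \<in> {h. \<exists>g\<in>chains n. h = g - op_t g}"
    by (auto intro!: bexI[of _ 0] simp: op_t_zero)
next
  fix x y :: "'a chain"
  assume "x \<in> {h. \<exists>g\<in>chains n. h = g - op_t g}" "y \<in> {h. \<exists>g\<in>chains n. h = g - op_t g}"
  then obtain g h where "g \<in> chains n" "h \<in> chains n" "x = g - op_t g" "y = h - op_t h" by auto
  then show "x + y \<in> {h. \<exists>g\<in>chains n. h = g - op_t g}"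
    by (auto intro!: bexI[of _ "g + h"] chains_add simp: op_t_add)
next
  fix c and x :: "'a chain"
  assume "x \<in> {h. \<exists>g\<in>chains n. h = g - op_t g}"
  then obtain g where "g \<in> chains n" "x = g - op_t g" by auto
  then show "fscale c x \<in> {h. \<exists>g\<in>chains n. h = g - op_t g}"
    by (auto intro!: bexI[of _ "fscale c g"] chains_scale simp: op_t_scale free_vs.scale_right_diff_distrib)
qed

lemma op_N_shift: "f \<in> supp (Len n) \<Longrightarrow> op_N f = (\<Sum>i<n. (op_t ^^ Suc i) f)"
  using op_t_N[of f n] by (simp add: op_N_Len op_t_sum)

text \<open>Exactly \<open>m\<close> rotations of a word of weight \<open>m\<close> begin with an \<open>s\<close>, and all of them are congruent to the
  word modulo \<open>1 - t\<close>.\<close>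

lemma head_part_N_cong:
  assumes f: "f \<in> weight_chains m n"
  shows "\<exists>g\<in>chains n. fscale (of_nat m) f - head_part (op_N f) = g - op_t g"
proof -
  have "fscale (of_nat m) f - head_part (op_N f) \<in> {h. \<exists>g\<in>chains n. h = g - op_t g}"
  proof (rule lin_maps_supp[OF f[unfolded weight_chains_def], where F = "\<lambda>f. fscale (of_nat m) f - head_part (op_N f)"])
    fix w assume w: "w \<in> {w. length w = Suc n \<and> list_all (\<lambda>a. fst a \<le> 1) w \<and> wt w = m}"
    then have sw: "sg w \<in> (chains n :: 'a chain set)" and len: "length w = Suc n"
      unfolding chains_def by (auto intro: supp_single)
    let ?v = "\<lambda>i. fst (w ! (Suc n - Suc i))"
    have le1: "?v i \<le> 1" if "i < Suc n" for i
      using w that by (auto simp: list_all_length)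
    have "m = (\<Sum>i<Suc n. fst (w ! i))"
      using w by (auto simp: wt_def sum_list_sum_nth atLeast0LessThan)
    also have "\<dots> = (\<Sum>i<Suc n. ?v i)"
      by (rule sum.nat_diff_reindex[symmetric])
    finally have m: "fscale (of_nat m) (sg w) = (\<Sum>i<Suc n. fscale (of_nat (?v i)) (sg w :: 'a chain))"
      by (simp only: of_nat_sum free_vs.scale_sum_left)
    have pDt: "head_part ((op_t ^^ Suc i) (sg w)) = (fscale (of_nat (?v i)) ((op_t ^^ Suc i) (sg w)) :: 'a chain)" if "i < Suc n" for i
    proof -
      let ?u = "drop (length w - Suc i) w @ take (length w - Suc i) w"
      have u: "(op_t ^^ Suc i) (sg w :: 'a chain) = fscale ((- 1) ^ (Suc i * (length w - 1))) (sg ?u)"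
        by (rule op_t_pow_single) (use that len in simp)
      have "?u \<noteq> []" "hd ?u = w ! (Suc n - Suc i)"
        using that len by (auto simp: hd_append hd_drop_conv_nth)
      then show ?thesis
        unfolding u head_part_scale head_part_sg using le1[OF that]
        by (cases "?v i") auto
    qed
    have "head_part (op_N (sg w)) = (\<Sum>i<Suc n. head_part ((op_t ^^ Suc i) (sg w)) :: 'a chain)"
      unfolding op_N_shift[OF chains_Len[OF sw]] head_part_sum ..
    also have "\<dots> = (\<Sum>i<Suc n. fscale (of_nat (?v i)) ((op_t ^^ Suc i) (sg w)))"
      by (intro sum.cong refl pDt) simp
    finally have "fscale (of_nat m) (sg w) - head_part (op_N (sg w)) =
        (\<Sum>i<Suc n. fscale (of_nat (?v i)) (sg w - (op_t ^^ Suc i) (sg w)) :: 'a chain)"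
      unfolding m free_vs.scale_right_diff_distrib sum_subtractf by simp
    also have "\<dots> \<in> {h. \<exists>g\<in>chains n. h = g - op_t g}"
      by (intro free_vs.subspace_sum[OF subspace_im_t] free_vs.subspace_scale[OF subspace_im_t])
        (use minus_op_t_pow[OF subspace_chains op_t_chains sw] in blast)
    finally show "fscale (of_nat m) (sg w) - head_part (op_N (sg w)) \<in> {h. \<exists>g\<in>chains n. h = g - (op_t g :: 'a chain)}" .
  qed (intro lin_intros lin_ops subspace_im_t)+
  then show ?thesis by blast
qed

text \<open>The boundaries of Connes' complex, in which chains are taken modulo \<open>1 - t\<close>.\<close>

definition Blam :: "nat \<Rightarrow> 'k::field chain set" where
  "Blam n = {hoch g + (h - op_t h) | g h. g \<in> chains (Suc n) \<and> h \<in> chains n}"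

lemma Blam_hoch: "g \<in> chains (Suc n) \<Longrightarrow> hoch g \<in> Blam n"
  unfolding Blam_def by (rule CollectI, rule exI[of _ g], rule exI[of _ 0]) (simp add: op_t_zero)

lemma Blam_t: "h \<in> chains n \<Longrightarrow> h - op_t h \<in> Blam n"
  unfolding Blam_def by (rule CollectI, rule exI[of _ 0], rule exI[of _ h]) (simp add: hoch_zero)

lemma subspace_Blam: "free_vs.subspace (Blam n)"
  unfolding free_vs.subspace_def
proof (intro conjI ballI allI)
  show "0 \<in> Blam n" using Blam_hoch[of 0 n] by (simp add: hoch_zero)
next
  fix x y :: "'a chain" assume "x \<in> Blam n" "y \<in> Blam n"
  then obtain g h g' h' where "x = hoch g + (h - op_t h)" "y = hoch g' + (h' - op_t h')"
    "g \<in> chains (Suc n)" "g' \<in> chains (Suc n)" "h \<in> chains n" "h' \<in> chains n" unfolding Blam_def by blast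
  then show "x + y \<in> Blam n"
    unfolding Blam_def
    by (intro CollectI exI[of _ "g + g'"] exI[of _ "h + h'"])
      (simp add: chains_add hoch_add op_t_add)
next
  fix c and x :: "'a chain" assume "x \<in> Blam n"
  then obtain g h where "x = hoch g + (h - op_t h)" "g \<in> chains (Suc n)" "h \<in> chains n" unfolding Blam_def by blast
  then show "fscale c x \<in> Blam n"
    unfolding Blam_def
    by (intro CollectI exI[of _ "fscale c g"] exI[of _ "fscale c h"])
      (simp add: chains_scale hoch_scale op_t_scale free_vs.scale_right_diff_distrib
        free_vs.scale_right_distrib)
qed

lemmas Blam_add = free_vs.subspace_add[OF subspace_Blam]
  and Blam_diff = free_vs.subspace_diff[OF subspace_Blam]
  and Blam_scale = free_vs.subspace_scale[OF subspace_Blam]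
  and Blam_sum = free_vs.subspace_sum[OF subspace_Blam]

section \<open>Explicit cycles\<close>

lemma bar_nonpure: "list_all (\<lambda>a. fst a > 0) w \<Longrightarrow> bar (sg w) = 0"
proof (induction w)
  case (Cons a w)
  then show ?case
    by (cases w) (simp_all add: bar_Cons lmul_Cons lmul_Nil bar_Nil coef_def cons_zero)
qed (simp add: bar_Nil)

lemma wrap_nonpure: "list_all (\<lambda>a. fst a > 0) w \<Longrightarrow> wrap (sg w) = 0"
proof (cases w rule: rev_cases)
  case (snoc v d)
  assume "list_all (\<lambda>a. fst a > 0) w"
  then show ?thesis
    by (cases v) (simp_all add: snoc wrap_def wrap_list_def coef_def)
qed (simp add: wrap_def wrap_list_def)

lemma hoch_nonpure: "list_all (\<lambda>a. fst a > 0) w \<Longrightarrow> hoch (sg w) = 0"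
  by (simp add: hoch_single bar_nonpure wrap_nonpure)

definition Lw :: "int \<Rightarrow> int \<Rightarrow> nat \<Rightarrow> nat \<Rightarrow> letter list" where
  "Lw c y p q = replicate (Suc p) (Suc 0, c) @ (0, y) # replicate q (Suc 0, c)"

text \<open>What \<open>Lw\<close> becomes when \<open>t\<^sup>y\<close> is multiplied into one of its neighbours.\<close>

definition Mw :: "int \<Rightarrow> int \<Rightarrow> nat \<Rightarrow> nat \<Rightarrow> letter list" where
  "Mw c y p q = replicate p (Suc 0, c) @ (Suc 0, c + y) # replicate q (Suc 0, c)"

lemma Lw_words: "Lw c y p q \<in> words (Suc 0) (p + q) (Suc (p + q))"
  and Mw_words: "Mw c y p q \<in> words (Suc 0) (p + q) (p + q)"
proof -
  show "Lw c y p q \<in> words (Suc 0) (p + q) (Suc (p + q))"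
    by (auto simp: Lw_def words_Cons sum_list_replicate list_all_iff)
  show "Mw c y p q \<in> words (Suc 0) (p + q) (p + q)"
    by (cases p) (auto simp: Mw_def words_Cons sum_list_replicate list_all_iff)
qed

lemma hoch_Mw: "hoch (sg (Mw c y p q)) = 0" and bar_Mw: "bar (sg (Mw c y p q)) = 0"
proof -
  have "list_all (\<lambda>a. fst a > 0) (Mw c y p q)"
    by (auto simp: Mw_def list_all_iff)
  then show "hoch (sg (Mw c y p q)) = 0" "bar (sg (Mw c y p q)) = 0"
    by (simp_all add: hoch_nonpure bar_nonpure)
qed

lemma bar_Lw: "bar (sg (Lw c y p q)) = Poly_Mapping.single (Mw c y p q) ((- 1) ^ p) +
    (if q = 0 then 0 else Poly_Mapping.single (Mw c y (Suc p) (q - 1)) ((- 1) ^ Suc p * parity y))"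
proof (induction p)
  case 0
  show ?case
  proof (cases q)
    case 0
    then show ?thesis
      by (simp add: Lw_def Mw_def bar_Cons lmul_Cons lmul_Nil bar_Nil coef_def twist_def cons_zero)
  next
    case (Suc q')
    have "bar (sg ((Suc 0, c) # replicate q' (Suc 0, c))) = (0 :: 'a chain)"
      by (rule bar_nonpure) (simp add: list_all_iff)
    then show ?thesis
      unfolding Lw_def Mw_def Suc
      by (simp add: bar_Cons[of "(0, y)"] bar_Cons[of "(Suc 0, c)" "(0, y) # _"] bar_Cons[of "(Suc 0, c)" "(0, y) # _"] lmul_Cons coef_def twist_def
          cons_zero cons_diff add.commute single_uminus)
  qed
next
  case (Suc p)
  have "Lw c y (Suc p) q = (Suc 0, c) # Lw c y p q" "Mw c y (Suc p) q = (Suc 0, c) # Mw c y p q"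
    "Mw c y (Suc (Suc p)) q' = (Suc 0, c) # Mw c y (Suc p) q'" for q'
    by (simp_all add: Lw_def Mw_def)
  moreover have "lmul (Suc 0, c) (sg (Lw c y p q)) = (0 :: 'a chain)"
    by (simp add: Lw_def lmul_Cons coef_def)
  ultimately show ?case
    by (simp add: bar_Cons Suc.IH cons_add cons_zero single_uminus
        cons_uminus)
qed

lemma wrap_Lw: "wrap (sg (Lw c y p q)) = (if q = 0 then Poly_Mapping.single (Mw c y 0 p) (parity y) else 0)"
proof (cases q)
  case 0
  then show ?thesis
    using wrap_snoc[of "(Suc 0, c)" "replicate p (Suc 0, c)" "(0, y)", where 'a = 'a]
    by (simp add: Lw_def Mw_def coef_def twist_def add.commute)
next
  case (Suc q')
  have "Lw c y p q = ((Suc 0, c) # replicate p (Suc 0, c) @ (0, y) # replicate q' (Suc 0, c)) @ [(Suc 0, c)]"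
    by (simp add: Lw_def Suc replicate_append_same)
  then show ?thesis
    unfolding \<open>Lw c y p q = _\<close> wrap_snoc by (simp add: Suc coef_def)
qed

lemma hoch_Lw_0: "hoch (sg (Lw c y p 0)) = Poly_Mapping.single (Mw c y p 0) ((- 1) ^ p)
   + Poly_Mapping.single (Mw c y 0 p) ((- 1) ^ Suc p * parity y)"
  and hoch_Lw_Suc: "hoch (sg (Lw c y p (Suc q))) = Poly_Mapping.single (Mw c y p (Suc q)) ((- 1) ^ p)
   + Poly_Mapping.single (Mw c y (Suc p) q) ((- 1) ^ Suc p * parity y)"
  by (simp_all add: hoch_single bar_Lw wrap_Lw fscale_single) (simp add: Lw_def)

lemma op_t_Mw: "op_t (sg (Mw c y p 0)) = fscale ((- 1) ^ p) (sg (Mw c y 0 p))"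
  using op_t_snoc[of "replicate p (Suc 0, c)" "(Suc 0, c + y)"] by (simp add: Mw_def)

lemma op_t_Lw: "op_t (sg (Lw c y p (Suc q))) = fscale ((- 1) ^ (p + q)) (sg (Lw c y (Suc p) q))"
  using op_t_snoc[of "replicate (Suc p) (Suc 0, c) @ (0, y) # replicate q (Suc 0, c)" "(Suc 0, c)"]
  by (simp add: Lw_def replicate_append_same)

lemma phi_Mw_aux: "phi_list ((j, x) # replicate q (Suc 0, 0)) = fscale (parity (x * int q)) (sg x)"
proof (induction q arbitrary: j)
  case (Suc q)
  then show ?case by (simp add: twist_def distrib_left parity_add)
qed simp

lemma phi_Mw_aux2: "phi_list ((j, 0) # replicate p (Suc 0, 0) @ (Suc 0, r) # replicate q (Suc 0, 0)) =
    fscale (parity (r * int q)) (sg r)"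
  by (induction p arbitrary: j) (simp_all add: phi_Mw_aux)

lemma phi_Mw: "phi (sg (Mw 0 r p q)) = fscale (parity (r * int q)) (sg r)"
  by (cases p) (simp_all add: phi_sg Mw_def phi_Mw_aux phi_Mw_aux2)

lemma phi_Lw_aux: "\<exists>u. u \<noteq> 0 \<and> phi_list ((j, x) # replicate p (Suc 0, c) @ (0, y) # v) =
   (if v = [] then Poly_Mapping.single (x + int p * c + y) (u * of_int y) else (0 :: int \<Rightarrow>\<^sub>0 'k::field))"
proof (induction p arbitrary: j x)
  case 0
  then show ?case by (intro exI[of _ 1]) simp
next
  case (Suc p)
  obtain u :: 'k where u: "u \<noteq> 0" "phi_list ((Suc j, x + c) # replicate p (Suc 0, c) @ (0, y) # v) =
   (if v = [] then Poly_Mapping.single ((x + c) + int p * c + y) (u * of_int y) else 0)"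
    using Suc[of "Suc j" "x + c"] by blast
  have "(x + c) + int p * c + y = x + int (Suc p) * c + y" by (simp add: algebra_simps)
  with u show ?case
    by (intro exI[of _ "twist (j, x) (Suc 0, c) * u"]) (simp add: fscale_single twist_def algebra_simps)
qed

lemma phi_Lw: "\<exists>u. u \<noteq> 0 \<and> phi (sg (Lw c y p q)) =
   (if q = 0 then Poly_Mapping.single (int (Suc p) * c + y) (u * of_int y) else (0 :: int \<Rightarrow>\<^sub>0 'k::field))"
proof -
  obtain u :: 'k where "u \<noteq> 0" "phi_list ((Suc 0, c) # replicate p (Suc 0, c) @ (0, y) # replicate q (Suc 0, c)) =
      (if replicate q (Suc 0, c) = [] then Poly_Mapping.single (c + int p * c + y) (u * of_int y) else 0)"
    using phi_Lw_aux by blast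
  moreover have "c + int p * c + y = int (Suc p) * c + y" by (simp add: algebra_simps)
  ultimately show ?thesis
    by (intro exI[of _ u]) (simp add: Lw_def phi_sg del: of_nat_Suc)
qed

lemma head_chains_chains: "f \<in> head_chains (Suc 0) l n \<Longrightarrow> f \<in> chains n"
  by (rule weight_chains_chains, rule head_chains_weight_chains)

lemma Mw_head_chains: "sg (Mw c y p q) \<in> head_chains (Suc 0) (p + q) (p + q)"
  and Lw_head_chains: "sg (Lw c y p q) \<in> head_chains (Suc 0) (p + q) (Suc (p + q))"
  by (rule supp_single, rule Mw_words) (rule supp_single, rule Lw_words)

text \<open>The boundary of \<open>Lw 0 r K 0\<close> identifies \<open>M\<close> with the word in which the exceptional letter comes
  first, whereas rotation identifies \<open>M\<close> with minus that word. So \<open>2 M\<close> is zero.\<close>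

lemma Mw_in_Blam:
  assumes "odd K" "even r"
  shows "(sg (Mw 0 r K 0) :: 'k::field_char_0 chain) \<in> Blam K"
proof -
  let ?M = "sg (Mw 0 r K 0) :: 'k chain" and ?L = "sg (Lw 0 r K 0) :: 'k chain" and ?N = "sg (Mw 0 r 0 K) :: 'k chain"
  have "hoch ?L = ?N - ?M" "op_t ?M = - ?N"
    using assms by (simp_all add: hoch_Lw_0 op_t_Mw parity_def fscale_m1 single_uminus)
  then have "(?M - op_t ?M) - hoch ?L = ?M + ?M" by simp
  also have "\<dots> = fscale 2 ?M"
    using free_vs.scale_left_distrib[of 1 1 ?M] by simp
  finally have "?M = fscale (1 / 2) ((?M - op_t ?M) - hoch ?L)" by simp
  moreover have "?M \<in> chains K" "?L \<in> chains (Suc K)"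
    using Mw_head_chains[of 0 r K 0] Lw_head_chains[of 0 r K 0] by (auto intro: head_chains_chains)
  then have "fscale (1 / 2) ((?M - op_t ?M) - hoch ?L) \<in> Blam K"
    by (intro Blam_scale Blam_diff Blam_t Blam_hoch)
  ultimately show ?thesis by (simp only:)
qed

text \<open>The boundary of the \<open>p\<close>-th summand is \<open>M\<^sub>p - M\<^sub>p\<^sub>+\<^sub>1\<close>, with indices modulo \<open>K + 1\<close>, hence the sum is a
  cycle. All words in it are rotations of the first one, without signs, so that modulo \<open>1 - t\<close> it is an
  alternating sum of \<open>K + 1\<close> equal terms.\<close>

lemma even_cycle:
  fixes c y :: int
  assumes K: "odd K" and y: "even y"
  defines "e \<equiv> \<Sum>p\<le>K. fscale ((- 1) ^ p) (sg (Lw c y p (K - p)) :: 'k::field_char_0 chain)"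
  shows "hoch e = 0" "e \<in> Blam (Suc K)" "e \<in> head_chains (Suc 0) K (Suc K)"
    "\<exists>u. u \<noteq> 0 \<and> phi e = Poly_Mapping.single (int (Suc K) * c + y) (u * of_int y)"
proof -
  let ?M = "\<lambda>p. sg (Mw c y p (K - p)) :: 'k chain"
  let ?L = "\<lambda>p. sg (Lw c y p (K - p)) :: 'k chain"
  have bhL: "fscale ((- 1) ^ p) (hoch (?L p)) = ?M p - ?M (Suc p)" if p: "p < K" for p
  proof -
    obtain q where "K - p = Suc q" "K - Suc p = q" using p by (cases "K - p") auto
    then show ?thesis using y
      by (simp add: hoch_Lw_Suc parity_def fscale_single free_vs.scale_right_distrib single_uminus
          free_vs.scale_right_diff_distrib flip: power_mult_distrib)
  qed
  have bhLK: "fscale ((- 1) ^ K) (hoch (?L K)) = ?M K - ?M 0"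
    using y K by (simp add: hoch_Lw_0 parity_def fscale_single free_vs.scale_right_distrib single_uminus fscale_neg)
  have "hoch e = (\<Sum>p<K. fscale ((- 1) ^ p) (hoch (?L p))) + fscale ((- 1) ^ K) (hoch (?L K))"
    unfolding e_def lessThan_Suc_atMost[symmetric] sum.lessThan_Suc hoch_add
      hoch_sum hoch_scale ..
  also have "(\<Sum>p<K. fscale ((- 1) ^ p) (hoch (?L p))) = (\<Sum>p<K. ?M p - ?M (Suc p))"
    by (intro sum.cong refl bhL) simp
  also have "\<dots> = ?M 0 - ?M K"
    by (rule sum_lessThan_telescope')
  finally show "hoch e = 0" using bhLK by simp
  have LC: "?L p \<in> head_chains (Suc 0) K (Suc K)" if "p \<le> K" for p
    using Lw_head_chains[of c y p "K - p"] that by simp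
  then show "e \<in> head_chains (Suc 0) K (Suc K)"
    unfolding e_def by (intro supp_sum supp_scale) simp
  have pow: "(op_t ^^ p) (?L 0) = ?L p" if "p \<le> K" for p
    using that
  proof (induction p)
    case (Suc p)
    then obtain q where q: "K - p = Suc q" "K - Suc p = q" by (cases "K - p") auto
    then have "even (p + q)" using K Suc.prems by presburger
    then show ?case using Suc q op_t_Lw[of c y p q, where 'a = 'k] by simp
  qed simp
  have "(\<Sum>p\<le>i. (- 1) ^ p) = (if even i then 1 else 0 :: 'k)" for i :: nat
    by (induction i) simp_all
  then have alt: "(\<Sum>p\<le>K. (- 1) ^ p) = (0 :: 'k)"
    using K by simp
  have L0: "?L 0 \<in> chains (Suc K)" using LC[of 0] by (auto intro: head_chains_chains)
  have "e = (\<Sum>p\<le>K. fscale ((- 1) ^ p) (?L p)) - fscale (\<Sum>p\<le>K. (- 1) ^ p) (?L 0)"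
    unfolding alt by (simp add: e_def)
  also have "\<dots> = (\<Sum>p\<le>K. fscale (- ((- 1) ^ p)) (?L 0 - (op_t ^^ p) (?L 0)))"
    unfolding free_vs.scale_sum_left sum_subtractf[symmetric]
    by (intro sum.cong refl) (use pow in \<open>simp add: fscale_neg free_vs.scale_right_diff_distrib\<close>)
  also have "\<dots> \<in> {h. \<exists>g\<in>chains (Suc K). h = g - op_t g}"
    by (intro free_vs.subspace_sum[OF subspace_im_t] free_vs.subspace_scale[OF subspace_im_t])
      (use minus_op_t_pow[OF subspace_chains op_t_chains L0] in blast)
  finally show "e \<in> Blam (Suc K)" using Blam_t by auto
  have "phi (?L p) = 0" if "p < K" for p
    using phi_Lw[of c y p "K - p", where 'k = 'k] that by auto
  then have "phi e = fscale ((- 1) ^ K) (phi (?L K))"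
    by (simp add: e_def phi_sum phi_add phi_scale flip: lessThan_Suc_atMost)
  moreover obtain u :: 'k where "u \<noteq> 0" "phi (?L K) = Poly_Mapping.single (int (Suc K) * c + y) (u * of_int y)"
    using phi_Lw[of c y K 0, where 'k = 'k] by auto
  ultimately show "\<exists>u. u \<noteq> 0 \<and> phi e = Poly_Mapping.single (int (Suc K) * c + y) (u * of_int y)"
    by (intro exI[of _ "(- 1) ^ K * u"]) (simp add: fscale_single mult.assoc)
qed

text \<open>Each Hochschild class with even \<open>r\<close> has a representative that is zero in cyclic homology.\<close>

lemma even_representative:
  assumes "odd l" "even r" "n = l \<or> n = Suc l"
  shows "\<exists>E \<in> head_chains (Suc 0) l n. hoch E = 0 \<and> phi E = (sg r :: int \<Rightarrow>\<^sub>0 'k::field_char_0) \<and> E \<in> Blam n"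
proof (cases "n = l")
  case True
  then show ?thesis
    using Mw_in_Blam[OF assms(1,2), where 'k = 'k] Mw_head_chains[of 0 r l 0, where 'a = 'k] hoch_Mw[of 0 r l 0, where 'a = 'k]
      phi_Mw[of r l 0, where 'a = 'k] by (intro bexI[of _ "sg (Mw 0 r l 0)"]) simp_all
next
  case False
  then have n: "n = Suc l" using assms(3) by simp
  \<comment> \<open>The factor \<open>y\<close> appears in \<open>phi\<close> and must not be 0. For \<open>r = 0\<close> this forces the other letters to contain \<open>t\<close>.\<close>
  define c y where "c = (if r = 0 then 1 else 0 :: int)" and "y = r - int (Suc l) * c"
  have "even y" "y \<noteq> 0" using assms(1,2) by (auto simp: c_def y_def)
  define e where "e = (\<Sum>p\<le>l. fscale ((- 1) ^ p) (sg (Lw c y p (l - p)) :: 'k chain))"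
  have e: "hoch e = 0" "e \<in> Blam (Suc l)" "e \<in> head_chains (Suc 0) l (Suc l)"
    "\<exists>u. u \<noteq> 0 \<and> phi e = Poly_Mapping.single (int (Suc l) * c + y) (u * of_int y)"
    using even_cycle[OF assms(1) \<open>even y\<close>, of c, where 'k = 'k] unfolding e_def by blast+
  have "int (Suc l) * c + y = r" by (simp add: y_def)
  with e(4) obtain u :: 'k where u: "u \<noteq> 0" "phi e = Poly_Mapping.single r (u * of_int y)" by auto
  let ?E = "fscale (1 / (u * of_int y)) e"
  have "phi ?E = sg r" using u \<open>y \<noteq> 0\<close> by (simp add: phi_scale fscale_single)
  then show ?thesis
    using e n by (intro bexI[of _ ?E]) (auto simp: hoch_scale Blam_scale supp_scale)
qed

text \<open>After all merging only words of length one and two contribute to \<open>phi\<close>.\<close>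

lemma phi_list_0: "w \<in> words j l n \<Longrightarrow> j > 0 \<Longrightarrow> n \<noteq> l \<Longrightarrow> n \<noteq> Suc l \<Longrightarrow> phi_list w = 0"
proof (induction l arbitrary: w j n)
  case 0
  then obtain k where "n = Suc (Suc k)" by (metis One_nat_def not0_implies_Suc)
  then show ?case using phi_long[of w j k] 0 by simp
next
  case (Suc l)
  obtain x i y v where w: "w = (j, x) # (i, y) # v" "i \<le> 1" "list_all (\<lambda>a. fst a \<le> 1) v"
    "i + sum_list (map fst v) = Suc l" "n = Suc (length v)"
    using Suc.prems(1) by (rule words_Suc_cases)
  show ?case
  proof (cases "i = 0")
    case True
    then show ?thesis using w by auto
  next
    case False
    then have i: "i = Suc 0" using w(2) by simp
    then have "(j + 1, x + y) # v \<in> words (j + 1) l (length v)" using w by (simp add: words_Cons)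
    then have "phi_list ((j + 1, x + y) # v) = (0 :: int \<Rightarrow>\<^sub>0 'a)"
      by (rule Suc.IH) (use Suc.prems w in auto)
    then show ?thesis using i w by simp
  qed
qed

lemma phi_0: "f \<in> head_chains (Suc 0) l n \<Longrightarrow> n \<noteq> l \<Longrightarrow> n \<noteq> Suc l \<Longrightarrow> phi f = 0"
  by (erule lin_0_on_supp) (auto intro: lin_phi simp: phi_sg phi_list_0)

text \<open>Pass to the Hochschild cycle \<open>\<zeta>\<close>, the part of \<open>N z\<close> in words that begin with an \<open>s\<close>. Subtracting
  representatives of its even classes that vanish in cyclic homology makes \<open>\<zeta>\<close> a Hochschild boundary.
  Finally \<open>z\<close> is recovered from \<open>\<zeta>\<close> by dividing by the weight.\<close>

lemma positive_weight_boundary: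
  fixes z :: "'k::field_char_0 chain"
  assumes z: "z \<in> weight_chains (Suc l) n" and cyc: "op_N (hoch z) = 0"
    and phi: "\<And>r. odd l \<Longrightarrow> odd r \<Longrightarrow> Poly_Mapping.lookup (phi (head_part (op_N z))) r = 0"
  shows "z \<in> Blam n"
proof -
  define \<zeta> where "\<zeta> = head_part (op_N z)"
  have zC: "z \<in> chains n" by (rule weight_chains_chains[OF z])
  have \<zeta>: "\<zeta> \<in> head_chains (Suc 0) l n"
    unfolding \<zeta>_def by (intro head_part_head_chains op_N_weight_chains z)
  have "hoch \<zeta> = head_part (bar (op_N z))"
    unfolding \<zeta>_def by (rule hoch_head_part[OF op_N_chains[OF zC] op_t_N[OF chains_Len[OF zC]]])
  then have hoch\<zeta>: "hoch \<zeta> = 0"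
    by (simp add: bar_N[OF chains_Len[OF zC]] cyc head_part_zero)
  have "\<exists>e \<in> head_chains (Suc 0) l n. hoch e = 0 \<and> e \<in> Blam n \<and> (odd l \<longrightarrow> phi e = phi \<zeta>)"
  proof (cases "odd l \<and> (n = l \<or> n = Suc l)")
    case False
    then show ?thesis using phi_0[OF \<zeta>]
      by (intro bexI[of _ 0]) (auto simp: hoch_zero phi_zero free_vs.subspace_0[OF subspace_Blam])
  next
    case True
    let ?P = "\<lambda>r E. E \<in> head_chains (Suc 0) l n \<and> hoch E = 0 \<and> phi E = (sg r :: int \<Rightarrow>\<^sub>0 'k) \<and> E \<in> Blam n"
    have ex: "\<exists>E. ?P r E" if "r \<in> Poly_Mapping.keys (phi \<zeta>)" for r
    proof -
      have "even r" using phi[of r] that True by (auto simp: \<zeta>_def in_keys_iff)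
      then show ?thesis using even_representative[of l r n, where 'k = 'k] True by blast
    qed
    define E where "E r = (SOME E. ?P r E)" for r
    have E: "?P r (E r)" if "r \<in> Poly_Mapping.keys (phi \<zeta>)" for r
      unfolding E_def using ex[OF that] by (rule someI_ex)
    let ?e = "\<Sum>r\<in>Poly_Mapping.keys (phi \<zeta>). fscale (Poly_Mapping.lookup (phi \<zeta>) r) (E r)"
    have "phi ?e = (\<Sum>r\<in>Poly_Mapping.keys (phi \<zeta>). Poly_Mapping.single r (Poly_Mapping.lookup (phi \<zeta>) r))"
      unfolding phi_sum phi_scale by (intro sum.cong refl) (simp add: E fscale_single)
    then have "phi ?e = phi \<zeta>" using poly_mapping_expand[of "phi \<zeta>"] by (rule trans[OF _ sym])
    moreover have "hoch ?e = 0"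
      unfolding hoch_sum hoch_scale by (intro sum.neutral) (simp add: E)
    moreover have "?e \<in> head_chains (Suc 0) l n" by (intro supp_sum supp_scale) (simp add: E)
    moreover have "?e \<in> Blam n" by (intro Blam_sum Blam_scale) (simp add: E)
    ultimately show ?thesis by blast
  qed
  then obtain e where e: "e \<in> head_chains (Suc 0) l n" "hoch e = 0" "e \<in> Blam n" "odd l \<Longrightarrow> phi e = phi \<zeta>" by blast
  have "\<exists>y\<in>head_chains (Suc 0) l (Suc n). \<zeta> - e = hoch y"
  proof (rule hochschild_boundary)
    show "phi (\<zeta> - e) = 0" if "even (Suc 0 + l)"
      using e(4) that by (simp add: phi_diff)
  qed (simp_all add: supp_diff[OF \<zeta> e(1)] hoch_diff hoch\<zeta> e(2))
  then obtain y where y: "y \<in> head_chains (Suc 0) l (Suc n)" "\<zeta> = hoch y + e"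
    by (auto simp: algebra_simps)
  have "\<zeta> \<in> Blam n"
    unfolding y(2) by (intro Blam_add Blam_hoch e(3) head_chains_chains[OF y(1)])
  moreover obtain g where g: "g \<in> chains n" "fscale (of_nat (Suc l)) z - \<zeta> = g - op_t g"
    using head_part_N_cong[OF z] unfolding \<zeta>_def by blast
  then have "fscale (of_nat (Suc l)) z = \<zeta> + (g - op_t g)"
    by (metis add_diff_cancel_left' diff_add_cancel add.commute)
  moreover note g(1)
  ultimately have "fscale (inverse (of_nat (Suc l))) (fscale (of_nat (Suc l)) z) \<in> Blam n"
    by (rule_tac Blam_scale[of "fscale (of_nat (Suc l)) z"]) (simp add: Blam_add Blam_t del: of_nat_Suc)
  moreover have "fscale (inverse (of_nat (Suc l))) (fscale (of_nat (Suc l)) z) = z"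
    by (simp del: of_nat_Suc)
  ultimately show ?thesis by (simp only:)
qed

section \<open>The weight zero part\<close>

lemma cycM_chains: "x \<in> cycM n \<Longrightarrow> p \<le> n \<Longrightarrow> x p \<in> chains (n - p)"
  by (simp add: cycM_def TotM_def)

lemma boundsI: 
  assumes "x \<in> TotM n" "y \<in> TotM (Suc n)"
    "\<And>p. p \<le> n \<Longrightarrow> x p = vertM p (y p) + horizontal (Suc p) (y (Suc p))"
  shows "x \<in> bounds n"
proof -
  have "dM (Suc n) y = x"
    using assms by (auto simp: dM_def fun_eq_iff TotM_def)
  then show ?thesis using assms(2) unfolding bounds_def by blast
qed

lemma boundsE:
  assumes "x \<in> bounds n"
  obtains y where "y \<in> TotM (Suc n)" "\<And>p. p \<le> n \<Longrightarrow> x p = vertM p (y p) + horizontal (Suc p) (y (Suc p))"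
proof -
  obtain y where y: "y \<in> TotM (Suc n)" "x = dM (Suc n) y" using assms unfolding bounds_def by blast
  then show ?thesis by (intro that[of y]) (simp_all add: dM_def)
qed

lemma vertM_parity: "vertM (Suc (Suc p)) = vertM p" and horizontal_parity: "horizontal (Suc (Suc p)) = horizontal p"
  by (simp_all add: vertM_def[abs_def] horizontal_def[abs_def])

lemma hoch_op_t_chains: "f \<in> chains (Suc n) \<Longrightarrow> hoch (f - op_t f) = bar f - op_t (bar f)"
  by (rule hoch_op_t) (auto simp: chains_def elim: supp_mono)

lemma head_chains_0_chains: "f \<in> head_chains 0 0 n \<Longrightarrow> f \<in> chains n"
  using weight_chains_chains[of f 0 n] by (simp add: weight_chains_0)

lemma op_t_head_chains_0: "f \<in> head_chains 0 0 n \<Longrightarrow> op_t f \<in> head_chains 0 0 n"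
  and op_N_head_chains_0: "f \<in> head_chains 0 0 n \<Longrightarrow> op_N f \<in> head_chains 0 0 n"
  using op_t_weight_chains[of f 0 n] op_N_weight_chains[of f 0 n] by (simp_all add: weight_chains_0)

lemma cons_head_chains_0: "f \<in> head_chains 0 0 n \<Longrightarrow> cons (0, 0) f \<in> head_chains 0 0 (Suc n)"
  by (erule supp_lin_ext, rule lin_ops) (auto simp: words_0 intro!: supp_single)

lemma bar_cons_unit_chains: "f \<in> chains n \<Longrightarrow> bar (cons (0, 0) f) = f - cons (0, 0) (bar f)"
  by (rule bar_cons_unit) (auto simp: chains_def elim!: supp_mono)

lemma weight_0_boundary_high:
  fixes v :: "'k::field_char_0 chain"
  assumes "v \<in> head_chains 0 0 (Suc (Suc n))" "hoch v = 0"
  shows "\<exists>y\<in>head_chains 0 0 (Suc (Suc (Suc n))). v = hoch y"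
  using hochschild_boundary[of v 0 0 "Suc (Suc n)"] assms phi_long_0[OF assms(1)] by simp

text \<open>A bounding chain of the shifted cycle lives in the columns from 2 on. Column 1 is filled in because
  \<open>b'\<close> is contractible, column 0 because the Hochschild homology of \<open>T\<close> vanishes in the degree in
  question.\<close>

lemma periodicity_inj:
  fixes x :: "nat \<Rightarrow> 'k::field_char_0 chain"
  assumes x: "x \<in> cycM (Suc (Suc n))" and w: "\<And>p. p \<le> Suc (Suc n) \<Longrightarrow> x p \<in> head_chains 0 0 (Suc (Suc n) - p)"
    and shift: "(\<lambda>p. x (Suc (Suc p))) \<in> bounds n"
  shows "x \<in> bounds (Suc (Suc n))"
proof -
  obtain y' where y': "y' \<in> TotM (Suc n)"
    "\<And>p. p \<le> n \<Longrightarrow> x (Suc (Suc p)) = vertM p (y' p) + horizontal (Suc p) (y' (Suc p))"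
    using boundsE[OF shift] by blast
  have y'C: "y' p \<in> chains (Suc n - p)" if "p \<le> Suc n" for p
    using y'(1) that by (simp add: TotM_def)
  \<comment> \<open>The given bounding chain may have components of other weights, to which the vanishing for \<open>T\<close> does not apply.\<close>
  define y where "y p = weight_part 0 (y' p)" for p
  have yCh: "y p \<in> head_chains 0 0 (Suc n - p)" if "p \<le> Suc n" for p
    using weight_part_weight_chains[OF y'C[OF that], of 0] by (simp add: y_def weight_chains_0)
  have yeq: "x (Suc (Suc p)) = vertM p (y p) + horizontal (Suc p) (y (Suc p))" if "p \<le> n" for p
  proof -
    have "x (Suc (Suc p)) = weight_part 0 (x (Suc (Suc p)))"
      using w[of "Suc (Suc p)"] that weight_part_id[of "x (Suc (Suc p))" 0 "n - p"] by (simp add: weight_chains_0)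
    also have "\<dots> = vertM p (y p) + horizontal (Suc p) (y (Suc p))"
      using y'C[of "Suc p"] that
      by (simp add: y'(2) weight_part_add weight_part_vertM weight_part_horizontal[of _ "n - p"] y_def)
    finally show ?thesis .
  qed
  have x1: "x 1 \<in> head_chains 0 0 (Suc n)" and x0: "x 0 \<in> head_chains 0 0 (Suc (Suc n))"
    using w[of 1] w[of 0] by simp_all
  have y0: "y 0 \<in> head_chains 0 0 (Suc n)" using yCh[of 0] by simp
  define u where "u = x 1 - op_N (y 0)"
  have u: "u \<in> head_chains 0 0 (Suc n)" unfolding u_def by (intro supp_diff x1 op_N_head_chains_0 y0)
  have "bar (x 1) = op_N (x 2)"
    using cycM_eq[OF x, of 1] by (simp add: vertM_def horizontal_def numeral_2_eq_2)
  also have "x 2 = hoch (y 0) + (y 1 - op_t (y 1))"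
    using yeq[of 0] by (simp add: vertM_def horizontal_def numeral_2_eq_2)
  also have "op_N \<dots> = op_N (hoch (y 0))"
    using yCh[of 1] op_N_minus_t[of "y 1" n] by (simp add: op_N_add head_chains_Len)
  also have "\<dots> = bar (op_N (y 0))"
    using bar_N[OF head_chains_Len[OF y0]] by simp
  finally have "bar u = 0" by (simp add: u_def bar_diff)
  then have cu: "bar (cons (0, 0) u) = u"
    using bar_cons_unit_chains[OF head_chains_0_chains[OF u]] by (simp add: cons_zero)
  \<comment> \<open>The sign compensates the one of \<open>b'\<close> in the odd columns.\<close>
  define y1 where "y1 = - cons (0, 0) u"
  have y1: "y1 \<in> head_chains 0 0 (Suc (Suc n))" "bar y1 = - u"
    unfolding y1_def using cons_head_chains_0[OF u] by (auto simp: supp_neg bar_uminus cu)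
  define v where "v = x 0 - (y1 - op_t y1)"
  have v: "v \<in> head_chains 0 0 (Suc (Suc n))"
    unfolding v_def by (intro supp_diff x0 y1(1) op_t_head_chains_0)
  have "hoch (x 0) = - (x 1 - op_t (x 1))"
    using cycM_eq[OF x, of 0] by (simp add: vertM_def horizontal_def)
  moreover have "op_t (op_N (y 0)) = op_N (y 0)"
    by (rule op_t_N[OF head_chains_Len[OF y0]])
  ultimately have "hoch v = 0"
    unfolding v_def hoch_diff[of "x 0"] hoch_op_t_chains[OF head_chains_0_chains[OF y1(1)]] y1(2)
    by (simp add: u_def op_t_uminus op_t_diff)
  then obtain y0' where y0': "y0' \<in> head_chains 0 0 (Suc (Suc (Suc n)))" "v = hoch y0'"
    using weight_0_boundary_high[OF v] by blast
  define Y where "Y p = (case p of 0 \<Rightarrow> y0' | Suc 0 \<Rightarrow> y1 | Suc (Suc q) \<Rightarrow> if q \<le> Suc n then y q else 0)" for p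
  show ?thesis
  proof (rule boundsI[where y = Y])
    show "x \<in> TotM (Suc (Suc n))" using x by (simp add: cycM_def)
    show "Y \<in> TotM (Suc (Suc (Suc n)))"
      using y0'(1) y1(1) yCh by (auto simp: TotM_def Y_def head_chains_0_chains split: nat.splits)
    show "x p = vertM p (Y p) + horizontal (Suc p) (Y (Suc p))" if "p \<le> Suc (Suc n)" for p
    proof -
      consider "p = 0" | "p = 1" | q where "p = Suc (Suc q)"
        by (metis One_nat_def not0_implies_Suc)
      then show ?thesis
      proof cases
        case 1
        then show ?thesis using y0'(2) by (simp add: Y_def vertM_def horizontal_def v_def algebra_simps)
      next
        case 2
        then show ?thesis by (simp add: Y_def vertM_def horizontal_def y1(2) u_def)
      next
        case 3
        then show ?thesis using that yeq[of q] by (simp add: Y_def vertM_parity horizontal_parity)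
      qed
    qed
  qed
qed

text \<open>The same two steps extend a cycle to the left by two columns.\<close>

lemma periodicity_surj:
  fixes x :: "nat \<Rightarrow> 'k::field_char_0 chain"
  assumes x: "x \<in> cycM (Suc n)" and w: "\<And>p. p \<le> Suc n \<Longrightarrow> x p \<in> head_chains 0 0 (Suc n - p)"
  shows "\<exists>z\<in>cycM (Suc (Suc (Suc n))). (\<forall>p\<le>Suc (Suc (Suc n)). z p \<in> head_chains 0 0 (Suc (Suc (Suc n)) - p)) \<and>
    (\<forall>p. z (Suc (Suc p)) = x p)"
proof -
  have x0: "x 0 \<in> head_chains 0 0 (Suc n)" and x1: "x 1 \<in> head_chains 0 0 n" using w[of 0] w[of 1] by simp_all
  have "hoch (x 0) = - (x 1 - op_t (x 1))"
    using cycM_eq[OF x, of 0] by (simp add: vertM_def horizontal_def)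
  then have "bar (op_N (x 0)) = 0"
    using op_N_minus_t[OF head_chains_Len[OF x1]]
    by (simp add: bar_N[OF head_chains_Len[OF x0]] op_N_uminus op_N_diff)
  define z1 where "z1 = cons (0, 0) (op_N (x 0))"
  have z1: "z1 \<in> head_chains 0 0 (Suc (Suc n))" unfolding z1_def by (intro cons_head_chains_0 op_N_head_chains_0 x0)
  have bpz1: "bar z1 = op_N (x 0)"
    using bar_cons_unit_chains[OF head_chains_0_chains[OF op_N_head_chains_0[OF x0]]] \<open>bar (op_N (x 0)) = 0\<close>
    by (simp add: z1_def cons_zero)
  define v where "v = z1 - op_t z1"
  have v: "v \<in> head_chains 0 0 (Suc (Suc n))" unfolding v_def by (intro supp_diff z1 op_t_head_chains_0)
  have "hoch v = 0"
    unfolding v_def hoch_op_t_chains[OF head_chains_0_chains[OF z1]] bpz1 using op_t_N[OF head_chains_Len[OF x0]] by simp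
  then obtain y where y: "y \<in> head_chains 0 0 (Suc (Suc (Suc n)))" "v = hoch y"
    using weight_0_boundary_high[OF v] by blast
  define z where "z p = (case p of 0 \<Rightarrow> - y | Suc 0 \<Rightarrow> z1 | Suc (Suc q) \<Rightarrow> x q)" for p
  have zw: "z p \<in> head_chains 0 0 (Suc (Suc (Suc n)) - p)" if "p \<le> Suc (Suc (Suc n))" for p
    using that y(1) z1 w by (auto simp: z_def supp_neg split: nat.splits)
  have "z \<in> TotM (Suc (Suc (Suc n)))"
    using zw x by (auto simp: TotM_def head_chains_0_chains cycM_def z_def split: nat.splits)
  moreover have "dM (Suc (Suc (Suc n))) z p = 0" for p
  proof -
    consider "p = 0" | "p = 1" | q where "p = Suc (Suc q)"
      by (metis One_nat_def not0_implies_Suc)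
    then show ?thesis
    proof cases
      case 1
      then show ?thesis using y(2) by (simp add: dM_def z_def vertM_def horizontal_def v_def hoch_uminus)
    next
      case 2
      then show ?thesis by (simp add: dM_def z_def vertM_def horizontal_def bpz1)
    next
      case 3
      then show ?thesis using cycM_eq[OF x, of q]
        by (simp add: dM_def z_def vertM_parity horizontal_parity)
    qed
  qed
  ultimately show ?thesis using zw by (intro bexI[of _ z]) (auto simp: cycM_def z_def)
qed

text \<open>Shifting by two columns as often as possible leaves total degree 0 or 1. Of the class of \<open>T\<close> found
  there in column 0, only the coefficient of \<open>t\<^sup>0\<close> survives.\<close>

definition psi :: "nat \<Rightarrow> (nat \<Rightarrow> 'k::field chain) \<Rightarrow> 'k" where
  "psi n x = Poly_Mapping.lookup (phi (x (if even n then n else n - 1))) 0"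

lemma psi_shift: "psi (Suc (Suc n)) x = psi n (\<lambda>p. x (Suc (Suc p)))"
  by (cases n) (auto simp: psi_def)

text \<open>The derivation \<open>t d/dt\<close>.\<close>

definition euler :: "(int \<Rightarrow>\<^sub>0 'k::field) \<Rightarrow> (int \<Rightarrow>\<^sub>0 'k)" where
  "euler = lin_ext (\<lambda>r. Poly_Mapping.single r (of_int r))"

lemma lin_euler: "lin euler"
  by (simp add: euler_def lin_lin_ext)

lemmas [lin_intros] = lin_euler[THEN lin_comp]

lemma lookup_euler: "Poly_Mapping.lookup (euler f) r = of_int r * Poly_Mapping.lookup f r"
proof -
  have "Poly_Mapping.lookup (euler f) r =
      (\<Sum>x\<in>Poly_Mapping.keys f. Poly_Mapping.lookup f x * Poly_Mapping.lookup (Poly_Mapping.single x (of_int x)) r)"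
    by (simp add: euler_def lin_ext_def lookup_sum)
  also have "\<dots> = (\<Sum>x\<in>Poly_Mapping.keys f. if x = r then of_int r * Poly_Mapping.lookup f r else 0)"
    by (intro sum.cong refl) (auto simp: lookup_single when_def)
  finally show ?thesis by (auto simp: in_keys_iff)
qed

text \<open>If \<open>b' f\<close> is the Laurent polynomial \<open>g\<close>, then \<open>f - t f\<close> represents Connes' operator applied to \<open>g\<close>,
  that is \<open>dg\<close>.\<close>

lemma phi_minus_t:
  assumes "f \<in> head_chains 0 0 1"
  shows "phi (f - op_t f) = euler (phi (bar f))"
proof (rule lin_eq_on_supp[OF assms, where F = "\<lambda>f. phi (f - op_t f)" and G = "\<lambda>f. euler (phi (bar f))"])
  fix w assume "w \<in> words 0 0 1"
  then obtain x y where w: "w = [(0, x), (0, y)]" by (auto simp: words_0 length_Suc_conv)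
  have "op_t (sg w) = (- sg [(0, y), (0, x)] :: 'a chain)"
    using op_t_snoc[of "[(0, x)]" "(0, y)", where 'b = 'a] by (simp add: w fscale_m1)
  then show "phi (sg w - op_t (sg w)) = (euler (phi (bar (sg w))) :: int \<Rightarrow>\<^sub>0 'a)"
    by (simp add: w phi_add phi_sg bar_Cons lmul_Cons lmul_Nil bar_Nil cons_zero
      euler_def add.commute coef_pure flip: single_add)
qed (intro lin_intros lin_phi lin_ops)+

text \<open>The word \<open>[t\<^sup>r, 1]\<close> is degenerate, hence a boundary, and its rotation is \<open>- [1, t\<^sup>r]\<close>.\<close>

lemma unit_pair_Blam: "(sg [(0, 0), (0, r)] :: 'k::field chain) \<in> Blam 1"
proof -
  let ?a = "sg [(0, r), (0, 0)] :: 'k chain" and ?c = "sg [(0, r), (0, 0), (0, 0)] :: 'k chain"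
  have "wrap ?c = ?a"
    using wrap_snoc[of "(0, r)" "[(0, 0)]" "(0, 0)", where 'a = 'k] by simp
  then have "hoch ?c = ?a"
    by (simp add: hoch_single bar_Cons lmul_Cons lmul_Nil bar_Nil cons_zero)
  moreover have "op_t ?a = - sg [(0, 0), (0, r)]"
    using op_t_snoc[of "[(0, r)]" "(0, 0)", where 'b = 'k] by (simp add: fscale_m1)
  ultimately have "sg [(0, 0), (0, r)] = (?a - op_t ?a) - hoch ?c" by simp
  moreover have "?a \<in> chains 1" "?c \<in> chains (Suc 1)"
    by (simp_all add: chains_def supp_single)
  ultimately show ?thesis by (simp only:) (intro Blam_diff Blam_t Blam_hoch)
qed

text \<open>The shift reduces degree \<open>n \<ge> 3\<close> to \<open>n - 2\<close>. In degree 1 the class of \<open>t\<^sup>r\<close> with \<open>r \<noteq> 0\<close> is represented by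
  \<open>1/r [1, t\<^sup>r]\<close>, which vanishes. In degree 2 a Laurent polynomial in the last column extends to a
  cycle only if its image under \<open>t d/dt\<close> is zero.\<close>

lemma weight_0_boundary:
  fixes x :: "nat \<Rightarrow> 'k::field_char_0 chain"
  assumes "x \<in> cycM n" "\<And>p. p \<le> n \<Longrightarrow> x p \<in> head_chains 0 0 (n - p)" "psi n x = 0" "n = 0 \<Longrightarrow> phi (x 0) = 0"
  shows "x \<in> bounds n"
  using assms
proof (induction n arbitrary: x rule: less_induct)
  case (less n)
  have low: "x \<in> bounds n" if B: "x 0 \<in> Blam n"
  proof -
    obtain g h where "x 0 = hoch g + (h - op_t h)" "g \<in> chains (Suc n)" "h \<in> chains n"
      using B unfolding Blam_def by blast
    then show ?thesis by (rule zigzag[OF less.prems(1)])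
  qed
  have x0: "x 0 \<in> head_chains 0 0 n" using less.prems(2)[of 0] by simp
  consider "n = 0" | "n = 1" | "n = 2" | m where "n = Suc (Suc (Suc m))"
    by (metis One_nat_def not0_implies_Suc numeral_2_eq_2)
  then show ?case
  proof cases
    case 1
    have "hoch (x 0) = 0" using x0 1 by (intro hoch_0) (simp add: head_chains_Len[of _ 0 0 0])
    then obtain y where "y \<in> head_chains 0 0 (Suc n)" "x 0 = hoch y"
      using hochschild_boundary[OF x0] less.prems(4)[OF 1] by auto
    then have "x 0 \<in> Blam n" by (simp add: Blam_hoch head_chains_0_chains)
    then show ?thesis by (rule low)
  next
    case 2
    have bh1: "hoch f = 0" if "f \<in> head_chains 0 0 1" for f :: "'k chain"
    proof (rule lin_0_on_supp[OF that lin_ops(6)])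
      fix w assume "w \<in> words 0 0 1"
      then obtain x y where w: "w = [(0, x), (0, y)]" by (auto simp: words_0 length_Suc_conv)
      then show "hoch (sg w) = (0 :: 'k chain)" by (simp add: hoch_pair)
    qed
    have no0: "Poly_Mapping.lookup (phi (x 0)) 0 = 0"
      using less.prems(3) 2 by (simp add: psi_def)
    define v :: "'k chain" where "v = lin_ext (\<lambda>r. fscale (1 / of_int r) (sg [(0, 0), (0, r)])) (phi (x 0))"
    have v: "v \<in> Blam n" "v \<in> head_chains 0 0 1"
      unfolding v_def 2
    proof -
      show "lin_ext (\<lambda>r. fscale (1 / of_int r) (sg [(0, 0), (0, r)])) (phi (x 0)) \<in> (Blam 1 :: 'k chain set)"
        by (rule lin_in_subspace[OF lin_lin_ext subspace_Blam])
          (simp only: lin_ext_single fscale_1 Blam_scale[OF unit_pair_Blam])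
      show "lin_ext (\<lambda>r. fscale (1 / of_int r) (sg [(0, 0), (0, r)])) (phi (x 0)) \<in> (head_chains 0 0 1 :: 'k chain set)"
        by (rule lin_in_subspace[OF lin_lin_ext subspace_supp])
          (simp add: supp_scale supp_single words_0)
    qed
    have "phi v = phi (x 0)"
      unfolding v_def
    proof (rule lin_eqI[where f = "phi (x 0)" and G = "\<lambda>f. f"])
      show "phi (lin_ext (\<lambda>r. fscale (1 / of_int r) (sg [(0, 0), (0, r)])) (sg r)) = (sg r :: int \<Rightarrow>\<^sub>0 'k)"
        if "r \<in> Poly_Mapping.keys (phi (x 0))" for r
      proof -
        have "r \<noteq> 0" using that no0 by (auto simp: in_keys_iff)
        then show ?thesis
          unfolding lin_ext_single fscale_1 phi_scale by (simp add: phi_sg fscale_single)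
      qed
    qed (intro lin_intros lin_phi)+
    moreover have "x 0 - v \<in> head_chains 0 0 1" using x0 v(2) 2 by (simp add: supp_diff)
    ultimately obtain y where y: "y \<in> head_chains 0 0 (Suc 1)" "x 0 - v = hoch y"
      using hochschild_boundary[of "x 0 - v" 0 0 1] bh1 by (auto simp: phi_diff)
    have "x 0 = hoch y + v" using y(2) by (simp add: algebra_simps)
    moreover have "hoch y \<in> Blam n" unfolding 2 by (intro Blam_hoch head_chains_0_chains y(1))
    ultimately have "x 0 \<in> Blam n" using v(1) by (simp add: Blam_add)
    then show ?thesis by (rule low)
  next
    case 3
    have x1: "x 1 \<in> head_chains 0 0 1" and x2: "x 2 \<in> head_chains 0 0 0" using less.prems(2)[of 1] less.prems(2)[of 2] 3 by simp_all
    have x0': "x 0 \<in> head_chains 0 0 2" using x0 3 by simp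
    have "x 1 - op_t (x 1) = - hoch (x 0)"
      using cycM_eq[OF less.prems(1), of 0] 3 by (simp add: vertM_def horizontal_def)
    then have "euler (phi (bar (x 1))) = 0"
      using phi_minus_t[OF x1] phi_hoch[OF x0'] by (simp add: phi_uminus)
    moreover have "bar (x 1) = op_N (x 2)"
      using cycM_eq[OF less.prems(1), of 1] 3 by (simp add: vertM_def horizontal_def numeral_2_eq_2)
    moreover have "op_N (x 2) = x 2"
      using op_N_Len[OF head_chains_Len[OF x2]] by simp
    ultimately have "of_int r * Poly_Mapping.lookup (phi (x 2)) r = 0" for r
      using lookup_euler[of "phi (x 2)" r] by simp
    moreover have "Poly_Mapping.lookup (phi (x 2)) 0 = 0"
      using less.prems(3) 3 by (simp add: psi_def)
    ultimately have "Poly_Mapping.lookup (phi (x 2)) r = 0" for r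
      by (cases "r = 0") (metis mult_eq_0_iff of_int_eq_0_iff)+
    then have "phi (x 2) = 0" by (intro poly_mapping_eqI) simp
    define x' where "x' = (\<lambda>p. x (Suc (Suc p)))"
    have "x' \<in> cycM 0"
      using less.prems(1) 3 by (auto simp: cycM_def TotM_def x'_def dM_def numeral_2_eq_2)
    then have "x' \<in> bounds 0"
      using less.IH[of 0 x'] \<open>phi (x 2) = 0\<close> x2 3 by (simp add: x'_def psi_def numeral_2_eq_2)
    then show ?thesis
      using periodicity_inj[of x 0] less.prems(1,2) 3 by (simp add: x'_def numeral_2_eq_2)
  next
    case 4
    define x' where "x' = (\<lambda>p. x (Suc (Suc p)))"
    have "x (Suc (Suc p)) \<in> chains (Suc m - p)" if "p \<le> Suc m" for p
      using cycM_chains[OF less.prems(1), of "Suc (Suc p)"] that 4 by simp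
    then have "x' \<in> TotM (Suc m)"
      using less.prems(1) 4 by (auto simp: cycM_def TotM_def x'_def)
    moreover have "dM (Suc m) x' p = 0" for p
      using cycM_eq[OF less.prems(1), of "Suc (Suc p)"] 4
      by (auto simp: x'_def dM_def vertM_parity horizontal_parity)
    ultimately have "x' \<in> cycM (Suc m)" by (auto simp: cycM_def)
    then have "x' \<in> bounds (Suc m)"
      using less.IH[of "Suc m" x'] less.prems(2)[of "Suc (Suc _)"] less.prems(3) 4
      by (simp add: x'_def psi_shift)
    then show ?thesis
      using periodicity_inj[of x "Suc m"] less.prems(1,2) 4 by (simp add: x'_def)
  qed
qed

text \<open>Degree 1 has the class of \<open>t\<^sup>-\<^sup>1 dt\<close>, degree 2 the periodic class of the ground field; the shift provides
  the other degrees.\<close>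

lemma weight_0_cycle:
  "\<exists>x\<in>cycM (Suc n). (\<forall>p\<le>Suc n. x p \<in> head_chains 0 0 (Suc n - p)) \<and> psi (Suc n) x = (1 :: 'k::field_char_0)"
proof (induction n rule: less_induct)
  case (less n)
  consider "n = 0" | "n = 1" | m where "n = Suc (Suc m)"
    by (metis One_nat_def not0_implies_Suc)
  then show ?case
  proof cases
    case 1
    define x :: "nat \<Rightarrow> 'k chain" where "x p = (if p = 0 then sg [(0, - 1), (0, 1)] else 0)" for p
    have "x \<in> cycM 1"
      by (auto simp: cycM_def TotM_def dM_def x_def chains_def vertM_def hoch_pair horizontal_zero intro!: supp_single)
    moreover have "\<forall>p\<le>1. x p \<in> head_chains 0 0 (1 - p)"
      by (auto simp: x_def words_0 intro!: supp_single)
    moreover have "psi 1 x = 1" by (simp add: psi_def x_def phi_sg)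
    ultimately show ?thesis using 1 by auto
  next
    case 2
    let ?o = "(0, 0) :: letter"
    define x :: "nat \<Rightarrow> 'k chain" where
      \<comment> \<open>\<open>N [1] = b' [1, 1]\<close> and \<open>(1 - t) [1, 1] = 2 [1, 1] = 2 b [1, 1, 1]\<close>\<close>
      "x p = (if p = 0 then fscale (- 2) (sg [?o, ?o, ?o]) else if p = 1 then sg [?o, ?o] else if p = 2 then sg [?o] else 0)" for p
    have w: "x p \<in> head_chains 0 0 (2 - p)" if "p \<le> 2" for p
      using that by (auto simp: x_def words_0 intro!: supp_neg supp_single supp_scale)
    have "wrap (sg [?o, ?o, ?o]) = (sg [?o, ?o] :: 'k chain)"
      using wrap_snoc[of ?o "[?o]" ?o, where 'a = 'k] by simp
    then have bh3: "hoch (sg [?o, ?o, ?o]) = (sg [?o, ?o] :: 'k chain)"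
      by (simp add: hoch_single bar_Cons lmul_Cons lmul_Nil bar_Nil cons_zero)
    have t2: "op_t (sg [?o, ?o]) = (- sg [?o, ?o] :: 'k chain)"
      using op_t_snoc[of "[?o]" ?o, where 'b = 'k] by (simp add: fscale_m1)
    have bp2: "bar (sg [?o, ?o]) = (sg [?o] :: 'k chain)"
      by (simp add: bar_Cons lmul_Cons lmul_Nil bar_Nil cons_zero)
    have N1: "op_N (sg [?o]) = (sg [?o] :: 'k chain)"
      using op_N_Len[of "sg [?o] :: 'k chain" 1] by (simp add: supp_single)
    have two: "fscale 2 f = f + f" for f :: "'k chain"
      using free_vs.scale_left_distrib[of 1 1 f] by simp
    have "dM 2 x p = 0" for p
      by (simp add: dM_def x_def vertM_def horizontal_def hoch_scale hoch_uminus hoch_diff bh3 t2 bp2 N1 two less_2_cases_iff)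
    moreover have "x \<in> TotM 2"
      using w by (auto simp: TotM_def head_chains_0_chains x_def)
    ultimately have "x \<in> cycM 2" by (auto simp: cycM_def)
    moreover have "psi 2 x = 1" by (simp add: psi_def x_def phi_sg)
    ultimately show ?thesis using 2 w by (auto simp: numeral_2_eq_2)
  next
    case 3
    then obtain x where x: "x \<in> cycM (Suc m)" "\<forall>p\<le>Suc m. x p \<in> head_chains 0 0 (Suc m - p)" "psi (Suc m) x = (1 :: 'k)"
      using less[of m] by auto
    then obtain z where z: "z \<in> cycM (Suc (Suc (Suc m)))" "\<forall>p\<le>Suc (Suc (Suc m)). z p \<in> head_chains 0 0 (Suc (Suc (Suc m)) - p)"
      "\<And>p. z (Suc (Suc p)) = x p"
      using periodicity_surj[of x m] by blast
    have "psi (Suc n) z = 1"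
      using x(3) unfolding 3 psi_shift by (simp add: z(3))
    then show ?thesis using z(1,2) 3 by blast
  qed
qed

section \<open>Cyclic homology of the monomial complex\<close>

definition evenwt :: "nat \<Rightarrow> nat" where
  "evenwt n = 2 * (Suc n div 2)"

lemma evenwt_pos: "n > 0 \<Longrightarrow> \<exists>l. evenwt n = Suc l \<and> odd l \<and> (n = l \<or> n = Suc l)"
  by (intro exI[of _ "evenwt n - 1"]) (unfold evenwt_def; presburger)

definition oddp :: "(int \<Rightarrow>\<^sub>0 'k::field) \<Rightarrow> (int \<Rightarrow>\<^sub>0 'k)" where
  "oddp = lin_ext (\<lambda>r. if odd r then sg r else 0)"

lemma lin_oddp: "lin oddp"
  by (simp add: oddp_def lin_lin_ext)

lemma lookup_oddp: "Poly_Mapping.lookup (oddp f) r = (if odd r then Poly_Mapping.lookup f r else 0)"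
proof -
  have "Poly_Mapping.lookup (oddp f) r =
      (\<Sum>x\<in>Poly_Mapping.keys f. Poly_Mapping.lookup f x * Poly_Mapping.lookup (if odd x then sg x else 0) r)"
    by (simp add: oddp_def lin_ext_def lookup_sum)
  also have "\<dots> = (\<Sum>x\<in>Poly_Mapping.keys f. if x = r then (if odd r then Poly_Mapping.lookup f r else 0) else 0)"
    by (intro sum.cong refl) (auto simp: lookup_single when_def)
  finally have "Poly_Mapping.lookup (oddp f) r =
      (\<Sum>x\<in>Poly_Mapping.keys f. if x = r then (if odd r then Poly_Mapping.lookup f r else 0) else 0)" .
  then show ?thesis by (auto simp: in_keys_iff)
qed

lemma oddp_span: "oddp f \<in> free_vs.span {sg r | r. odd r}"
  unfolding oddp_def
  by (rule lin_in_subspace[OF lin_lin_ext free_vs.subspace_span]) (auto intro: free_vs.span_base free_vs.span_zero)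

text \<open>The component in \<open>T\<^sub>o\<^sub>d\<close> of the isomorphism.\<close>

definition Psi1 :: "nat \<Rightarrow> (nat \<Rightarrow> 'k::field chain) \<Rightarrow> (int \<Rightarrow>\<^sub>0 'k)" where
  "Psi1 n x = oddp (phi (head_part (op_N (weight_part (evenwt n) (x 0)))))"

text \<open>The component in \<open>k\<close> of the isomorphism.\<close>

definition Psi2 :: "nat \<Rightarrow> (nat \<Rightarrow> 'k::field chain) \<Rightarrow> 'k" where
  "Psi2 n x = psi n (\<lambda>p. weight_part 0 (x p))"

lemma lin_Psi1: "lin (\<lambda>f. oddp (phi (head_part (op_N (weight_part m f)))))"
  by (intro lin_comp[OF lin_oddp] lin_intros lin_weight_part)

lemmas Psi1_add = lin_add[OF lin_Psi1]
  and Psi1_scale = lin_scale[OF lin_Psi1]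

lemma Psi_add: "Psi1 n (\<lambda>p. x p + y p) = Psi1 n x + Psi1 n y" "Psi2 n (\<lambda>p. x p + y p) = Psi2 n x + Psi2 n y"
  and Psi_scale: "Psi1 n (\<lambda>p. fscale c (x p)) = fscale c (Psi1 n x)" "Psi2 n (\<lambda>p. fscale c (x p)) = c * Psi2 n x"
  using Psi1_add Psi1_scale
  by (simp_all add: Psi1_def Psi2_def psi_def weight_part_add phi_add lookup_add
    weight_part_scale phi_scale)

lemma dM_add: "dM n (\<lambda>p. x p + y p) = (\<lambda>p. dM n x p + dM n y p)"
  and dM_scale: "dM n (\<lambda>p. fscale c (x p)) = (\<lambda>p. fscale c (dM n x p))"
  by (simp_all add: dM_def fun_eq_iff vertM_add horizontal_add
    vertM_scale horizontal_scale free_vs.scale_right_distrib)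

lemma TotM_add: "x \<in> TotM n \<Longrightarrow> y \<in> TotM n \<Longrightarrow> (\<lambda>p. x p + y p) \<in> TotM n"
  and TotM_scale: "x \<in> TotM n \<Longrightarrow> (\<lambda>p. fscale c (x p)) \<in> TotM n"
  by (simp_all add: TotM_def chains_add chains_scale)

lemma cycM_add: "x \<in> cycM n \<Longrightarrow> y \<in> cycM n \<Longrightarrow> (\<lambda>p. x p + y p) \<in> cycM n"
  and cycM_scale: "x \<in> cycM n \<Longrightarrow> (\<lambda>p. fscale c (x p)) \<in> cycM n"
  by (simp_all add: cycM_def TotM_add TotM_scale dM_add dM_scale)

lemma cycM_zero: "(\<lambda>p. 0) \<in> cycM n"
  by (simp add: cycM_def TotM_def dM_def fun_eq_iff vertM_zero horizontal_zero)

lemma bounds_add: "x \<in> bounds n \<Longrightarrow> y \<in> bounds n \<Longrightarrow> (\<lambda>p. x p + y p) \<in> bounds n"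
proof -
  assume "x \<in> bounds n" "y \<in> bounds n"
  then obtain a b where "a \<in> TotM (Suc n)" "b \<in> TotM (Suc n)" "x = dM (Suc n) a" "y = dM (Suc n) b"
    unfolding bounds_def by blast
  then show ?thesis
    unfolding bounds_def by (intro image_eqI[of _ _ "\<lambda>p. a p + b p"]) (simp_all add: dM_add TotM_add)
qed

lemma bounds_zero: "(\<lambda>p. 0) \<in> bounds n"
  unfolding bounds_def
proof (rule image_eqI)
  show "(\<lambda>p. 0) = dM (Suc n) (\<lambda>p. 0 :: 'a chain)" "(\<lambda>p. 0 :: 'a chain) \<in> TotM (Suc n)"
    using cycM_zero[of "Suc n", where 'a = 'a] by (simp_all add: cycM_def)
qed

lemma bounds_sum: "finite I \<Longrightarrow> (\<And>i. i \<in> I \<Longrightarrow> X i \<in> bounds n) \<Longrightarrow> (\<lambda>p. \<Sum>i\<in>I. X i p) \<in> bounds n"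
proof (induction I rule: finite_induct)
  case (insert i I)
  have "(\<lambda>p. X i p + (\<Sum>i\<in>I. X i p)) \<in> bounds n"
    by (rule bounds_add) (use insert in simp_all)
  then show ?case using insert by simp
qed (simp add: bounds_zero)

lemma weight_part_TotM: "x \<in> TotM n \<Longrightarrow> (\<lambda>p. weight_part m (x p)) \<in> TotM n"
  by (simp add: TotM_def weight_part_chains weight_part_zero)

lemma weight_part_cycM:
  assumes x: "x \<in> cycM n"
  shows "(\<lambda>p. weight_part m (x p)) \<in> cycM n"
proof -
  have "dM n (\<lambda>p. weight_part m (x p)) p = 0" for p
  proof (cases "p < n")
    case True
    then have "vertM p (weight_part m (x p)) + horizontal (Suc p) (weight_part m (x (Suc p))) =
        weight_part m (vertM p (x p) + horizontal (Suc p) (x (Suc p)))"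
      using weight_part_horizontal[OF cycM_chains[OF x, of "Suc p"]]
      by (simp add: weight_part_add weight_part_vertM)
    also have "\<dots> = 0"
      using cycM_eq[OF x True] by (simp add: weight_part_zero)
    finally show ?thesis using True by (simp add: dM_def)
  qed (simp add: dM_def)
  then have "dM n (\<lambda>p. weight_part m (x p)) = (\<lambda>_. 0)" by (rule ext)
  moreover have "(\<lambda>p. weight_part m (x p)) \<in> TotM n"
    using x weight_part_TotM[of x n m] unfolding cycM_def by blast
  ultimately show ?thesis unfolding cycM_def by blast
qed

lemma sum_weight_part':
  assumes "f \<in> chains k" "k \<le> n"
  shows "(\<Sum>m\<le>Suc n. weight_part m f) = f"
proof -
  have "weight_part m f = 0" if "m > Suc k" for m
  proof (rule lin_eq_0I[OF lin_weight_part])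
    fix w assume "w \<in> Poly_Mapping.keys f"
    then have "length w = Suc k" "list_all (\<lambda>a. fst a \<le> 1) w" using assms(1) by (auto simp: chains_def supp_def)
    then have "wt w \<noteq> m" using wt_le[of w] that by auto
    then show "weight_part m (sg w) = (0 :: 'a chain)" by (simp add: weight_part_sg)
  qed
  then have "(\<Sum>m\<le>Suc n. weight_part m f) = (\<Sum>m\<le>Suc k. weight_part m f)"
    using assms(2) by (intro sum.mono_neutral_right) auto
  with sum_weight_part[OF assms(1)] show ?thesis by simp
qed

theorem monomial_kernel:
  fixes x :: "nat \<Rightarrow> 'k::field_char_0 chain"
  assumes x: "x \<in> cycM n" and psi1: "n > 0 \<Longrightarrow> Psi1 n x = 0" and psi2: "Psi2 n x = 0"
    and n0: "n = 0 \<Longrightarrow> phi (weight_part 0 (x 0)) = 0"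
  shows "x \<in> bounds n"
proof -
  have "(\<lambda>p. weight_part m (x p)) \<in> bounds n" if "m \<le> Suc n" for m
  proof (cases m)
    case 0
    have "weight_part 0 (x p) \<in> head_chains 0 0 (n - p)" if "p \<le> n" for p
      using weight_part_weight_chains[OF cycM_chains[OF x that], of 0] by (simp add: weight_chains_0)
    then show ?thesis
      using weight_0_boundary[OF weight_part_cycM[OF x, of 0]] psi2 n0 by (simp add: 0 Psi2_def)
  next
    case (Suc l)
    let ?z = "weight_part (Suc l) (x 0)"
    have z: "?z \<in> weight_chains (Suc l) n" using weight_part_weight_chains[OF cycM_chains[OF x, of 0]] by simp
    have cyc: "(\<lambda>p. weight_part m (x p)) \<in> cycM n" by (rule weight_part_cycM[OF x])
    have "op_N (hoch ?z) = 0"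
    proof (cases n)
      case 0
      then have "hoch ?z = 0" using chains_Len[OF weight_chains_chains[OF z]] by (intro hoch_0) simp
      then show ?thesis by (simp add: op_N_zero)
    next
      case (Suc k)
      have "hoch ?z = - (weight_part m (x 1) - op_t (weight_part m (x 1)))"
        using cycM_eq[OF cyc, of 0] Suc \<open>m = Suc l\<close> by (simp add: vertM_def horizontal_def)
      moreover have "weight_part m (x 1) \<in> supp (Len (Suc k))"
        using cycM_chains[OF cyc, of 1] Suc by (auto intro: chains_Len)
      ultimately show ?thesis
        using op_N_minus_t[of "weight_part m (x 1)" k] by (simp add: op_N_uminus op_N_diff)
    qed
    moreover have "Poly_Mapping.lookup (phi (head_part (op_N ?z))) r = 0" if "odd l" "odd r" for r
    proof (cases "m = evenwt n")
      case True
      then have "n > 0" using Suc that by (cases n) (auto simp: evenwt_def)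
      then have "Poly_Mapping.lookup (oddp (phi (head_part (op_N ?z)))) r = 0"
        using psi1 True Suc by (simp add: Psi1_def)
      then show ?thesis using that(2) by (simp add: lookup_oddp)
    next
      case False
      then have "n \<noteq> l" "n \<noteq> Suc l" using that(1) Suc by (auto simp: evenwt_def elim!: oddE)
      then have "phi (head_part (op_N ?z)) = 0"
        by (rule phi_0[OF head_part_head_chains[OF op_N_weight_chains[OF z]]])
      then show ?thesis by simp
    qed
    ultimately have "?z \<in> Blam n"
      using positive_weight_boundary[OF z] by blast
    then obtain g h where "?z = hoch g + (h - op_t h)" "g \<in> chains (Suc n)" "h \<in> chains n"
      unfolding Blam_def by blast
    then show ?thesis
      using zigzag[OF cyc, of g h] Suc by simp
  qed
  then have "(\<lambda>p. \<Sum>m\<le>Suc n. weight_part m (x p)) \<in> bounds n"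
    by (intro bounds_sum) auto
  moreover have "(\<Sum>m\<le>Suc n. weight_part m (x p)) = x p" for p
  proof (cases "p \<le> n")
    case True
    then show ?thesis using sum_weight_part'[OF cycM_chains[OF x True], of n] by simp
  next
    case False
    then have "x p = 0" using x by (simp add: cycM_def TotM_def)
    then show ?thesis by (simp add: weight_part_zero del: sum.atMost_Suc)
  qed
  ultimately show ?thesis by simp
qed

lemma op_t_length_1: "f \<in> chains 0 \<Longrightarrow> op_t f = f"
  using op_t_pow_Len[of f 1] chains_Len[of f 0] by simp

lemmas oddp_zero = lin_0[OF lin_oddp]

text \<open>The norm kills \<open>1 - t\<close> and turns \<open>b\<close> into \<open>b'\<close>, so that \<open>phi\<close> after \<open>head_part\<close> is applied to a
  Hochschild boundary.\<close>

theorem monomial_boundary: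
  fixes x :: "nat \<Rightarrow> 'k::field_char_0 chain"
  assumes x: "x \<in> bounds n"
  shows "n > 0 \<Longrightarrow> Psi1 n x = 0" "Psi2 n x = 0" "n = 0 \<Longrightarrow> phi (weight_part 0 (x 0)) = 0"
proof -
  obtain y where y: "y \<in> TotM (Suc n)" "\<And>p. p \<le> n \<Longrightarrow> x p = vertM p (y p) + horizontal (Suc p) (y (Suc p))"
    using boundsE[OF x] by blast
  have yC: "y p \<in> chains (Suc n - p)" if "p \<le> Suc n" for p
    using y(1) that by (simp add: TotM_def)
  have y0: "y 0 \<in> chains (Suc n)" and y1: "y 1 \<in> chains n" using yC[of 0] yC[of 1] by simp_all
  show "Psi1 n x = 0" if "n > 0"
  proof -
    obtain l where l: "evenwt n = Suc l" "odd l" using evenwt_pos[OF \<open>n > 0\<close>] by blast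
    let ?u = "weight_part (evenwt n) (y 0)" and ?v = "weight_part (evenwt n) (y 1)"
    have u: "?u \<in> weight_chains (Suc l) (Suc n)" using weight_part_weight_chains[OF y0] l by metis
    have "weight_part (evenwt n) (x 0) = hoch ?u + (?v - op_t ?v)"
      using y(2)[of 0] by (simp add: vertM_def horizontal_def weight_part_add weight_part_diff weight_part_hoch weight_part_t[OF y1[unfolded One_nat_def]])
    then have "op_N (weight_part (evenwt n) (x 0)) = op_N (hoch ?u)"
      using op_N_minus_t[OF chains_Len[OF weight_part_chains[OF y1]]] by (simp add: op_N_add)
    also have "\<dots> = bar (op_N ?u)"
      by (rule bar_N[OF chains_Len[OF weight_chains_chains[OF u]], symmetric])
    also have "head_part \<dots> = hoch (head_part (op_N ?u))"
      by (rule hoch_head_part[OF op_N_chains[OF weight_chains_chains[OF u]] op_t_N[OF chains_Len[OF weight_chains_chains[OF u]]], symmetric])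
    finally have "phi (head_part (op_N (weight_part (evenwt n) (x 0)))) = 0"
      using phi_hoch[OF head_part_head_chains[OF op_N_weight_chains[OF u]]] l(2) by simp
    then show ?thesis by (simp add: Psi1_def oddp_zero)
  qed
  have ev: "phi (weight_part 0 (x n)) = 0" if "even n"
  proof -
    have yn: "y n \<in> chains 1" "y (Suc n) \<in> chains 0" using yC[of n] yC[of "Suc n"] by simp_all
    have "x n = hoch (y n)"
      using y(2)[of n] that op_t_length_1[OF yn(2)] by (simp add: vertM_def horizontal_def)
    then have "phi (weight_part 0 (x n)) = phi (hoch (weight_part 0 (y n)))" by (simp add: weight_part_hoch)
    also have "\<dots> = 0"
      using phi_hoch[of "weight_part 0 (y n)" 0 0 1] weight_part_weight_chains[OF yn(1), of 0] by (simp add: weight_chains_0)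
    finally show ?thesis .
  qed
  then show "n = 0 \<Longrightarrow> phi (weight_part 0 (x 0)) = 0" by auto
  show "Psi2 n x = 0"
  proof (cases "even n")
    case True
    then show ?thesis using ev by (simp add: Psi2_def psi_def)
  next
    case False
    then obtain k where n: "n = Suc k" "even k" by (cases n) auto
    have yk: "y k \<in> chains 2" "y n \<in> chains 1" using yC[of k] yC[of n] n by (simp_all add: numeral_2_eq_2)
    let ?u = "weight_part 0 (y k)" and ?v = "weight_part 0 (y n)"
    have uv: "?u \<in> head_chains 0 0 2" "?v \<in> head_chains 0 0 1"
      using weight_part_weight_chains[OF yk(1), of 0] weight_part_weight_chains[OF yk(2), of 0] by (simp_all add: weight_chains_0)
    have "weight_part 0 (x k) = hoch ?u + (?v - op_t ?v)"
      using y(2)[of k] n by (simp add: vertM_def horizontal_def weight_part_add weight_part_diff weight_part_hoch weight_part_t[OF yk(2)[unfolded n(1)]])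
    then have "phi (weight_part 0 (x k)) = euler (phi (bar ?v))"
      using phi_hoch[OF uv(1)] phi_minus_t[OF uv(2)] by (simp add: phi_add)
    then show ?thesis
      using n by (simp add: Psi2_def psi_def lookup_euler)
  qed
qed

text \<open>The \<open>K + 1\<close> rotations all contribute with the same sign because \<open>r\<close> is odd. For even \<open>r\<close> they would
  cancel.\<close>

lemma phi_N_Mw:
  assumes K: "odd K" and r: "odd r"
  shows "phi (head_part (op_N (sg (Mw 0 r K 0)))) = (fscale (of_nat (Suc K)) (sg r) :: int \<Rightarrow>\<^sub>0 'k::field)"
proof -
  let ?M = "sg (Mw 0 r K 0) :: 'k chain"
  have len: "length (Mw 0 r K 0) = Suc K" by (simp add: Mw_def)
  have "phi (head_part ((op_t ^^ i) ?M)) = sg r" if "i < Suc K" for i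
  proof (cases i)
    case 0
    then show ?thesis using phi_Mw[of r K 0, where 'a = 'k] head_part_id[OF Mw_head_chains[of 0 r K 0, where 'a = 'k]] by simp
  next
    case (Suc p)
    have "drop (length (Mw 0 r K 0) - i) (Mw 0 r K 0) @ take (length (Mw 0 r K 0) - i) (Mw 0 r K 0) = Mw 0 r p (K - p)"
      unfolding len using that Suc by (simp add: Mw_def)
    then have "(op_t ^^ i) ?M = fscale ((- 1) ^ (i * K)) (sg (Mw 0 r p (K - p)))"
      using op_t_pow_single[of i "Mw 0 r K 0", where 'k = 'k] that len by simp
    then have "phi (head_part ((op_t ^^ i) ?M)) = fscale ((- 1) ^ (i * K) * parity (r * int (K - p))) (sg r)"
      using phi_Mw[of r p "K - p", where 'a = 'k] head_part_id[OF Mw_head_chains[of 0 r p "K - p", where 'a = 'k]]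
      by (simp add: head_part_scale phi_scale)
    moreover have "even (i * K) \<longleftrightarrow> even (r * int (K - p))"
      using K r Suc that by auto
    then have "(- 1) ^ (i * K) * parity (r * int (K - p)) = (1 :: 'k)"
      by (cases "even (i * K)") (simp_all add: parity_def)
    ultimately show ?thesis by simp
  qed
  then have "(\<Sum>i<Suc K. phi (head_part ((op_t ^^ i) ?M))) = (\<Sum>i<Suc K. sg r)"
    by (intro sum.cong refl) simp
  moreover have "op_N ?M = (\<Sum>i<Suc K. (op_t ^^ i) ?M)"
    by (rule op_N_Len) (simp add: supp_single len)
  ultimately show ?thesis
    by (simp only: head_part_sum phi_sum fscale_of_nat)
qed

text \<open>Only the rotation with the pure letter in last place contributes.\<close>

lemma phi_N_Lw:
  assumes r: "odd r"
  shows "\<exists>u. u \<noteq> 0 \<and> phi (head_part (op_N (sg (Lw 0 r K 0)))) = (fscale u (sg r) :: int \<Rightarrow>\<^sub>0 'k::field_char_0)"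
proof -
  let ?L = "sg (Lw 0 r K 0) :: 'k chain"
  have len: "length (Lw 0 r K 0) = Suc (Suc K)" by (simp add: Lw_def)
  have rot: "phi (head_part ((op_t ^^ Suc i) ?L)) = 0" if i: "i < Suc K" for i
  proof -
    have w: "drop (length (Lw 0 r K 0) - Suc i) (Lw 0 r K 0) @ take (length (Lw 0 r K 0) - Suc i) (Lw 0 r K 0) =
        replicate i (Suc 0, 0) @ (0, r) # replicate (Suc K - i) (Suc 0, 0)"
      unfolding len using that by (simp add: Lw_def del: replicate_Suc)
    have t: "(op_t ^^ Suc i) ?L = fscale ((- 1) ^ (Suc i * Suc K)) (sg (replicate i (Suc 0, 0) @ (0, r) # replicate (Suc K - i) (Suc 0, 0)))"
      using op_t_pow_single[of "Suc i" "Lw 0 r K 0", where 'k = 'k] that len w by simp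
    show ?thesis
    proof (cases i)
      case 0
      then show ?thesis unfolding t by (simp add: head_part_scale head_part_uminus head_part_sg phi_zero)
    next
      case (Suc p)
      obtain q where q: "Suc K - i = Suc q" using i by (cases "Suc K - i") auto
      have "phi (sg (Lw 0 r p (Suc q))) = (0 :: int \<Rightarrow>\<^sub>0 'k)"
        using phi_Lw[of 0 r p "Suc q", where 'k = 'k] by simp
      moreover have "replicate i (Suc 0, 0) @ (0, r) # replicate (Suc K - i) (Suc 0, 0) = Lw 0 r p (Suc q)"
        unfolding q unfolding Suc Lw_def ..
      ultimately show ?thesis
        unfolding t using head_part_id[OF Lw_head_chains[of 0 r p "Suc q"], where 'a = 'k]
        by (simp add: head_part_scale phi_scale head_part_uminus phi_uminus)
    qed
  qed
  have "phi (head_part (op_N ?L)) = (\<Sum>i<Suc (Suc K). phi (head_part ((op_t ^^ i) ?L)))"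
    by (subst op_N_Len[of ?L "Suc (Suc K)"])
      (simp add: supp_single len, simp only: head_part_sum phi_sum)
  also have "\<dots> = phi (head_part ?L) + (\<Sum>i<Suc K. phi (head_part ((op_t ^^ Suc i) ?L)))"
    by (simp only: sum.lessThan_Suc_shift[of _ "Suc K"] funpow_0)
  also have "(\<Sum>i<Suc K. phi (head_part ((op_t ^^ Suc i) ?L))) = 0"
    by (intro sum.neutral ballI rot) (simp only: lessThan_iff)
  finally have "phi (head_part (op_N ?L)) = phi ?L"
    using head_part_id[OF Lw_head_chains[of 0 r K 0], where 'a = 'k] by simp
  moreover obtain u :: 'k where "u \<noteq> 0" "phi ?L = Poly_Mapping.single r (u * of_int r)"
    using phi_Lw[of 0 r K 0, where 'k = 'k] by auto
  moreover have "r \<noteq> 0" using r by auto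
  ultimately show ?thesis
    by (intro exI[of _ "u * of_int r"]) (simp add: fscale_single)
qed

text \<open>For odd \<open>n\<close> the cycle is the Hochschild cycle \<open>[s, \<dots>, s, s t\<^sup>r]\<close>. For even \<open>n\<close> it is \<open>[s, \<dots>, s, t\<^sup>r]\<close>, which is
  a cycle modulo \<open>1 - t\<close> only; the correction sits in column 1.\<close>

lemma monomial_odd_cycle:
  assumes n: "n > 0" and r: "odd r"
  shows "\<exists>x\<in>cycM n. Psi1 n x = (sg r :: int \<Rightarrow>\<^sub>0 'k::field_char_0) \<and> Psi2 n x = 0"
proof -
  obtain K where K: "odd K" "n = K \<or> n = Suc K" "evenwt n = Suc K"
    using evenwt_pos[OF n] by blast
  let ?M = "sg (Mw 0 r K 0) :: 'k chain" and ?L = "sg (Lw 0 r K 0) :: 'k chain"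
  have M: "?M \<in> weight_chains (Suc K) K" and L: "?L \<in> weight_chains (Suc K) (Suc K)"
    using head_chains_weight_chains[OF Mw_head_chains[of 0 r K 0, where 'a = 'k]] head_chains_weight_chains[OF Lw_head_chains[of 0 r K 0]] by simp_all
  have "\<exists>x\<in>cycM n. \<exists>u. u \<noteq> 0 \<and> Psi1 n x = fscale u (sg r :: int \<Rightarrow>\<^sub>0 'k) \<and> Psi2 n x = 0"
    using K(2)
  proof
    assume nK: "n = K"
    define x where "x p = (if p = 0 then ?M else 0)" for p :: nat
    have "x \<in> cycM n"
      using weight_chains_chains[OF M] by (auto simp: cycM_def TotM_def dM_def x_def nK vertM_def hoch_Mw horizontal_zero hoch_zero bar_zero)
    moreover have "weight_part (evenwt n) ?M = ?M" "weight_part 0 ?M = 0"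
      using weight_part_id[OF M] weight_part_other[OF M, of 0] K(3) by simp_all
    then have "Psi1 n x = fscale (of_nat (Suc K)) (sg r)" "Psi2 n x = 0"
      using r by (simp_all add: Psi1_def x_def phi_N_Mw[OF K(1) r] lin_scale[OF lin_lin_ext] oddp_def Psi2_def psi_def
         weight_part_zero phi_zero if_distrib[of "weight_part 0"] if_distrib[of phi] cong: if_cong del: of_nat_Suc)
    ultimately show ?thesis by (intro bexI[of _ x] exI[of _ "of_nat (Suc K)"]) (simp_all del: of_nat_Suc)
  next
    assume nK: "n = Suc K"
    define x where "x p = (if p = 0 then ?L else if p = 1 then ?M else 0)" for p :: nat
    have "hoch ?L + (?M - op_t ?M) = 0"
      using K(1) r by (simp add: hoch_Lw_0 op_t_Mw parity_def fscale_m1 single_uminus)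
    then have "x \<in> cycM n"
      using weight_chains_chains[OF M] weight_chains_chains[OF L] by (auto simp: cycM_def TotM_def dM_def x_def nK vertM_def horizontal_def bar_Mw op_N_zero op_t_zero
         hoch_zero bar_zero)
    moreover have "weight_part (evenwt n) ?L = ?L" "weight_part 0 ?L = 0" "weight_part 0 ?M = 0"
      using weight_part_id[OF L] weight_part_other[OF L, of 0] weight_part_other[OF M, of 0] K(3) by simp_all
    moreover obtain u :: 'k where u: "u \<noteq> 0" "phi (head_part (op_N ?L)) = fscale u (sg r)"
      using phi_N_Lw[OF r] by blast
    ultimately have "x \<in> cycM n" "Psi1 n x = fscale u (sg r)" "Psi2 n x = 0"
      using r by (simp_all add: Psi1_def x_def lin_scale[OF lin_lin_ext] oddp_def Psi2_def psi_def
         weight_part_zero phi_zero if_distrib[of "weight_part 0"] if_distrib[of phi] cong: if_cong)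
    then show ?thesis using u(1) by blast
  qed
  then obtain x and u :: 'k where x: "x \<in> cycM n" "u \<noteq> 0" "Psi1 n x = fscale u (sg r)" "Psi2 n x = 0" by blast
  then show ?thesis
    by (intro bexI[of _ "\<lambda>p. fscale (1 / u) (x p)"]) (simp_all add: Psi_scale cycM_scale fscale_single)
qed

theorem monomial_surj:
  fixes g :: "int \<Rightarrow>\<^sub>0 'k::field_char_0"
  assumes n: "n > 0" and g: "g \<in> free_vs.span {sg r | r. odd r}"
  shows "\<exists>x\<in>cycM n. Psi1 n x = g \<and> Psi2 n x = c"
proof -
  have "\<exists>x\<in>cycM n. Psi1 n x = g \<and> Psi2 n x = 0"
    using g
  proof (induction rule: free_vs.span_induct_alt)
    case base
    have "Psi1 n (\<lambda>p. 0 :: 'k chain) = 0" "Psi2 n (\<lambda>p. 0 :: 'k chain) = 0"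
      using Psi_scale[of n 0 "\<lambda>p. 0"] by simp_all
    then show ?case using cycM_zero by blast
  next
    case (step a f h)
    then obtain r y where "odd r" "f = sg r" "y \<in> cycM n" "Psi1 n y = h" "Psi2 n y = 0" by blast
    moreover obtain x where "x \<in> cycM n" "Psi1 n x = (sg r :: int \<Rightarrow>\<^sub>0 'k)" "Psi2 n x = 0"
      using monomial_odd_cycle[OF n \<open>odd r\<close>] by blast
    ultimately show ?case
      by (intro bexI[of _ "\<lambda>p. fscale a (x p) + y p"]) (simp_all add: Psi_add Psi_scale cycM_add cycM_scale)
  qed
  then obtain x where x: "x \<in> cycM n" "Psi1 n x = g" "Psi2 n x = 0" by blast
  obtain m where m: "n = Suc m" using n by (cases n) auto
  obtain y :: "nat \<Rightarrow> 'k chain" where y: "y \<in> cycM n" "\<forall>p\<le>n. y p \<in> head_chains 0 0 (n - p)" "psi n y = 1"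
    using weight_0_cycle[of m, where 'k = 'k] m by blast
  have y0: "y p \<in> weight_chains 0 (n - p)" if "p \<le> n" for p using y(2) that by (simp add: weight_chains_0)
  have "evenwt n \<noteq> 0" using m by (simp add: evenwt_def)
  then have "weight_part (evenwt n) (y 0) = 0" using y0[of 0] by (intro weight_part_other) auto
  then have "Psi1 n y = 0"
    by (simp add: Psi1_def op_N_zero head_part_zero phi_zero oddp_zero)
  moreover have "weight_part 0 (y p) = y p" for p
    using weight_part_id[OF y0] y(1) by (cases "p \<le> n") (auto simp: cycM_def TotM_def weight_part_zero)
  then have "Psi2 n y = 1" using y(3) by (simp add: Psi2_def)
  ultimately show ?thesis
    using x y(1) by (intro bexI[of _ "\<lambda>p. x p + fscale c (y p)"]) (simp_all add: Psi_add Psi_scale cycM_add cycM_scale)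
qed

theorem monomial_surj_0:
  fixes g :: "int \<Rightarrow>\<^sub>0 'k::field"
  shows "\<exists>x\<in>cycM 0. phi (weight_part 0 (x 0)) = g"
proof -
  define f where "f = (lin_ext (\<lambda>r. sg [(0, r)]) g :: 'k chain)"
  have "f \<in> chains 0"
    unfolding f_def by (rule lin_in_subspace[OF lin_lin_ext subspace_chains]) (simp add: chains_def supp_single)
  moreover have "phi (weight_part 0 f) = g"
    unfolding f_def
    by (rule lin_eqI[where f = g and G = "\<lambda>f. f" and F = "\<lambda>g. phi (weight_part 0 (lin_ext (\<lambda>r. sg [(0, r)]) g))"])
      ((intro lin_intros)+, simp add: weight_part_sg wt_def phi_sg)
  ultimately show ?thesis
    by (intro bexI[of _ "\<lambda>p. if p = 0 then f else 0"]) (auto simp: cycM_def TotM_def dM_def)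
qed

section \<open>Coordinates on the Pareigis algebra\<close>

text \<open>Left multiplication by the generators on the space that the monomials are to span. That it respects
  the relations makes the monomials linearly independent in the algebra.\<close>

primrec act_gen :: "pareigis_gen \<Rightarrow> (letter \<Rightarrow>\<^sub>0 'k::field) \<Rightarrow> (letter \<Rightarrow>\<^sub>0 'k)" where
  "act_gen Gen_s = lin_ext (\<lambda>a. if fst a = 0 then sg (1, snd a) else 0)"
| "act_gen Gen_t = lin_ext (\<lambda>a. Poly_Mapping.single (fst a, snd a + 1) (parity (int (fst a))))"
| "act_gen Gen_tinv = lin_ext (\<lambda>a. Poly_Mapping.single (fst a, snd a - 1) (parity (int (fst a))))"

lemma lin_act_gen: "lin (act_gen g)"
  by (cases g) (simp_all add: lin_lin_ext)

definition act_word :: "pareigis_gen fword \<Rightarrow> (letter \<Rightarrow>\<^sub>0 'k::field) \<Rightarrow> (letter \<Rightarrow>\<^sub>0 'k)" where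
  "act_word w m = foldr act_gen (letters w) m"

lemma lin_act_word: "lin (act_word w)"
proof -
  have "lin (\<lambda>m. foldr act_gen l m)" for l
    by (induction l) (auto intro: lin_ident lin_comp lin_act_gen)
  then show ?thesis by (simp add: act_word_def[abs_def])
qed

definition act :: "(pareigis_gen fword \<Rightarrow>\<^sub>0 'k::field) \<Rightarrow> (letter \<Rightarrow>\<^sub>0 'k) \<Rightarrow> (letter \<Rightarrow>\<^sub>0 'k)" where
  "act f m = lin_ext (\<lambda>w. act_word w m) f"

lemma lin_act_left: "lin (\<lambda>f. act f m)"
  by (simp add: act_def[abs_def] lin_lin_ext)

lemma lin_act: "lin (act f)"
  unfolding act_def[abs_def] lin_ext_def
  by (intro lin_Sum lin_fscale lin_act_word)

lemma act_sg: "act (sg w) m = act_word w m"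
  by (simp add: act_def)

lemma lin_mult_right: "lin (\<lambda>f :: 'x fword \<Rightarrow>\<^sub>0 'k::field. f * g)"
  and lin_mult_left: "lin (\<lambda>f :: 'x fword \<Rightarrow>\<^sub>0 'k::field. g * f)"
proof -
  show "lin (\<lambda>f :: 'x fword \<Rightarrow>\<^sub>0 'k::field. f * g)"
    by (rule linI) (simp_all add: distrib_right fscale_mult_left)
  show "lin (\<lambda>f :: 'x fword \<Rightarrow>\<^sub>0 'k::field. g * f)"
    by (rule linI) (simp_all add: distrib_left flip: fscale_mult_right)
qed

lemma act_mult: "act (f * g) m = act f (act g m)"
proof (rule lin_eqI[where f = f and F = "\<lambda>f. act (f * g) m" and G = "\<lambda>f. act f (act g m)"])
  show "lin (\<lambda>f. act (f * g) m)" by (rule lin_comp[OF lin_act_left lin_mult_right])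
  show "lin (\<lambda>f. act f (act g m))" by (rule lin_act_left)
  fix u
  show "act (sg u * g) m = act (sg u) (act g m)"
  proof (rule lin_eqI[where f = g and F = "\<lambda>g. act (sg u * g) m" and G = "\<lambda>g. act (sg u) (act g m)"])
    show "lin (\<lambda>g. act (sg u * g) m)" by (rule lin_comp[OF lin_act_left lin_mult_left])
    show "lin (\<lambda>g. act (sg u) (act g m))" by (rule lin_comp[OF lin_act lin_act_left])
    show "act (sg u * sg v) m = act (sg u) (act (sg v) m)" for v
      by (simp add: mult_single act_sg act_word_def plus_fword_def)
  qed
qed

lemma act_one: "act 1 m = m"
  using act_sg[of 0 m] by (simp add: act_word_def) (simp add: zero_fword_def)

lemma act_fgen: "act (fgen g) m = act_gen g m"
  by (simp add: fgen_def act_sg act_word_def)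

lemma act_gen_inverse: "act_gen Gen_t (act_gen Gen_tinv m) = m" "act_gen Gen_tinv (act_gen Gen_t m) = m"
  and act_gen_s_s: "act_gen Gen_s (act_gen Gen_s m) = 0"
  and act_gen_s_t: "act_gen Gen_s (act_gen Gen_t m) + act_gen Gen_t (act_gen Gen_s m) = 0"
proof -
  show "act_gen Gen_t (act_gen Gen_tinv m) = m"
    by (rule lin_eqI[where f = m and G = "\<lambda>m. m", OF lin_comp[OF lin_act_gen lin_act_gen] lin_ident]) (simp add: fscale_single)
  show "act_gen Gen_tinv (act_gen Gen_t m) = m"
    by (rule lin_eqI[where f = m and G = "\<lambda>m. m", OF lin_comp[OF lin_act_gen lin_act_gen] lin_ident]) (simp add: fscale_single)
  show "act_gen Gen_s (act_gen Gen_s m) = 0"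
    by (rule lin_eq_0I[where f = m, OF lin_comp[OF lin_act_gen lin_act_gen]]) (simp add: lin_0[OF lin_lin_ext])
  show "act_gen Gen_s (act_gen Gen_t m) + act_gen Gen_t (act_gen Gen_s m) = 0"
    by (rule lin_eq_0I[where f = m, OF lin_plus[OF lin_comp[OF lin_act_gen lin_act_gen] lin_comp[OF lin_act_gen lin_act_gen]]])
      (auto simp: lin_0[OF lin_lin_ext] fscale_single parity_def single_uminus)
qed

lemmas act_left_add = lin_add[OF lin_act_left]
  and act_left_diff = lin_diff[OF lin_act_left]
  and act_left_scale = lin_scale[OF lin_act_left]
  and act_left_zero = lin_0[OF lin_act_left]

lemmas act_add = lin_add[OF lin_act]
  and act_scale = lin_scale[OF lin_act]
  and act_zero = lin_0[OF lin_act]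

lemma act_ideal: "f \<in> pareigis_ideal \<Longrightarrow> act f m = 0"
proof -
  let ?K = "{f :: pareigis_gen fword \<Rightarrow>\<^sub>0 'a. \<forall>m. act f m = 0}"
  have "two_sided_ideal ?K"
    by (simp add: two_sided_ideal_def act_left_add act_left_zero act_mult act_zero)
  moreover have "pareigis_relators \<subseteq> ?K"
    by (simp add: pareigis_relators_def act_left_add act_left_diff act_mult act_one act_fgen
      act_gen_inverse act_gen_s_s act_gen_s_t del: act_gen.simps)
  ultimately have "pareigis_ideal \<subseteq> ?K"
    unfolding pareigis_ideal_def by (rule hull_minimal[rotated])
  moreover assume "f \<in> pareigis_ideal"
  ultimately show ?thesis by blast
qed

lift_definition pact :: "'k::field pareigis \<Rightarrow> (letter \<Rightarrow>\<^sub>0 'k) \<Rightarrow> (letter \<Rightarrow>\<^sub>0 'k)" is act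
proof -
  fix f g :: "pareigis_gen fword \<Rightarrow>\<^sub>0 'k"
  assume "pareigis_rel f g"
  then have "act (f - g) m = 0" for m
    unfolding pareigis_rel_def by (rule act_ideal)
  then show "act f = act g"
    by (auto simp: act_left_diff fun_eq_iff)
qed

definition coord :: "'k::field pareigis \<Rightarrow> (letter \<Rightarrow>\<^sub>0 'k)" where
  "coord a = pact a (sg (0, 0))"

lemma pact_add: "pact (a + b) m = pact a m + pact b m"
  and pact_scale: "pact (pareigis_scale c a) m = fscale c (pact a m)"
  and pact_mult: "pact (a * b) m = pact a (pact b m)"
  by (transfer; simp add: act_left_add act_left_scale act_mult)+

lemma lin_pact: "lin (pact a)"
  by (rule linI; transfer; simp add: act_add act_scale)

lemma coord_add: "coord (a + b) = coord a + coord b"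
  and coord_scale: "coord (pareigis_scale c a) = fscale c (coord a)"
  and coord_mult': "coord (a * b) = pact a (coord b)"
  by (simp_all add: coord_def pact_add pact_scale pact_mult)

definition gen :: "pareigis_gen \<Rightarrow> 'k::field pareigis" where
  "gen g = abs_pareigis (fgen g)"

lemma pact_gen: "pact (gen g) m = act_gen g m"
  by (simp add: gen_def pact.abs_eq act_fgen)

lemma abs_eqI: "f - g \<in> pareigis_ideal \<Longrightarrow> abs_pareigis f = abs_pareigis g"
  by (simp add: pareigis.abs_eq_iff pareigis_rel_def)

lemma relator_in_ideal: "f \<in> pareigis_relators \<Longrightarrow> f \<in> pareigis_ideal"
  unfolding pareigis_ideal_def by (rule hull_inc)

lemma gen_relations:
  "gen Gen_t * gen Gen_tinv = (1 :: 'k::field pareigis)"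
  "gen Gen_tinv * gen Gen_t = (1 :: 'k pareigis)"
  "gen Gen_s * gen Gen_s = (0 :: 'k pareigis)"
  "gen Gen_t * gen Gen_s = (- (gen Gen_s * gen Gen_t) :: 'k pareigis)"
proof -
  show "gen Gen_t * gen Gen_tinv = (1 :: 'k pareigis)" "gen Gen_tinv * gen Gen_t = (1 :: 'k pareigis)"
    "gen Gen_s * gen Gen_s = (0 :: 'k pareigis)" "gen Gen_t * gen Gen_s = (- (gen Gen_s * gen Gen_t) :: 'k pareigis)"
    unfolding gen_def times_pareigis.abs_eq one_pareigis_def zero_pareigis_def uminus_pareigis.abs_eq
    by (rule abs_eqI, rule relator_in_ideal, simp add: pareigis_relators_def add.commute)+
qed

lemma gen_tinv_s: "gen Gen_tinv * gen Gen_s = (- (gen Gen_s * gen Gen_tinv) :: 'k::field pareigis)"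
proof -
  let ?t = "gen Gen_t :: 'k pareigis" and ?u = "gen Gen_tinv :: 'k pareigis" and ?s = "gen Gen_s :: 'k pareigis"
  have "?u * ?s = ?u * (?s * ?t) * ?u"
    using gen_relations(1)[where 'k = 'k] by (simp add: mult.assoc)
  also have "?s * ?t = - (?t * ?s)"
    using gen_relations(4)[where 'k = 'k] by simp
  also have "?u * (- (?t * ?s)) * ?u = - ((?u * ?t) * (?s * ?u))"
    by (simp add: mult.assoc)
  finally show ?thesis by (simp add: gen_relations(2))
qed

definition tpow :: "int \<Rightarrow> 'k::field pareigis" where
  "tpow x = (if x \<ge> 0 then gen Gen_t ^ nat x else gen Gen_tinv ^ nat (- x))"

lemma tpow_0: "tpow 0 = 1"
  by (simp add: tpow_def)

lemma gen_t_tpow: "gen Gen_t * tpow x = (tpow (x + 1) :: 'k::field pareigis)"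
proof (cases "x \<ge> 0")
  case True
  then show ?thesis by (simp add: tpow_def nat_add_distrib)
next
  case False
  then have "nat (- x) = Suc (nat (- (x + 1)))" by simp
  then have "gen Gen_t * tpow x = (gen Gen_t * gen Gen_tinv) * (gen Gen_tinv ^ nat (- (x + 1)) :: 'k pareigis)"
    using False by (simp only: tpow_def power_Suc mult.assoc if_False)
  also have "\<dots> = tpow (x + 1)"
    using False by (simp only: gen_relations(1)) (auto simp: tpow_def)
  finally show ?thesis .
qed

lemma gen_tinv_tpow: "gen Gen_tinv * tpow x = (tpow (x - 1) :: 'k::field pareigis)"
proof -
  have "gen Gen_tinv * tpow x = gen Gen_tinv * (gen Gen_t * tpow (x - 1) :: 'k pareigis)"
    by (simp add: gen_t_tpow)
  then show ?thesis by (simp add: gen_relations(2) flip: mult.assoc)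
qed

definition elt :: "letter \<Rightarrow> 'k::field pareigis" where
  "elt a = gen Gen_s ^ fst a * tpow (snd a)"

text \<open>The detour through representatives lets the linear extension take place in the free algebra.\<close>

definition comb :: "(letter \<Rightarrow>\<^sub>0 'k::field) \<Rightarrow> 'k pareigis" where
  "comb m = abs_pareigis (lin_ext (\<lambda>a. rep_pareigis (elt a)) m)"

lemma abs_rep: "abs_pareigis (rep_pareigis a) = a"
  by (rule Quotient3_abs_rep[OF Quotient3_pareigis])

lemma comb_add: "comb (m + m') = comb m + comb m'"
  and comb_scale: "comb (fscale c m) = pareigis_scale c (comb m)"
  and comb_sg: "comb (sg a) = elt a"
  by (simp_all add: comb_def lin_add[OF lin_lin_ext] lin_scale[OF lin_lin_ext] plus_pareigis.abs_eq
     pareigis_scale.abs_eq abs_rep)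

lemma comb_0: "comb 0 = 0"
  using comb_add[of 0 0] by simp

interpretation P: vector_space pareigis_scale
  by (rule vector_space_pareigis_scale)

lemma pareigis_scale_simps [simp]: "pareigis_scale 1 a = a" "pareigis_scale (- 1) a = - a"
  "pareigis_scale c 0 = 0" "pareigis_scale c (- a) = - pareigis_scale c a"
  using P.scale_minus_left[of 1 a] by simp_all

lemma comb_single: "comb (Poly_Mapping.single a c) = pareigis_scale c (elt a)"
  using comb_scale[of c "sg a"] by (simp add: fscale_single comb_sg)

definition L1 :: "letter set" where
  "L1 = {a. fst a \<le> 1}"

lemma subspace_mem:
  assumes "free_vs.subspace S" "\<And>x. x \<in> Poly_Mapping.keys f \<Longrightarrow> sg x \<in> S"
  shows "f \<in> S"
  using lin_in_subspace[OF lin_ident assms(1), of f] assms(2) by simp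

lemma act_gen_L1: "m \<in> supp L1 \<Longrightarrow> act_gen g m \<in> supp L1"
proof (erule supp_lin_ext[OF _ lin_act_gen])
  show "act_gen g (sg a) \<in> (supp L1 :: (letter \<Rightarrow>\<^sub>0 'a) set)" if "a \<in> L1" for a
    using that by (cases g) (auto simp: L1_def intro!: supp_single)
qed

lemmas act_gen_add = lin_add[OF lin_act_gen]
  and act_gen_scale = lin_scale[OF lin_act_gen]
  and act_gen_zero = lin_0[OF lin_act_gen]

lemma comb_act_gen:
  fixes m :: "letter \<Rightarrow>\<^sub>0 'k::field"
  assumes m: "m \<in> supp L1"
  shows "comb (act_gen g m) = gen g * comb m"
proof -
  have "m \<in> {m :: letter \<Rightarrow>\<^sub>0 'k. comb (act_gen g m) = gen g * comb m}"
  proof (rule subspace_mem)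
    show "free_vs.subspace {m :: letter \<Rightarrow>\<^sub>0 'k. comb (act_gen g m) = gen g * comb m}"
      by (auto simp: free_vs.subspace_def act_gen_zero act_gen_add act_gen_scale
        comb_0 comb_add comb_scale distrib_left pareigis_scale_mult(2))
    fix a assume "a \<in> Poly_Mapping.keys m"
    then have "fst a \<le> 1" using m by (auto simp: supp_def L1_def)
    then obtain j x where a: "a = (j, x)" "j = 0 \<or> j = 1" by (cases a) (fastforce simp: le_Suc_eq)
    have "gen Gen_s * (gen Gen_s * y) = 0" for y :: "'k pareigis"
      by (simp add: gen_relations(3) flip: mult.assoc)
    moreover have "gen Gen_t * (gen Gen_s * y) = - (gen Gen_s * (gen Gen_t * y))" for y :: "'k pareigis"
      by (simp add: gen_relations(4) flip: mult.assoc)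
    moreover have "gen Gen_tinv * (gen Gen_s * y) = - (gen Gen_s * (gen Gen_tinv * y))" for y :: "'k pareigis"
      by (simp add: gen_tinv_s flip: mult.assoc)
    ultimately show "sg a \<in> {m :: letter \<Rightarrow>\<^sub>0 'k. comb (act_gen g m) = gen g * comb m}"
      using a(2) by (cases g) (auto simp: a(1) comb_sg comb_single comb_0 elt_def gen_t_tpow gen_tinv_tpow parity_def)
  qed
  then show ?thesis by simp
qed

text \<open>The elements that are recovered from their coordinates contain 1 and are stable under left
  multiplication by generators.\<close>

lemma coord_L1_comb: "coord a \<in> supp L1 \<and> comb (coord a) = a"
proof -
  define S where "S = {f :: pareigis_gen fword \<Rightarrow>\<^sub>0 'a. coord (abs_pareigis f) \<in> supp L1 \<and> comb (coord (abs_pareigis f)) = abs_pareigis f}"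
  have z: "abs_pareigis 0 = (0 :: 'a pareigis)" by (simp add: zero_pareigis_def)
  have cz: "coord 0 = (0 :: letter \<Rightarrow>\<^sub>0 'a)" using coord_add[of 0 "0 :: 'a pareigis"] by simp
  have S: "free_vs.subspace S"
    unfolding free_vs.subspace_def S_def
    by (auto simp: z cz comb_0 plus_pareigis.abs_eq[symmetric] pareigis_scale.abs_eq[symmetric] coord_add coord_scale
       comb_add comb_scale supp_add supp_scale)
  have one: "coord (1 :: 'a pareigis) = sg (0, 0)"
    unfolding coord_def by (transfer, simp add: act_one)
  have sgS: "sg (FWord l) \<in> S" for l
  proof (induction l)
    case Nil
    have "abs_pareigis (sg (FWord [])) = (1 :: 'a pareigis)"
      using single_one[where 'a = "pareigis_gen fword" and 'b = 'a] by (simp add: one_pareigis_def zero_fword_def)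
    then show ?case
      by (simp add: S_def one comb_sg elt_def tpow_0 L1_def supp_single)
  next
    case (Cons g l)
    have "sg (FWord (g # l)) = (fgen g * sg (FWord l) :: pareigis_gen fword \<Rightarrow>\<^sub>0 'a)"
      by (simp add: fgen_def mult_single plus_fword_def)
    then have "abs_pareigis (sg (FWord (g # l))) = (gen g * abs_pareigis (sg (FWord l)) :: 'a pareigis)"
      by (simp add: gen_def times_pareigis.abs_eq)
    then show ?case
      using Cons.IH by (simp add: S_def coord_mult' pact_gen act_gen_L1 comb_act_gen)
  qed
  have "rep_pareigis a \<in> S"
    by (rule subspace_mem[OF S]) (metis fword.exhaust sgS)
  then show ?thesis by (simp add: S_def abs_rep)
qed

lemmas coord_L1 = coord_L1_comb[THEN conjunct1] and comb_coord = coord_L1_comb[THEN conjunct2]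

text \<open>The product of the algebra in coordinates.\<close>

definition mulM :: "(letter \<Rightarrow>\<^sub>0 'k::field) \<Rightarrow> (letter \<Rightarrow>\<^sub>0 'k) \<Rightarrow> (letter \<Rightarrow>\<^sub>0 'k)" where
  "mulM p q = lin_ext (\<lambda>a. lin_ext (\<lambda>c. Poly_Mapping.single (a + c) (coef a c)) q) p"

lemma pact_tpow: "pact (tpow x) (sg c) = Poly_Mapping.single ((0, x) + c) (twist (0, x) c)"
proof -
  have t: "pact (gen Gen_t ^ n) (sg c) = Poly_Mapping.single ((0, int n) + c) (twist (0, int n) c :: 'a)" for n
  proof (induction n)
    case 0
    have "pact 1 m = m" for m :: "letter \<Rightarrow>\<^sub>0 'a" by (transfer, simp add: act_one)
    then show ?case by simp
  next
    case (Suc n)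
    have "snd c + int n + 1 = snd c + (1 + int n)" by simp
    moreover have "parity (int n * int (fst c)) * parity (int (fst c)) = (parity ((1 + int n) * int (fst c)) :: 'a)"
      by (auto simp: parity_def)
    ultimately show ?case using Suc
      by (cases c) (simp add: pact_mult pact_gen fscale_single twist_def add.commute add.left_commute)
  qed
  have u: "pact (gen Gen_tinv ^ n) (sg c) = Poly_Mapping.single ((0, - int n) + c) (twist (0, - int n) c :: 'a)" for n
  proof (induction n)
    case 0
    have "pact 1 m = m" for m :: "letter \<Rightarrow>\<^sub>0 'a" by (transfer, simp add: act_one)
    then show ?case by simp
  next
    case (Suc n)
    have "parity (- (int n * int (fst c))) * parity (int (fst c)) = (parity ((- 1 - int n) * int (fst c)) :: 'a)"
      by (auto simp: parity_def)
    then show ?case using Suc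
      by (cases c) (simp add: pact_mult pact_gen fscale_single twist_def add.commute, simp add: algebra_simps)
  qed
  show ?thesis
    using t[of "nat x"] u[of "nat (- x)"] by (simp add: tpow_def)
qed

lemma pact_elt: "fst a \<le> 1 \<Longrightarrow> pact (elt a) (sg c) = Poly_Mapping.single (a + c) (coef a c)"
proof -
  assume "fst a \<le> 1"
  then obtain j x where a: "a = (j, x)" "j = 0 \<or> j = 1" by (cases a) (fastforce simp: le_Suc_eq)
  have "pact (elt a) (sg c) = pact (gen Gen_s ^ j) (Poly_Mapping.single ((0, x) + c) (twist (0, x) c))"
    by (simp add: elt_def a pact_mult pact_tpow)
  moreover have "pact 1 m = m" for m :: "letter \<Rightarrow>\<^sub>0 'a" by (transfer, simp add: act_one)
  ultimately show ?thesis
    using a(2) by (cases c) (auto simp: a(1) pact_gen fscale_single coef_def twist_def)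
qed

lemma coord_elt: "fst a \<le> 1 \<Longrightarrow> coord (elt a) = sg a"
  by (simp add: coord_def pact_elt)

lemma pact_mulM: "pact a m = mulM (coord a) m"
proof -
  have "coord a \<in> {p. pact (comb p) m = mulM p m}"
  proof (rule subspace_mem)
    show "free_vs.subspace {p. pact (comb p) m = mulM p m}"
      unfolding free_vs.subspace_def mulM_def
      using pact_add[of 0 0 m] by (auto simp: lin_0[OF lin_lin_ext] lin_add[OF lin_lin_ext] lin_scale[OF lin_lin_ext] comb_0 comb_add comb_scale
        pact_add pact_scale)
    fix c assume "c \<in> Poly_Mapping.keys (coord a)"
    then have c: "fst c \<le> 1" using coord_L1[of a] by (auto simp: supp_def L1_def)
    have "pact (elt c) m = lin_ext (\<lambda>d. Poly_Mapping.single (c + d) (coef c d)) m"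
      by (rule lin_eqI[OF lin_pact lin_lin_ext]) (simp only: pact_elt[OF c] lin_ext_single fscale_1)
    then show "sg c \<in> {p. pact (comb p) m = mulM p m}"
      by (simp add: comb_sg mulM_def)
  qed
  then show ?thesis by (simp add: comb_coord)
qed

lemma coord_mult: "coord (a * b) = mulM (coord a) (coord b)"
  by (simp add: coord_mult' pact_mulM)

section \<open>Tensor powers in coordinates\<close>

text \<open>The tensor product with a first factor, given by its coordinates.\<close>

definition ten :: "(letter \<Rightarrow>\<^sub>0 'k::field) \<Rightarrow> 'k chain \<Rightarrow> 'k chain" where
  "ten p f = lin_ext (\<lambda>a. cons a f) p"

definition ten_end :: "(letter \<Rightarrow>\<^sub>0 'k::field) \<Rightarrow> 'k chain \<Rightarrow> 'k chain" where
  "ten_end p f = lin_ext (\<lambda>a. snoc a f) p"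

definition lmul_lin :: "(letter \<Rightarrow>\<^sub>0 'k::field) \<Rightarrow> 'k chain \<Rightarrow> 'k chain" where
  "lmul_lin p f = lin_ext (\<lambda>a. lmul a f) p"

lemma lin_lin_ext_param: "(\<And>a. lin (h a)) \<Longrightarrow> lin (\<lambda>f. lin_ext (\<lambda>a. h a f) p)"
  unfolding lin_ext_def by (intro lin_Sum lin_fscale)

lemma lin_ten: "lin (\<lambda>p. ten p f)" "lin (ten p)"
  and lin_ten_end: "lin (\<lambda>p. ten_end p f)" "lin (ten_end p)"
  and lin_lmul_lin: "lin (\<lambda>p. lmul_lin p f)" "lin (lmul_lin p)"
  unfolding ten_def[abs_def] ten_end_def[abs_def] lmul_lin_def[abs_def]
  by (intro lin_lin_ext lin_lin_ext_param lin_ops)+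

lemma lin_mulM: "lin (\<lambda>p. mulM p q)" "lin (mulM p)"
  unfolding mulM_def[abs_def]
  by (intro lin_lin_ext lin_lin_ext_param)+

lemma ten_sg: "ten (sg a) f = cons a f" and ten_end_sg: "ten_end (sg a) f = snoc a f"
  and lmul_lin_sg: "lmul_lin (sg a) f = lmul a f"
  by (simp_all add: ten_def ten_end_def lmul_lin_def)

lemma mulM_sg: "mulM (sg a) (sg c) = Poly_Mapping.single (a + c) (coef a c)"
  by (simp add: mulM_def)

lemma bar_ten: "bar (ten p f) = lmul_lin p f - ten p (bar f)"
  by (rule lin_eqI[where f = p and F = "\<lambda>p. bar (ten p f)" and G = "\<lambda>p. lmul_lin p f - ten p (bar f)"])
    (intro lin_comp[OF lin_ops(4)] lin_ten lin_lmul_lin lin_minus | simp add: ten_sg lmul_lin_sg bar_cons)+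

lemma lmul_lin_ten: "lmul_lin p (ten q f) = ten (mulM p q) f"
proof (rule lin_eqI[where f = p and F = "\<lambda>p. lmul_lin p (ten q f)" and G = "\<lambda>p. ten (mulM p q) f"])
  show "lmul_lin (sg a) (ten q f) = ten (mulM (sg a) q) f" for a
  proof (rule lin_eqI[where f = q and F = "\<lambda>q. lmul_lin (sg a) (ten q f)" and G = "\<lambda>q. ten (mulM (sg a) q) f"])
    show "lmul_lin (sg a) (ten (sg c) f) = ten (mulM (sg a) (sg c)) f" for c
      by (simp add: lmul_lin_sg ten_sg mulM_sg cons_lmul) (simp add: ten_def)
  qed (intro lin_comp[OF lin_lmul_lin(2)] lin_comp[OF lin_ten(1)] lin_mulM lin_ten)+
qed (intro lin_lmul_lin lin_comp[OF lin_ten(1)] lin_mulM)+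

lemma ten_ten_end: "ten p (ten_end q f) = ten_end q (ten p f)"
proof (rule lin_eqI[where f = p and F = "\<lambda>p. ten p (ten_end q f)" and G = "\<lambda>p. ten_end q (ten p f)"])
  show "ten (sg a) (ten_end q f) = ten_end q (ten (sg a) f)" for a
    by (rule lin_eqI[where f = q and F = "\<lambda>q. ten (sg a) (ten_end q f)" and G = "\<lambda>q. ten_end q (ten (sg a) f)"])
      (intro lin_comp[OF lin_ten(2)] lin_ten_end | simp add: ten_sg ten_end_sg cons_snoc)+
qed (intro lin_comp[OF lin_ten_end(2)] lin_ten lin_comp[OF lin_ten(1)])+

lemma wrap_ten_end: "f \<in> supp {w. w \<noteq> []} \<Longrightarrow> wrap (ten_end q f) = lmul_lin q f"
  by (rule lin_eqI[where f = q and F = "\<lambda>q. wrap (ten_end q f)" and G = "\<lambda>q. lmul_lin q f"])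
    (intro lin_comp[OF lin_ops(5)] lin_ten_end lin_lmul_lin | simp add: ten_end_sg lmul_lin_sg wrap_snoc')+

lemma op_t_ten_end:
  assumes "f \<in> supp (Len n)"
  shows "op_t (ten_end q f) = fscale ((- 1) ^ n) (ten q f)"
proof (rule lin_eqI[where f = q and F = "\<lambda>q. op_t (ten_end q f)" and G = "\<lambda>q. fscale ((- 1) ^ n) (ten q f)"])
  show "op_t (ten_end (sg a) f) = fscale ((- 1) ^ n) (ten (sg a) f)" for a
    unfolding ten_sg ten_end_sg
    by (rule lin_eq_on_supp[OF assms, where F = "\<lambda>f. op_t (snoc a f)" and G = "\<lambda>f. fscale ((- 1) ^ n) (cons a f)"])
      (intro lin_intros | auto simp: op_t_snoc)+
qed (intro lin_comp[OF lin_ops(7)] lin_ten_end lin_ten lin_fscale)+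

primrec coords :: "'k::field pareigis list \<Rightarrow> 'k chain" where
  "coords [] = sg []"
| "coords (a # w) = ten (coord a) (coords w)"

text \<open>Expansion of tensors in the basis of words; it is defined before multilinearity is divided out.\<close>

definition to_chain :: "('k::field pareigis list \<Rightarrow>\<^sub>0 'k) \<Rightarrow> 'k chain" where
  "to_chain = lin_ext coords"

definition of_chain :: "'k::field chain \<Rightarrow> ('k pareigis list \<Rightarrow>\<^sub>0 'k)" where
  "of_chain = lin_ext (\<lambda>w. sg (map elt w))"

lemma lin_to_chain: "lin to_chain" and lin_of_chain: "lin of_chain"
  by (simp_all add: to_chain_def of_chain_def lin_lin_ext)

lemma to_chain_sg: "to_chain (sg w) = coords w" and of_chain_sg: "of_chain (sg v) = sg (map elt v)"
  by (simp_all add: to_chain_def of_chain_def)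

lemma coords_snoc: "coords (w @ [y]) = ten_end (coord y) (coords w)"
proof (induction w)
  case Nil
  have "ten (coord y) (sg []) = ten_end (coord y) (sg [])"
    by (simp add: ten_def ten_end_def)
  then show ?case by simp
qed (simp add: ten_ten_end)

definition LW :: "nat \<Rightarrow> letter list set" where
  "LW n = {w. length w = n \<and> list_all (\<lambda>a. fst a \<le> 1) w}"

lemma chains_LW: "chains n = supp (LW (Suc n))"
  by (simp add: chains_def LW_def)

lemma coords_LW: "coords w \<in> supp (LW (length w))"
proof (induction w)
  case (Cons a w)
  have "cons c (coords w) \<in> supp (LW (Suc (length w)))" if "c \<in> L1" for c
    using that Cons.IH by (rule_tac supp_lin_ext[OF _ lin_ops(1)]) (auto simp: LW_def L1_def intro!: supp_single)
  then have "ten (coord a) (coords w) \<in> supp (LW (Suc (length w)))"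
    using coord_L1[of a] by (rule_tac supp_lin_ext[OF _ lin_ten(1)]) (simp_all add: ten_sg)
  then show ?case by simp
qed (simp add: LW_def supp_single)

lemma to_chain_LW: "f \<in> supp (Len n) \<Longrightarrow> to_chain f \<in> supp (LW n)"
  by (erule supp_lin_ext[OF _ lin_to_chain]) (use coords_LW in \<open>force simp: to_chain_sg\<close>)

lemma of_chain_Len: "g \<in> supp (LW n) \<Longrightarrow> of_chain g \<in> supp (Len n)"
  by (erule supp_lin_ext[OF _ lin_of_chain]) (simp add: of_chain_sg supp_single LW_def)

lemma to_chain_of_chain: "g \<in> supp (LW n) \<Longrightarrow> to_chain (of_chain g) = g"
proof (erule lin_eq_on_supp[where F = "\<lambda>g. to_chain (of_chain g)" and G = "\<lambda>g. g"])
  fix w assume w: "w \<in> LW n"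
  have "list_all (\<lambda>a. fst a \<le> 1) w \<Longrightarrow> coords (map elt w) = (sg w :: 'a chain)"
    by (induction w) (simp_all add: coord_elt ten_sg)
  with w show "to_chain (of_chain (sg w)) = (sg w :: 'a chain)" by (simp add: to_chain_sg of_chain_sg LW_def)
qed (intro lin_comp[OF lin_to_chain] lin_of_chain lin_ident)+

subsection \<open>Multilinearity relations\<close>

abbreviation null :: "nat \<Rightarrow> ('k::field pareigis list \<Rightarrow>\<^sub>0 'k) set" where
  "null \<equiv> tensor_null pareigis_scale"

lemma subspace_null: "free_vs.subspace (null n)"
  by (simp add: tensor_null_def)

lemma lin_span:
  assumes "lin F" "\<And>x. x \<in> A \<Longrightarrow> F x \<in> V" "free_vs.subspace V" "f \<in> free_vs.span A"
  shows "F f \<in> V"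
  using assms(4)
proof (induction rule: free_vs.span_induct_alt)
  case base
  then show ?case by (simp add: lin_0[OF assms(1)] free_vs.subspace_0[OF assms(3)])
next
  case (step c x y)
  then show ?case
    by (simp add: lin_add[OF assms(1)] lin_scale[OF assms(1)] free_vs.subspace_add[OF assms(3)]
      free_vs.subspace_scale[OF assms(3)] assms(2))
qed

lemma coords_add: "coords (us @ (x + y) # vs) = coords (us @ x # vs) + coords (us @ y # vs)"
  and coords_scale: "coords (us @ pareigis_scale c x # vs) = fscale c (coords (us @ x # vs))"
  by (induction us) (simp_all add: coord_add coord_scale lin_add[OF lin_ten(1)] lin_scale[OF lin_ten(1)]
    lin_add[OF lin_ten(2)] lin_scale[OF lin_ten(2)])

lemmas to_chain_add = lin_add[OF lin_to_chain]
  and to_chain_diff = lin_diff[OF lin_to_chain]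
  and to_chain_scale = lin_scale[OF lin_to_chain]
  and to_chain_sum = lin_sum[OF lin_to_chain]
  and to_chain_uminus = lin_uminus[OF lin_to_chain]
  and to_chain_zero = lin_0[OF lin_to_chain]

lemma to_chain_null: "f \<in> null n \<Longrightarrow> to_chain f = 0"
proof -
  assume f: "f \<in> null n"
  have "to_chain f \<in> {0}"
    using lin_to_chain _ free_vs.subspace_single_0 f[unfolded tensor_null_def]
  proof (rule lin_span)
    show "to_chain x \<in> {0}" if "x \<in> tensor_relators pareigis_scale n" for x :: "'a pareigis list \<Rightarrow>\<^sub>0 'a"
      using that by (auto simp: tensor_relators_def to_chain_diff to_chain_scale to_chain_sg coords_add coords_scale)
  qed
  then show ?thesis by simp
qed

lemma null_Len: "f \<in> null n \<Longrightarrow> f \<in> supp (Len n)"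
  unfolding tensor_null_def
  by (rule lin_span[OF lin_ident _ subspace_supp])
    (auto simp: tensor_relators_def intro!: supp_diff supp_scale supp_single)

lemma cons_null: "f \<in> null n \<Longrightarrow> cons a f \<in> null (Suc n)"
  unfolding tensor_null_def[of _ n]
proof (rule lin_span[OF lin_ops(1) _ subspace_null])
  fix x assume "x \<in> tensor_relators (pareigis_scale :: 'a \<Rightarrow> _) n"
  then consider (add) us u v vs where
      "x = sg (us @ (u + v) # vs) - sg (us @ u # vs) - sg (us @ v # vs)" "length us + 1 + length vs = n"
    | (scale) us c u vs where
      "x = sg (us @ pareigis_scale c u # vs) - fscale c (sg (us @ u # vs))" "length us + 1 + length vs = n"
    unfolding tensor_relators_def by blast
  then show "cons a x \<in> null (Suc n)"
  proof cases
    case add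
    have "cons a x = sg ((a # us) @ (u + v) # vs) - sg ((a # us) @ u # vs) - sg ((a # us) @ v # vs)"
      by (simp add: add(1) cons_diff)
    moreover have "length (a # us) + 1 + length vs = Suc n" using add(2) by simp
    ultimately have "cons a x \<in> tensor_relators pareigis_scale (Suc n)"
      unfolding tensor_relators_def by blast
    then show ?thesis unfolding tensor_null_def by (rule free_vs.span_base)
  next
    case scale
    have "cons a x = sg ((a # us) @ pareigis_scale c u # vs) - fscale c (sg ((a # us) @ u # vs))"
      by (simp add: scale(1) cons_diff cons_scale)
    moreover have "length (a # us) + 1 + length vs = Suc n" using scale(2) by simp
    ultimately have "cons a x \<in> tensor_relators pareigis_scale (Suc n)"
      unfolding tensor_relators_def by blast
    then show ?thesis unfolding tensor_null_def by (rule free_vs.span_base)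
  qed
qed

lemmas null_0 = free_vs.subspace_0[OF subspace_null]
  and null_add = free_vs.subspace_add[OF subspace_null]
  and null_diff = free_vs.subspace_diff[OF subspace_null]
  and null_scale = free_vs.subspace_scale[OF subspace_null]

lemma cons_add_null:
  assumes "h \<in> supp (Len n)"
  shows "cons (a + b) h - cons a h - cons b h \<in> null (Suc n)"
proof (rule lin_maps_supp[OF assms, where F = "\<lambda>h. cons (a + b) h - cons a h - cons b h"])
  fix w :: "'a pareigis list" assume "w \<in> Len n"
  then have "length ([] :: 'a pareigis list) + 1 + length w = Suc n" by simp
  moreover have "cons (a + b) (sg w) - cons a (sg w) - cons b (sg w) = (sg ([] @ (a + b) # w) - sg ([] @ a # w) - sg ([] @ b # w) :: _ \<Rightarrow>\<^sub>0 'a)"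
    by simp
  ultimately have "cons (a + b) (sg w) - cons a (sg w) - cons b (sg w) \<in> tensor_relators (pareigis_scale :: 'a \<Rightarrow> _) (Suc n)"
    unfolding tensor_relators_def by blast
  then show "cons (a + b) (sg w) - cons a (sg w) - cons b (sg w) \<in> (null (Suc n) :: ('a pareigis list \<Rightarrow>\<^sub>0 'a) set)"
    unfolding tensor_null_def by (rule free_vs.span_base)
qed (intro lin_intros subspace_null)+

lemma cons_scale_null:
  assumes "h \<in> supp (Len n)"
  shows "cons (pareigis_scale c a) h - fscale c (cons a h) \<in> null (Suc n)"
proof (rule lin_maps_supp[OF assms, where F = "\<lambda>h. cons (pareigis_scale c a) h - fscale c (cons a h)"])
  fix w :: "'a pareigis list" assume "w \<in> Len n"
  then have "length ([] :: 'a pareigis list) + 1 + length w = Suc n" by simp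
  moreover have "cons (pareigis_scale c a) (sg w) - fscale c (cons a (sg w)) = (sg ([] @ pareigis_scale c a # w) - fscale c (sg ([] @ a # w)) :: _ \<Rightarrow>\<^sub>0 'a)"
    by simp
  ultimately have "cons (pareigis_scale c a) (sg w) - fscale c (cons a (sg w)) \<in> tensor_relators (pareigis_scale :: 'a \<Rightarrow> _) (Suc n)"
    unfolding tensor_relators_def by blast
  then show "cons (pareigis_scale c a) (sg w) - fscale c (cons a (sg w)) \<in> (null (Suc n) :: ('a pareigis list \<Rightarrow>\<^sub>0 'a) set)"
    unfolding tensor_null_def by (rule free_vs.span_base)
qed (intro lin_intros subspace_null)+

lemma cons_comb_null:
  fixes h :: "'k::field pareigis list \<Rightarrow>\<^sub>0 'k"
  assumes h: "h \<in> supp (Len n)"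
  shows "cons (comb p) h - lin_ext (\<lambda>a. cons (elt a) h) p \<in> null (Suc n)"
proof -
  define G where "G p = lin_ext (\<lambda>a. cons (elt a) h) p" for p :: "letter \<Rightarrow>\<^sub>0 'k"
  have G: "lin G" by (simp add: G_def[abs_def] lin_lin_ext)
  let ?S = "{p. cons (comb p) h - G p \<in> null (Suc n)}"
  have "p \<in> ?S"
  proof (rule subspace_mem)
    show "free_vs.subspace ?S"
      unfolding free_vs.subspace_def
    proof (safe intro!: ballI)
      have "cons (pareigis_scale 0 0) h - fscale 0 (cons (0 :: 'k pareigis) h) \<in> null (Suc n)"
        by (rule cons_scale_null[OF h])
      then show "cons (comb 0) h - G 0 \<in> null (Suc n)"
        by (simp add: comb_0 lin_0[OF G])
    next
      fix p q assume "cons (comb p) h - G p \<in> null (Suc n)" "cons (comb q) h - G q \<in> null (Suc n)"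
      then have "(cons (comb p + comb q) h - cons (comb p) h - cons (comb q) h) + ((cons (comb p) h - G p) + (cons (comb q) h - G q)) \<in> null (Suc n)"
        by (intro null_add cons_add_null[OF h])
      then show "cons (comb (p + q)) h - G (p + q) \<in> null (Suc n)"
        by (simp add: comb_add lin_add[OF G] algebra_simps)
    next
      fix c p assume "cons (comb p) h - G p \<in> null (Suc n)"
      then have "(cons (pareigis_scale c (comb p)) h - fscale c (cons (comb p) h)) + fscale c (cons (comb p) h - G p) \<in> null (Suc n)"
        by (intro null_add null_scale cons_scale_null[OF h])
      then show "cons (comb (fscale c p)) h - G (fscale c p) \<in> null (Suc n)"
        by (simp add: comb_scale lin_scale[OF G] free_vs.scale_right_diff_distrib)
    qed
    show "sg a \<in> ?S" for a
      by (simp add: comb_sg G_def null_0)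
  qed
  then show ?thesis by (simp add: G_def)
qed

lemma of_chain_ten: "of_chain (ten p f) = lin_ext (\<lambda>a. cons (elt a) (of_chain f)) p"
proof (rule lin_eqI[where f = p and F = "\<lambda>p. of_chain (ten p f)"])
  show "of_chain (ten (sg a) f) = lin_ext (\<lambda>a. cons (elt a) (of_chain f)) (sg a)" for a
  proof -
    have "of_chain (cons a f) = cons (elt a) (of_chain f)"
      by (rule lin_eqI[where f = f, OF lin_comp[OF lin_of_chain lin_ops(1)] lin_comp[OF lin_ops(1) lin_of_chain]])
        (simp add: of_chain_sg)
    then show ?thesis by (simp add: ten_sg)
  qed
qed (intro lin_comp[OF lin_of_chain] lin_ten lin_lin_ext)+

text \<open>Expanding the factors of a tensor one after the other changes it by multilinearity relations only. So
  \<open>to_chain\<close> has no more in its kernel than these relations.\<close>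

lemma of_chain_to_chain_single: "sg w - of_chain (coords w) \<in> null (length w)"
proof (induction w)
  case Nil
  show ?case by (simp add: of_chain_sg null_0)
next
  case (Cons a w)
  have "of_chain (coords w) \<in> supp (Len (length w))"
    by (rule of_chain_Len[OF coords_LW])
  then have "cons (comb (coord a)) (of_chain (coords w)) - of_chain (ten (coord a) (coords w)) \<in> null (Suc (length w))"
    unfolding of_chain_ten by (rule cons_comb_null)
  moreover have "cons a (sg w - of_chain (coords w)) \<in> null (Suc (length w))"
    by (rule cons_null[OF Cons.IH])
  ultimately have "cons a (sg w - of_chain (coords w)) + (cons a (of_chain (coords w)) - of_chain (ten (coord a) (coords w))) \<in> null (Suc (length w))"
    by (simp add: comb_coord null_add)
  then show ?case by (simp add: cons_diff)
qed

lemma of_chain_to_chain: "f \<in> supp (Len n) \<Longrightarrow> f - of_chain (to_chain f) \<in> null n"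
proof (erule lin_maps_supp[where F = "\<lambda>f. f - of_chain (to_chain f)"])
  show "sg w - of_chain (to_chain (sg w)) \<in> null n" if "w \<in> Len n" for w :: "'a pareigis list"
    using of_chain_to_chain_single[of w] that by (simp add: to_chain_sg)
qed (intro lin_minus lin_ident lin_comp[OF lin_of_chain lin_to_chain] subspace_null)+

lemmas of_chain_zero = lin_0[OF lin_of_chain]

lemma null_iff: "f \<in> supp (Len n) \<Longrightarrow> f \<in> null n \<longleftrightarrow> to_chain f = 0"
  using of_chain_to_chain[of f n] to_chain_null[of f n] by (auto simp: of_chain_zero)

subsection \<open>The operators in coordinates\<close>

lemma lin_bb: "lin op_b'" "lin op_b"
  by (simp_all add: op_b'_def op_b_def lin_lin_ext)

lemma op_b'_Cons: "op_b' (sg (a # b # w)) = sg ((a * b) # w) - cons a (op_b' (sg (b # w)) :: 'a::ring_1 list \<Rightarrow>\<^sub>0 'k::field)"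
proof -
  have "op_b' (sg (a # b # w)) = (\<Sum>i<Suc (length w). Poly_Mapping.single (face i (a # b # w)) ((- 1) ^ i) :: _ \<Rightarrow>\<^sub>0 'k)"
    by (simp add: op_b'_def)
  also have "\<dots> = sg ((a * b) # w) + (\<Sum>i<length w. Poly_Mapping.single (a # face i (b # w)) (- ((- 1) ^ i)))"
    by (subst sum.lessThan_Suc_shift) (simp add: face_def)
  also have "(\<Sum>i<length w. Poly_Mapping.single (a # face i (b # w)) (- ((- 1) ^ i))) = - cons a (op_b' (sg (b # w)) :: _ \<Rightarrow>\<^sub>0 'k)"
    by (simp add: op_b'_def cons_sum single_uminus sum_negf)
  finally show ?thesis by simp
qed

lemma op_b'_short: "op_b' (sg []) = 0" "op_b' (sg [a]) = 0"
  by (simp_all add: op_b'_def)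

lemma to_chain_cons: "to_chain (cons a f) = ten (coord a) (to_chain f)"
  by (rule lin_eqI[where f = f, OF lin_comp[OF lin_to_chain lin_ops(1)] lin_comp[OF lin_ten(2) lin_to_chain]]) (simp add: to_chain_sg)

lemma to_chain_op_b'_single: "to_chain (op_b' (sg w)) = bar (coords w)"
proof (induction w)
  case Nil
  then show ?case by (simp add: op_b'_short to_chain_zero bar_Nil)
next
  case (Cons a w)
  show ?case
  proof (cases w)
    case Nil
    have "lmul_lin (coord a) (sg []) = (0 :: 'a chain)"
      by (rule lin_eq_0I[OF lin_lmul_lin(1)]) (simp add: lmul_lin_sg lmul_Nil)
    then show ?thesis
      by (simp add: Nil op_b'_short to_chain_zero bar_ten bar_Nil lin_0[OF lin_ten(2)])
  next
    case w: (Cons b v)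
    have "to_chain (op_b' (sg (a # w))) = ten (coord (a * b)) (coords v) - ten (coord a) (to_chain (op_b' (sg w)))"
      unfolding w op_b'_Cons by (simp add: to_chain_diff to_chain_cons to_chain_sg)
    also have "\<dots> = lmul_lin (coord a) (coords w) - ten (coord a) (bar (coords w))"
      by (simp add: Cons.IH) (simp add: w coord_mult lmul_lin_ten)
    finally show ?thesis by (simp add: bar_ten)
  qed
qed

lemma to_chain_op_b': "to_chain (op_b' f) = bar (to_chain f)"
  by (rule lin_eqI[where f = f, OF lin_comp[OF lin_to_chain lin_bb(1)] lin_comp[OF lin_ops(4) lin_to_chain]])
    (simp add: to_chain_op_b'_single to_chain_sg)

lemma coords_Len: "coords w \<in> supp (Len (length w))"
  by (rule supp_mono[OF coords_LW]) (auto simp: LW_def)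

lemma to_chain_op_b: "f \<in> supp {w. length w \<ge> 2} \<Longrightarrow> to_chain (op_b f) = hoch (to_chain f)"
proof (erule lin_eq_on_supp[where F = "\<lambda>f. to_chain (op_b f)" and G = "\<lambda>f. hoch (to_chain f)"])
  fix w :: "'a pareigis list" assume w: "w \<in> {w. length w \<ge> 2}"
  then obtain u y where u: "w = u @ [y]"
    by (cases w rule: rev_cases) auto
  with w have "u \<noteq> []" by auto
  then obtain a v where v: "u = a # v" by (cases u) auto
  have "op_b (sg w) = op_b' (sg w) + fscale ((- 1) ^ length u) (sg ((y * a) # v) :: _ \<Rightarrow>\<^sub>0 'a)"
    by (simp add: op_b_def op_b'_def last_face_def u v fscale_single)
  then have "to_chain (op_b (sg w)) = bar (coords w) + fscale ((- 1) ^ length u) (coords ((y * a) # v))"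
    by (simp add: to_chain_add to_chain_scale to_chain_op_b'_single to_chain_sg)
  moreover have "coords u \<in> supp {w. w \<noteq> []}"
    using \<open>u \<noteq> []\<close> by (intro supp_mono[OF coords_Len]) auto
  then have "wrap (coords w) = lmul_lin (coord y) (coords u)"
    unfolding u coords_snoc by (rule wrap_ten_end)
  then have "wrap (coords w) = coords ((y * a) # v)"
    by (simp add: v coord_mult lmul_lin_ten)
  moreover have "hoch (coords w) = bar (coords w) + fscale ((- 1) ^ length u) (wrap (coords w))"
    using coords_Len[of w] by (intro hoch_Len) (simp add: u)
  ultimately show "to_chain (op_b (sg w)) = hoch (to_chain (sg w))"
    by (simp add: to_chain_sg)
qed (intro lin_comp[OF lin_to_chain] lin_comp[OF lin_ops(6)] lin_bb lin_to_chain)+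

lemma to_chain_op_t: "f \<in> supp {w. w \<noteq> []} \<Longrightarrow> to_chain (op_t f) = op_t (to_chain f)"
proof (erule lin_eq_on_supp[where F = "\<lambda>f. to_chain (op_t f)" and G = "\<lambda>f. op_t (to_chain f)"])
  fix w :: "'a pareigis list" assume "w \<in> {w. w \<noteq> []}"
  then obtain u y where u: "w = u @ [y]" by (cases w rule: rev_cases) auto
  show "to_chain (op_t (sg w)) = op_t (to_chain (sg w))"
    unfolding u op_t_snoc to_chain_scale to_chain_sg coords_snoc op_t_ten_end[OF coords_Len] by simp
qed (intro lin_comp[OF lin_to_chain] lin_comp[OF lin_ops(7)] lin_ops lin_to_chain)+

lemma to_chain_op_N: "f \<in> supp (Len (Suc n)) \<Longrightarrow> to_chain (op_N f) = op_N (to_chain f)"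
proof -
  assume f: "f \<in> supp (Len (Suc n))"
  have "to_chain ((op_t ^^ i) f) = (op_t ^^ i) (to_chain f) \<and> (op_t ^^ i) f \<in> supp (Len (Suc n))" for i
  proof (induction i)
    case (Suc i)
    then have "(op_t ^^ i) f \<in> supp {w. w \<noteq> []}" by (auto elim!: supp_mono)
    then show ?case using Suc by (simp add: to_chain_op_t op_t_Len)
  qed (simp add: f)
  moreover have "to_chain f \<in> supp (Len (Suc n))"
    using to_chain_LW[OF f] by (rule supp_mono) (auto simp: LW_def)
  ultimately show ?thesis
    by (simp add: op_N_Len[OF f] op_N_Len[of "to_chain f" "Suc n"] to_chain_sum del: sum.lessThan_Suc)
qed

lemma face_length: "Suc i < length w \<Longrightarrow> length (face i w) = length w - 1"
  by (simp add: face_def)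

lemma op_b'_Len: "f \<in> supp (Len (Suc n)) \<Longrightarrow> op_b' f \<in> supp (Len n)"
  by (erule supp_lin_ext[OF _ lin_bb(1)]) (auto simp: op_b'_def face_length intro!: supp_sum supp_single)

lemma op_b_Len: "f \<in> supp (Len (Suc (Suc n))) \<Longrightarrow> op_b f \<in> supp (Len (Suc n))"
  by (erule supp_lin_ext[OF _ lin_bb(2)])
    (auto simp: op_b_def face_length last_face_def intro!: supp_add supp_sum supp_scale supp_single)

lemma lin_vertical: "lin (vertical p)"
  unfolding vertical_def[abs_def] by (cases "even p"; simp; intro lin_neg lin_bb)

lemma vertical_Len: "f \<in> supp (Len (Suc (Suc n))) \<Longrightarrow> vertical p f \<in> supp (Len (Suc n))"
  by (simp add: vertical_def op_b_Len op_b'_Len supp_neg)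

lemma horizontal_Len: "f \<in> supp (Len (Suc n)) \<Longrightarrow> horizontal p f \<in> supp (Len (Suc n))"
  by (simp add: horizontal_def op_t_Len op_N_Len' supp_diff)

lemma to_chain_vertical: "f \<in> supp (Len (Suc (Suc n))) \<Longrightarrow> to_chain (vertical p f) = vertM p (to_chain f)"
proof -
  assume f: "f \<in> supp (Len (Suc (Suc n)))"
  then have "f \<in> supp {w. length w \<ge> 2}" by (auto elim!: supp_mono)
  then show ?thesis by (simp add: vertical_def vertM_def to_chain_op_b to_chain_op_b' to_chain_uminus)
qed

lemma to_chain_horizontal: "f \<in> supp (Len (Suc n)) \<Longrightarrow> to_chain (horizontal p f) = horizontal p (to_chain f)"
proof -
  assume f: "f \<in> supp (Len (Suc n))"
  then have "f \<in> supp {w. w \<noteq> []}" by (auto elim!: supp_mono)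
  then show ?thesis using f by (simp add: horizontal_def to_chain_op_N to_chain_op_t to_chain_diff)
qed

section \<open>The total complex in coordinates\<close>

text \<open>The fibres of \<open>\<phi>\<close> are the cosets of \<open>W\<close>, so \<open>\<phi>\<close> can be evaluated on any representative of a
  coset.\<close>

lemma quotient_vspace_iso:
  assumes closed: "\<And>x y. x \<in> vcarrier V \<Longrightarrow> y \<in> vcarrier V \<Longrightarrow> vadd V x y \<in> vcarrier V"
      "\<And>c x. x \<in> vcarrier V \<Longrightarrow> vsmult V c x \<in> vcarrier V"
    and W: "W \<subseteq> vcarrier V" "W \<noteq> {}"
    and add: "\<And>x y. x \<in> vcarrier V \<Longrightarrow> y \<in> vcarrier V \<Longrightarrow> \<phi> (vadd V x y) = vadd U (\<phi> x) (\<phi> y)"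
    and smult: "\<And>c x. x \<in> vcarrier V \<Longrightarrow> \<phi> (vsmult V c x) = vsmult U c (\<phi> x)"
    and kill: "\<And>x w. x \<in> vcarrier V \<Longrightarrow> w \<in> W \<Longrightarrow> \<phi> (vadd V x w) = \<phi> x"
    and inj: "\<And>x y. x \<in> vcarrier V \<Longrightarrow> y \<in> vcarrier V \<Longrightarrow> \<phi> x = \<phi> y \<Longrightarrow> \<exists>w\<in>W. y = vadd V x w"
    and surj: "\<phi> ` vcarrier V = vcarrier U"
  shows "vspace_iso (quotient_vspace V W) U"
proof -
  define cl where "cl x = {vadd V x w | w. w \<in> W}" for x
  define F where "F X = \<phi> (SOME x. x \<in> X)" for X
  have cl: "cl x = {y \<in> vcarrier V. \<phi> y = \<phi> x}" if x: "x \<in> vcarrier V" for x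
  proof (intro equalityI subsetI)
    fix y assume "y \<in> cl x"
    then show "y \<in> {y \<in> vcarrier V. \<phi> y = \<phi> x}"
      using x W(1) closed(1) kill by (auto simp: cl_def)
  next
    fix y assume "y \<in> {y \<in> vcarrier V. \<phi> y = \<phi> x}"
    then show "y \<in> cl x"
      using inj[OF x, of y] by (auto simp: cl_def)
  qed
  have carrier: "vcarrier (quotient_vspace V W) = cl ` vcarrier V"
    by (auto simp: quotient_vspace_def cl_def)
  have F_const: "F X = u" if "X \<noteq> {}" "\<And>x. x \<in> X \<Longrightarrow> \<phi> x = u" for X u
    unfolding F_def using that by (metis some_in_eq)
  have F_cl: "F (cl x) = \<phi> x" if "x \<in> vcarrier V" for x
    by (rule F_const) (use cl[OF that] that in auto)
  have "bij_betw F (vcarrier (quotient_vspace V W)) (vcarrier U)"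
    unfolding bij_betw_def
  proof
    show "inj_on F (vcarrier (quotient_vspace V W))"
    proof (rule inj_onI, unfold carrier)
      fix X Y assume "X \<in> cl ` vcarrier V" "Y \<in> cl ` vcarrier V" and eq: "F X = F Y"
      then obtain x y where xy: "x \<in> vcarrier V" "y \<in> vcarrier V" "X = cl x" "Y = cl y" by blast
      then have "\<phi> x = \<phi> y" using eq by (simp add: F_cl)
      then show "X = Y" using xy by (simp add: cl)
    qed
    show "F ` vcarrier (quotient_vspace V W) = vcarrier U"
      unfolding carrier image_image surj[symmetric] by (intro image_cong refl F_cl)
  qed
  moreover have "F (vadd (quotient_vspace V W) X Y) = vadd U (F X) (F Y)"
    if XY: "X \<in> vcarrier (quotient_vspace V W)" "Y \<in> vcarrier (quotient_vspace V W)" for X Y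
  proof -
    obtain x y where xy: "x \<in> vcarrier V" "y \<in> vcarrier V" "X = cl x" "Y = cl y"
      using XY unfolding carrier by blast
    have "x \<in> X" "y \<in> Y" using xy by (simp_all add: cl)
    then have "vadd (quotient_vspace V W) X Y \<noteq> {}"
      by (auto simp: quotient_vspace_def)
    then have "F (vadd (quotient_vspace V W) X Y) = vadd U (\<phi> x) (\<phi> y)"
      by (rule F_const) (auto simp: quotient_vspace_def xy cl add)
    then show ?thesis by (simp add: xy F_cl)
  qed
  moreover have "F (vsmult (quotient_vspace V W) c X) = vsmult U c (F X)"
    if X: "X \<in> vcarrier (quotient_vspace V W)" for c X
  proof -
    obtain x where x: "x \<in> vcarrier V" "X = cl x"
      using X unfolding carrier by blast
    have "x \<in> X" using x by (simp add: cl)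
    then have "vsmult (quotient_vspace V W) c X \<noteq> {}"
      using W(2) by (auto simp: quotient_vspace_def)
    then have "F (vsmult (quotient_vspace V W) c X) = vsmult U c (\<phi> x)"
      by (rule F_const) (auto simp: quotient_vspace_def x cl smult closed(2) kill)
    then show ?thesis by (simp add: x F_cl)
  qed
  ultimately show ?thesis unfolding vspace_iso_def by blast
qed

abbreviation TP :: "nat \<Rightarrow> ('k::field, ('k pareigis list \<Rightarrow>\<^sub>0 'k) set) vspace" where
  "TP \<equiv> tensor_power pareigis_scale"

definition coset :: "nat \<Rightarrow> ('k::field pareigis list \<Rightarrow>\<^sub>0 'k) \<Rightarrow> ('k pareigis list \<Rightarrow>\<^sub>0 'k) set" where
  "coset n f = {f + w | w. w \<in> null n}"

lemma supp_Len_eq: "{f. \<forall>as\<in>Poly_Mapping.keys f. length as = n} = supp (Len n)"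
  by (auto simp: supp_def)

lemma TP_carrier: "vcarrier (TP n) = coset n ` supp (Len n)"
  unfolding tensor_power_def quotient_vspace_def sub_vspace_def supp_Len_eq coset_def by auto

lemma coset_iff: "g \<in> coset n f \<longleftrightarrow> g - f \<in> null n"
  unfolding coset_def by (auto simp: algebra_simps) (metis add_diff_cancel_left' diff_add_cancel add.commute)

lemma coset_self: "f \<in> coset n f"
  by (simp add: coset_iff null_0)

lemma coset_eqI: "f - g \<in> null n \<Longrightarrow> coset n f = coset n g"
proof -
  assume "f - g \<in> null n"
  then have "h - f \<in> null n \<longleftrightarrow> h - g \<in> null n" for h
    using null_add[of "h - f" n "f - g"] null_diff[of "h - g" n "f - g"] by auto
  then show ?thesis by (auto simp: coset_iff)
qed

lemma coset_eq_iff: "f \<in> supp (Len n) \<Longrightarrow> g \<in> supp (Len n) \<Longrightarrow> coset n f = coset n g \<longleftrightarrow> to_chain f = to_chain g"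
proof
  assume fg: "f \<in> supp (Len n)" "g \<in> supp (Len n)"
  show "to_chain f = to_chain g" if "coset n f = coset n g"
    using coset_self[of f n] to_chain_null[of "f - g" n] that by (simp add: coset_iff to_chain_diff)
  show "coset n f = coset n g" if "to_chain f = to_chain g"
    using null_iff[of "f - g" n] fg that by (intro coset_eqI) (simp add: supp_diff to_chain_diff)
qed

lemma TP_add: "vadd (TP n) (coset n f) (coset n g) = coset n (f + g)"
proof -
  have "vadd (TP n) (coset n f) (coset n g) = {x + y | x y. x \<in> coset n f \<and> y \<in> coset n g}"
    by (simp add: tensor_power_def quotient_vspace_def sub_vspace_def)
  also have "\<dots> = coset n (f + g)"
  proof (intro equalityI subsetI)
    fix z assume "z \<in> {x + y | x y. x \<in> coset n f \<and> y \<in> coset n g}"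
    then obtain x y where "z = x + y" "x - f \<in> null n" "y - g \<in> null n" by (auto simp: coset_iff)
    then show "z \<in> coset n (f + g)"
      using null_add[of "x - f" n "y - g"] by (simp add: coset_iff algebra_simps)
  next
    fix z assume "z \<in> coset n (f + g)"
    then have "z = (z - g) + g" "z - g \<in> coset n f" by (simp_all add: coset_iff algebra_simps)
    then show "z \<in> {x + y | x y. x \<in> coset n f \<and> y \<in> coset n g}" using coset_self by blast
  qed
  finally show ?thesis .
qed

lemma TP_scale: "vsmult (TP n) c (coset n f) = coset n (fscale c f)"
proof -
  have "vsmult (TP n) c (coset n f) = {fscale c x + w | x w. x \<in> coset n f \<and> w \<in> null n}"
    by (simp add: tensor_power_def quotient_vspace_def sub_vspace_def)
  also have "\<dots> = coset n (fscale c f)"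
  proof (intro equalityI subsetI)
    fix z assume "z \<in> {fscale c x + w | x w. x \<in> coset n f \<and> w \<in> null n}"
    then obtain x w where "z = fscale c x + w" "x - f \<in> null n" "w \<in> null n" by (auto simp: coset_iff)
    then show "z \<in> coset n (fscale c f)"
      using null_add[OF null_scale[of "x - f" n c]] by (simp add: coset_iff free_vs.scale_right_diff_distrib algebra_simps)
  next
    fix z assume "z \<in> coset n (fscale c f)"
    then have "z = fscale c f + (z - fscale c f)" "z - fscale c f \<in> null n" by (simp_all add: coset_iff)
    then show "z \<in> {fscale c x + w | x w. x \<in> coset n f \<and> w \<in> null n}" using coset_self by blast
  qed
  finally show ?thesis .
qed

lemma TP_zero: "vzero (TP n) = coset n 0"
  by (auto simp: tensor_power_def quotient_vspace_def coset_iff)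

lemma induced_coset:
  assumes "lin F" "\<And>w. w \<in> null n \<Longrightarrow> F w \<in> null n'"
  shows "induced pareigis_scale n' F (coset n f) = coset n' (F f)"
proof (intro equalityI subsetI)
  fix z assume "z \<in> induced pareigis_scale n' F (coset n f)"
  then obtain x r where "z = F x + r" "x - f \<in> null n" "r \<in> null n'"
    by (auto simp: induced_def coset_iff)
  then show "z \<in> coset n' (F f)"
    using null_add[OF assms(2)[of "x - f"], of r] by (simp add: coset_iff lin_diff[OF assms(1)] algebra_simps)
next
  fix z assume "z \<in> coset n' (F f)"
  then have "z = F f + (z - F f)" "z - F f \<in> null n'" by (simp_all add: coset_iff)
  then show "z \<in> induced pareigis_scale n' F (coset n f)"
    unfolding induced_def using coset_self by blast
qed

lemma induced_vertical: 
  "induced pareigis_scale (Suc n) (vertical p) (coset (Suc (Suc n)) f) = coset (Suc n) (vertical p f)"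
proof (rule induced_coset[OF lin_vertical])
  fix w :: "'a pareigis list \<Rightarrow>\<^sub>0 'a" assume w: "w \<in> null (Suc (Suc n))"
  note wL = null_Len[OF w]
  show "vertical p w \<in> null (Suc n)"
    using null_iff[OF vertical_Len[OF wL]] to_chain_vertical[OF wL] to_chain_null[OF w]
    by (simp add: vertM_zero)
qed

lemma induced_horizontal: 
  "induced pareigis_scale (Suc n) (horizontal p) (coset (Suc n) f) = coset (Suc n) (horizontal p f)"
proof (rule induced_coset[OF lin_horizontal])
  fix w :: "'a pareigis list \<Rightarrow>\<^sub>0 'a" assume w: "w \<in> null (Suc n)"
  note wL = null_Len[OF w]
  show "horizontal p w \<in> null (Suc n)"
    using null_iff[OF horizontal_Len[OF wL]] to_chain_horizontal[OF wL] to_chain_null[OF w]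
    by (simp add: horizontal_zero)
qed

definition ev :: "('k::field pareigis list \<Rightarrow>\<^sub>0 'k) set \<Rightarrow> 'k chain" where
  "ev X = to_chain (SOME f. f \<in> X)"

lemma ev_coset: "ev (coset n f) = to_chain f"
proof -
  have "(SOME g. g \<in> coset n f) \<in> coset n f"
    using coset_self by (rule someI)
  then show ?thesis
    unfolding ev_def using to_chain_null[of "_ - f" n] by (fastforce simp: coset_iff to_chain_diff)
qed

abbreviation TotP :: "nat \<Rightarrow> (nat \<Rightarrow> ('k::field pareigis list \<Rightarrow>\<^sub>0 'k) set) set" where
  "TotP n \<equiv> vcarrier (Tot pareigis_scale n)"

lemma TotP_iff: "X \<in> TotP n \<longleftrightarrow> X \<in> (\<Pi>\<^sub>E p\<in>{..n}. coset (Suc (n - p)) ` supp (Len (Suc (n - p))))"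
  by (simp add: Tot_def Sum_vspace_def TP_carrier)

text \<open>The passage from cosets of tensors to chains of words.\<close>

definition Theta :: "nat \<Rightarrow> (nat \<Rightarrow> ('k::field pareigis list \<Rightarrow>\<^sub>0 'k) set) \<Rightarrow> nat \<Rightarrow> 'k chain" where
  "Theta n X = (\<lambda>p. if p \<le> n then ev (X p) else 0)"

lemma TotP_reps:
  assumes "X \<in> TotP n"
  obtains f where "\<And>p. p \<le> n \<Longrightarrow> f p \<in> supp (Len (Suc (n - p)))" "\<And>p. p \<le> n \<Longrightarrow> X p = coset (Suc (n - p)) (f p)"
    "\<And>p. p \<le> n \<Longrightarrow> Theta n X p = to_chain (f p)"
proof -
  have "\<forall>p\<in>{..n}. \<exists>f. f \<in> supp (Len (Suc (n - p))) \<and> X p = coset (Suc (n - p)) f"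
    using assms unfolding TotP_iff PiE_iff by blast
  then obtain f where "\<forall>p\<in>{..n}. f p \<in> supp (Len (Suc (n - p))) \<and> X p = coset (Suc (n - p)) (f p)"
    by (rule bchoice[THEN exE])
  then show ?thesis by (intro that[of f]) (simp_all add: Theta_def ev_coset)
qed

lemma Theta_TotM: "X \<in> TotP n \<Longrightarrow> Theta n X \<in> TotM n"
proof -
  assume "X \<in> TotP n"
  then obtain f where "\<And>p. p \<le> n \<Longrightarrow> f p \<in> supp (Len (Suc (n - p)))" "\<And>p. p \<le> n \<Longrightarrow> Theta n X p = to_chain (f p)"
    by (rule TotP_reps) blast
  then show ?thesis by (auto simp: TotM_def chains_LW to_chain_LW) (simp add: Theta_def)
qed

lemma Theta_inj:
  assumes X: "X \<in> TotP n" and Y: "Y \<in> TotP n" and eq: "Theta n X = Theta n Y"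
  shows "X = Y"
proof -
  obtain f where f: "\<And>p. p \<le> n \<Longrightarrow> f p \<in> supp (Len (Suc (n - p)))" "\<And>p. p \<le> n \<Longrightarrow> X p = coset (Suc (n - p)) (f p)"
    "\<And>p. p \<le> n \<Longrightarrow> Theta n X p = to_chain (f p)" using X by (rule TotP_reps) blast
  obtain g where g: "\<And>p. p \<le> n \<Longrightarrow> g p \<in> supp (Len (Suc (n - p)))" "\<And>p. p \<le> n \<Longrightarrow> Y p = coset (Suc (n - p)) (g p)"
    "\<And>p. p \<le> n \<Longrightarrow> Theta n Y p = to_chain (g p)" using Y by (rule TotP_reps) blast
  show ?thesis
  proof (rule PiE_ext[OF X[unfolded TotP_iff] Y[unfolded TotP_iff]])
    fix p assume "p \<in> {..n}"
    then have p: "p \<le> n" by simp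
    have "to_chain (f p) = to_chain (g p)" using f(3)[OF p] g(3)[OF p] eq by simp
    then show "X p = Y p"
      using coset_eq_iff[OF f(1)[OF p] g(1)[OF p]] f(2)[OF p] g(2)[OF p] by simp
  qed
qed

lemma Theta_surj:
  assumes x: "x \<in> TotM n"
  obtains X where "X \<in> TotP n" "Theta n X = x"
proof -
  let ?X = "\<lambda>p\<in>{..n}. coset (Suc (n - p)) (of_chain (x p))"
  have L: "x p \<in> supp (LW (Suc (n - p)))" if "p \<le> n" for p
    using x that by (simp add: TotM_def chains_LW)
  then have "?X \<in> TotP n"
    unfolding TotP_iff by (auto intro!: of_chain_Len)
  moreover have "Theta n ?X = x"
    using x by (auto simp: Theta_def ev_coset to_chain_of_chain[OF L] TotM_def fun_eq_iff)
  ultimately show ?thesis by (rule that)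
qed

lemma Tot_add:
  assumes X: "X \<in> TotP n" and Y: "Y \<in> TotP n"
  shows "vadd (Tot pareigis_scale n) X Y \<in> TotP n"
    "Theta n (vadd (Tot pareigis_scale n) X Y) = (\<lambda>p. Theta n X p + Theta n Y p)"
proof -
  obtain f where f: "\<And>p. p \<le> n \<Longrightarrow> f p \<in> supp (Len (Suc (n - p)))" "\<And>p. p \<le> n \<Longrightarrow> X p = coset (Suc (n - p)) (f p)"
    "\<And>p. p \<le> n \<Longrightarrow> Theta n X p = to_chain (f p)" using X by (rule TotP_reps) blast
  obtain g where g: "\<And>p. p \<le> n \<Longrightarrow> g p \<in> supp (Len (Suc (n - p)))" "\<And>p. p \<le> n \<Longrightarrow> Y p = coset (Suc (n - p)) (g p)"
    "\<And>p. p \<le> n \<Longrightarrow> Theta n Y p = to_chain (g p)" using Y by (rule TotP_reps) blast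
  have eq: "vadd (Tot pareigis_scale n) X Y = (\<lambda>p\<in>{..n}. coset (Suc (n - p)) (f p + g p))"
    by (auto simp: Tot_def Sum_vspace_def f(2) g(2) TP_add fun_eq_iff restrict_def)
  show "vadd (Tot pareigis_scale n) X Y \<in> TotP n"
    unfolding eq TotP_iff by (auto intro!: supp_add f g)
  show "Theta n (vadd (Tot pareigis_scale n) X Y) = (\<lambda>p. Theta n X p + Theta n Y p)"
    unfolding eq using f(3) g(3) by (auto simp: Theta_def ev_coset to_chain_add fun_eq_iff)
qed

lemma Tot_smult:
  assumes X: "X \<in> TotP n"
  shows "vsmult (Tot pareigis_scale n) c X \<in> TotP n"
    "Theta n (vsmult (Tot pareigis_scale n) c X) = (\<lambda>p. fscale c (Theta n X p))"
proof -
  obtain f where f: "\<And>p. p \<le> n \<Longrightarrow> f p \<in> supp (Len (Suc (n - p)))" "\<And>p. p \<le> n \<Longrightarrow> X p = coset (Suc (n - p)) (f p)"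
    "\<And>p. p \<le> n \<Longrightarrow> Theta n X p = to_chain (f p)" using X by (rule TotP_reps) blast
  have eq: "vsmult (Tot pareigis_scale n) c X = (\<lambda>p\<in>{..n}. coset (Suc (n - p)) (fscale c (f p)))"
    by (auto simp: Tot_def Sum_vspace_def f(2) TP_scale fun_eq_iff restrict_def)
  show "vsmult (Tot pareigis_scale n) c X \<in> TotP n"
    unfolding eq TotP_iff by (auto intro!: supp_scale f)
  show "Theta n (vsmult (Tot pareigis_scale n) c X) = (\<lambda>p. fscale c (Theta n X p))"
    unfolding eq using f(3) by (auto simp: Theta_def ev_coset to_chain_scale fun_eq_iff)
qed

lemma Tot_boundary_component:
  assumes X: "X \<in> TotP n" and p: "p < n"
  obtains g where "g \<in> supp (Len (n - p))" "Tot_boundary pareigis_scale n X p = coset (n - p) g"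
    "to_chain g = dM n (Theta n X) p"
proof -
  obtain f where f: "\<And>p. p \<le> n \<Longrightarrow> f p \<in> supp (Len (Suc (n - p)))" "\<And>p. p \<le> n \<Longrightarrow> X p = coset (Suc (n - p)) (f p)"
    "\<And>p. p \<le> n \<Longrightarrow> Theta n X p = to_chain (f p)" using X by (rule TotP_reps) blast
  obtain q where q: "n - p = Suc q" "n - Suc p = q" using p by (cases "n - p") auto
  have fp: "f p \<in> supp (Len (Suc (Suc q)))" "X p = coset (Suc (Suc q)) (f p)" "Theta n X p = to_chain (f p)"
    using f[of p] p q by simp_all
  have fp': "f (Suc p) \<in> supp (Len (Suc q))" "X (Suc p) = coset (Suc q) (f (Suc p))" "Theta n X (Suc p) = to_chain (f (Suc p))"
    using f[of "Suc p"] p q by simp_all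
  let ?g = "vertical p (f p) + horizontal (Suc p) (f (Suc p))"
  have "Tot_boundary pareigis_scale n X p = coset (n - p) ?g"
    using p by (simp add: Tot_boundary_def q fp(2) fp'(2) induced_vertical induced_horizontal TP_add)
  moreover have "?g \<in> supp (Len (n - p))"
    unfolding q by (intro supp_add vertical_Len horizontal_Len fp fp')
  moreover have "to_chain ?g = dM n (Theta n X) p"
    using p by (simp add: dM_def fp(3) fp'(3) to_chain_add to_chain_vertical[OF fp(1)] to_chain_horizontal[OF fp'(1)])
  ultimately show ?thesis by (intro that)
qed

lemma Tot_boundary_Theta:
  assumes X: "X \<in> TotP (Suc n)"
  shows "Tot_boundary pareigis_scale (Suc n) X \<in> TotP n"
    "Theta n (Tot_boundary pareigis_scale (Suc n) X) = dM (Suc n) (Theta (Suc n) X)"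
proof -
  have comp: "\<exists>g. g \<in> supp (Len (Suc (n - p))) \<and> Tot_boundary pareigis_scale (Suc n) X p = coset (Suc (n - p)) g
      \<and> to_chain g = dM (Suc n) (Theta (Suc n) X) p" if "p \<le> n" for p
    using Tot_boundary_component[OF X, of p] that by (metis Suc_diff_le le_imp_less_Suc)
  show "Tot_boundary pareigis_scale (Suc n) X \<in> TotP n"
    unfolding TotP_iff PiE_iff
  proof
    show "\<forall>p\<in>{..n}. Tot_boundary pareigis_scale (Suc n) X p \<in> coset (Suc (n - p)) ` supp (Len (Suc (n - p)))"
      using comp by blast
    show "Tot_boundary pareigis_scale (Suc n) X \<in> extensional {..n}"
      by (simp add: Tot_boundary_def lessThan_Suc_atMost)
  qed
  show "Theta n (Tot_boundary pareigis_scale (Suc n) X) = dM (Suc n) (Theta (Suc n) X)"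
  proof
    fix p
    show "Theta n (Tot_boundary pareigis_scale (Suc n) X) p = dM (Suc n) (Theta (Suc n) X) p"
    proof (cases "p \<le> n")
      case True
      then obtain g where "Tot_boundary pareigis_scale (Suc n) X p = coset (Suc (n - p)) g"
        "to_chain g = dM (Suc n) (Theta (Suc n) X) p" using comp by blast
      then show ?thesis using True by (simp add: Theta_def ev_coset)
    qed (simp add: Theta_def dM_def)
  qed
qed

lemma Tot_cycles_Theta: "Tot_cycles pareigis_scale n = {X \<in> TotP n. Theta n X \<in> cycM n}"
proof -
  have "Tot_boundary pareigis_scale n X p = vzero (TP (n - p)) \<longleftrightarrow> dM n (Theta n X) p = 0"
    if X: "X \<in> TotP n" and p: "p < n" for X :: "nat \<Rightarrow> ('a pareigis list \<Rightarrow>\<^sub>0 'a) set" and p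
  proof -
    obtain g where g: "g \<in> supp (Len (n - p))" "Tot_boundary pareigis_scale n X p = coset (n - p) g"
      "to_chain g = dM n (Theta n X) p"
      using Tot_boundary_component[OF X p] by blast
    then show ?thesis
      using coset_eq_iff[OF g(1), of 0] by (simp add: TP_zero to_chain_zero)
  qed
  moreover have "dM n x p = 0" if "\<not> p < n" for x :: "nat \<Rightarrow> 'a chain" and p
    using that by (simp add: dM_def)
  ultimately show ?thesis
    unfolding Tot_cycles_def cycM_def fun_eq_iff using Theta_TotM by blast
qed

text \<open>A linear map on the cycles of words whose fibres are the homology classes, combined with \<open>Theta\<close>, gives
  an isomorphism from cyclic homology onto its image.\<close>

lemma cyclic_homology_iso:
  fixes \<Psi> :: "(nat \<Rightarrow> 'k::field chain) \<Rightarrow> 'u" and U :: "('k, 'u) vspace"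
  assumes add: "\<And>x y. x \<in> cycM n \<Longrightarrow> y \<in> cycM n \<Longrightarrow> \<Psi> (\<lambda>p. x p + y p) = vadd U (\<Psi> x) (\<Psi> y)"
    and smult: "\<And>c x. x \<in> cycM n \<Longrightarrow> \<Psi> (\<lambda>p. fscale c (x p)) = vsmult U c (\<Psi> x)"
    and kill: "\<And>x w. x \<in> cycM n \<Longrightarrow> w \<in> bounds n \<Longrightarrow> \<Psi> (\<lambda>p. x p + w p) = \<Psi> x"
    and inj: "\<And>x y. x \<in> cycM n \<Longrightarrow> y \<in> cycM n \<Longrightarrow> \<Psi> x = \<Psi> y \<Longrightarrow> (\<lambda>p. y p + fscale (- 1) (x p)) \<in> bounds n"
    and surj: "\<Psi> ` cycM n = vcarrier U"
    and bc: "(bounds n :: (nat \<Rightarrow> 'k chain) set) \<subseteq> cycM n"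
  shows "vspace_iso (cyclic_homology (pareigis_scale :: 'k \<Rightarrow> _) n) U"
  unfolding cyclic_homology_def
proof (rule quotient_vspace_iso[where \<phi> = "\<lambda>X. \<Psi> (Theta n X)"])
  let ?V = "(Tot pareigis_scale n)\<lparr>vcarrier := Tot_cycles (pareigis_scale :: 'k \<Rightarrow> _) n\<rparr>"
  let ?W = "Tot_boundary (pareigis_scale :: 'k \<Rightarrow> _) (Suc n) ` TotP (Suc n)"
  have V: "vcarrier ?V = {X \<in> TotP n. Theta n X \<in> cycM n}" "vadd ?V = vadd (Tot pareigis_scale n)"
    "vsmult ?V = vsmult (Tot pareigis_scale n)"
    by (simp_all add: Tot_cycles_Theta)
  have W: "w \<in> TotP n" "Theta n w \<in> bounds n" if "w \<in> ?W" for w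
  proof -
    obtain x where x: "x \<in> TotP (Suc n)" "w = Tot_boundary pareigis_scale (Suc n) x"
      using \<open>w \<in> ?W\<close> by blast
    show "w \<in> TotP n" unfolding x(2) by (rule Tot_boundary_Theta(1)[OF x(1)])
    show "Theta n w \<in> bounds n"
      unfolding x(2) Tot_boundary_Theta(2)[OF x(1)] bounds_def by (rule imageI[OF Theta_TotM[OF x(1)]])
  qed
  have W': "\<exists>w\<in>?W. Theta n w = b" if "b \<in> bounds n" for b
  proof -
    obtain y where y: "y \<in> TotM (Suc n)" "b = dM (Suc n) y" using \<open>b \<in> bounds n\<close> unfolding bounds_def by blast
    obtain X where X: "X \<in> TotP (Suc n)" "Theta (Suc n) X = y" using y(1) by (rule Theta_surj)
    have "Theta n (Tot_boundary pareigis_scale (Suc n) X) = b"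
      using Tot_boundary_Theta(2)[OF X(1)] X(2) y(2) by simp
    then show ?thesis using X(1) by (intro bexI[OF _ imageI])
  qed
  show "vadd ?V x y \<in> vcarrier ?V" if "x \<in> vcarrier ?V" "y \<in> vcarrier ?V" for x y
    using that unfolding V by (simp add: Tot_add cycM_add)
  show "vsmult ?V c x \<in> vcarrier ?V" if "x \<in> vcarrier ?V" for c x
    using that unfolding V by (simp add: Tot_smult cycM_scale)
  show "?W \<subseteq> vcarrier ?V"
  proof
    fix w assume "w \<in> ?W"
    then show "w \<in> vcarrier ?V" unfolding V using W[of w] subsetD[OF bc, of "Theta n w"] by simp
  qed
  show "?W \<noteq> {}" using W'[OF bounds_zero] by blast
  show "\<Psi> (Theta n (vadd ?V x y)) = vadd U (\<Psi> (Theta n x)) (\<Psi> (Theta n y))"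
    if "x \<in> vcarrier ?V" "y \<in> vcarrier ?V" for x y
    using that unfolding V by (simp add: Tot_add add)
  show "\<Psi> (Theta n (vsmult ?V c x)) = vsmult U c (\<Psi> (Theta n x))" if "x \<in> vcarrier ?V" for c x
    using that unfolding V by (simp add: Tot_smult smult)
  show "\<Psi> (Theta n (vadd ?V x w)) = \<Psi> (Theta n x)" if "x \<in> vcarrier ?V" "w \<in> ?W" for x w
    using that(1) W[OF that(2)] unfolding V by (simp add: Tot_add kill)
  show "\<exists>w\<in>?W. y = vadd ?V x w" if xy: "x \<in> vcarrier ?V" "y \<in> vcarrier ?V" "\<Psi> (Theta n x) = \<Psi> (Theta n y)" for x y
  proof -
    have x: "x \<in> TotP n" "Theta n x \<in> cycM n" and y: "y \<in> TotP n" "Theta n y \<in> cycM n"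
      using xy unfolding V by auto
    obtain w where w: "w \<in> ?W" "Theta n w = (\<lambda>p. Theta n y p + fscale (- 1) (Theta n x p))"
      using W'[OF inj[OF x(2) y(2) xy(3)]] by blast
    have "Theta n (vadd (Tot pareigis_scale n) x w) = Theta n y"
      using Tot_add(2)[OF x(1) W(1)[OF w(1)]] by (simp add: w(2) fscale_m1)
    then have "y = vadd (Tot pareigis_scale n) x w"
      using Theta_inj[OF Tot_add(1)[OF x(1) W(1)[OF w(1)]] y(1)] by simp
    then show ?thesis using w(1) unfolding V by blast
  qed
  show "(\<lambda>X. \<Psi> (Theta n X)) ` vcarrier ?V = vcarrier U"
    unfolding V surj[symmetric]
  proof (intro equalityI subsetI)
    fix u assume "u \<in> \<Psi> ` cycM n"
    then obtain x where "x \<in> cycM n" "u = \<Psi> x" by blast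
    moreover then obtain X where "X \<in> TotP n" "Theta n X = x"
      using Theta_surj[of x n] by (auto simp: cycM_def)
    ultimately show "u \<in> (\<lambda>X. \<Psi> (Theta n X)) ` {X \<in> TotP n. Theta n X \<in> cycM n}" by blast
  qed auto
qed

lemma bounds_cycM: "(bounds n :: (nat \<Rightarrow> 'k::field_char_0 chain) set) \<subseteq> cycM n"
proof
  fix x :: "nat \<Rightarrow> 'k chain" assume "x \<in> bounds n"
  then obtain y where y: "y \<in> TotM (Suc n)" "x = dM (Suc n) y" unfolding bounds_def by blast
  have yC: "y p \<in> chains (Suc n - p)" if "p \<le> Suc n" for p
    using y(1) that by (simp add: TotM_def)
  have yC': "y p \<in> chains (Suc (n - p))" if "p \<le> n" for p
    using yC[of p] that by (simp add: Suc_diff_le)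
  have hh: "horizontal p (horizontal (Suc p) f) = 0" if "f \<in> chains k" "p > 0" for p k and f :: "'k chain"
    using op_N_minus_t[OF chains_Len[OF that(1)]] op_t_N[OF chains_Len[OF that(1)]] by (simp add: horizontal_def)
  have "x \<in> TotM n"
    unfolding y(2) using yC' yC[of "Suc _"]
    by (auto simp: TotM_def dM_def intro!: chains_add vertM_chains horizontal_chains)
  moreover have "dM n x p = 0" for p
  proof (cases "p < n")
    case True
    have "y (Suc p) \<in> chains (Suc (n - Suc p))" "y (Suc (Suc p)) \<in> chains (n - Suc p)"
      using yC'[of "Suc p"] yC[of "Suc (Suc p)"] True by simp_all
    then show ?thesis
      using True horizontal_vertM[of "y (Suc p)" "n - Suc p" "Suc p"] hh[of "y (Suc (Suc p))" "n - Suc p" "Suc p"]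
      by (simp add: dM_def y(2) vertM_add horizontal_add vertM_vertM)
  qed (simp add: dM_def)
  ultimately show "x \<in> cycM n" by (auto simp: cycM_def)
qed

theorem cyclic_homology_degree_0:
  "vspace_iso (cyclic_homology (pareigis_scale :: 'k::field_char_0 \<Rightarrow> 'k pareigis \<Rightarrow> 'k pareigis) 0) laurent"
proof (rule cyclic_homology_iso[where \<Psi> = "\<lambda>x. phi (weight_part 0 (x 0))"])
  fix x y :: "nat \<Rightarrow> 'k chain" and c :: 'k
  show "phi (weight_part 0 (x 0 + y 0)) = vadd laurent (phi (weight_part 0 (x 0))) (phi (weight_part 0 (y 0)))"
    by (simp add: laurent_def sub_vspace_def weight_part_add phi_add)
  show "phi (weight_part 0 (fscale c (x 0))) = vsmult laurent c (phi (weight_part 0 (x 0)))"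
    by (simp add: laurent_def sub_vspace_def weight_part_scale phi_scale)
  show "phi (weight_part 0 (x 0 + y 0)) = phi (weight_part 0 (x 0))" if "y \<in> bounds 0"
    using monomial_boundary(3)[OF that] by (simp add: weight_part_add phi_add)
  show "(\<lambda>p. y p + fscale (- 1) (x p)) \<in> bounds 0"
    if "x \<in> cycM 0" "y \<in> cycM 0" "phi (weight_part 0 (x 0)) = phi (weight_part 0 (y 0))"
  proof (rule monomial_kernel)
    show "(\<lambda>p. y p + fscale (- 1) (x p)) \<in> cycM 0" using that by (intro cycM_add cycM_scale)
    show eq: "phi (weight_part 0 (y 0 + fscale (- 1) (x 0))) = 0"
      using that(3) by (simp add: fscale_m1 weight_part_diff phi_diff)
    then show "Psi2 0 (\<lambda>p. y p + fscale (- 1) (x p)) = 0"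
      unfolding Psi2_def psi_def by simp
  qed simp
next
  show "(\<lambda>x. phi (weight_part 0 (x 0)) :: int \<Rightarrow>\<^sub>0 'k) ` cycM 0 = vcarrier laurent"
  proof -
    have "g \<in> (\<lambda>x. phi (weight_part 0 (x 0))) ` cycM 0" for g :: "int \<Rightarrow>\<^sub>0 'k"
      using monomial_surj_0[of g] by blast
    then show ?thesis by (auto simp: laurent_def sub_vspace_def)
  qed
qed (rule bounds_cycM)

theorem cyclic_homology_positive_degree:
  assumes n: "n > 0"
  shows "vspace_iso (cyclic_homology (pareigis_scale :: 'k::field_char_0 \<Rightarrow> 'k pareigis \<Rightarrow> 'k pareigis) n)
    (sum_vspace laurent_odd ground_field)"
proof (rule cyclic_homology_iso[where \<Psi> = "\<lambda>x. (Psi1 n x, Psi2 n x)"])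
  fix x y :: "nat \<Rightarrow> 'k chain" and c :: 'k
  let ?U = "sum_vspace laurent_odd ground_field"
  show "(Psi1 n (\<lambda>p. x p + y p), Psi2 n (\<lambda>p. x p + y p)) = vadd ?U (Psi1 n x, Psi2 n x) (Psi1 n y, Psi2 n y)"
    by (simp add: sum_vspace_def laurent_odd_def ground_field_def sub_vspace_def Psi_add)
  show "(Psi1 n (\<lambda>p. fscale c (x p)), Psi2 n (\<lambda>p. fscale c (x p))) = vsmult ?U c (Psi1 n x, Psi2 n x)"
    by (simp add: sum_vspace_def laurent_odd_def ground_field_def sub_vspace_def Psi_scale)
  show "(Psi1 n (\<lambda>p. x p + y p), Psi2 n (\<lambda>p. x p + y p)) = (Psi1 n x, Psi2 n x)" if "y \<in> bounds n"
    using monomial_boundary(1,2)[OF that] n by (simp add: Psi_add)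
  show "(\<lambda>p. y p + fscale (- 1) (x p)) \<in> bounds n"
    if "x \<in> cycM n" "y \<in> cycM n" "(Psi1 n x, Psi2 n x) = (Psi1 n y, Psi2 n y)"
  proof (rule monomial_kernel)
    show "(\<lambda>p. y p + fscale (- 1) (x p)) \<in> cycM n" using that by (intro cycM_add cycM_scale)
    show "Psi1 n (\<lambda>p. y p + fscale (- 1) (x p)) = 0" "Psi2 n (\<lambda>p. y p + fscale (- 1) (x p)) = 0"
      unfolding Psi_add Psi_scale using that(3) by (simp_all add: fscale_m1)
  qed (use n in simp)
next
  show "(\<lambda>x. (Psi1 n x, Psi2 n x) :: (int \<Rightarrow>\<^sub>0 'k) \<times> 'k) ` cycM n = vcarrier (sum_vspace laurent_odd ground_field)"
  proof (intro equalityI subsetI)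
    fix u :: "(int \<Rightarrow>\<^sub>0 'k) \<times> 'k" assume "u \<in> vcarrier (sum_vspace laurent_odd ground_field)"
    then have "fst u \<in> free_vs.span {sg r | r. odd r}"
      by (auto simp: sum_vspace_def laurent_odd_def sub_vspace_def)
    then obtain x where "x \<in> cycM n" "Psi1 n x = fst u" "Psi2 n x = snd u"
      using monomial_surj[OF n] by blast
    then show "u \<in> (\<lambda>x. (Psi1 n x, Psi2 n x)) ` cycM n"
      by (intro image_eqI[of _ _ x]) auto
  qed (auto simp: sum_vspace_def laurent_odd_def ground_field_def sub_vspace_def Psi1_def oddp_span)
qed (rule bounds_cycM)

theorem proposition5p15:
  fixes n :: nat
  shows "(n = 0 \<longrightarrow> vspace_iso
            (cyclic_homology (pareigis_scale :: 'k::field_char_0 \<Rightarrow> 'k pareigis \<Rightarrow> 'k pareigis) n)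
            laurent) \<and>
         (n > 0 \<longrightarrow> vspace_iso
            (cyclic_homology (pareigis_scale :: 'k \<Rightarrow> 'k pareigis \<Rightarrow> 'k pareigis) n)
            (sum_vspace laurent_odd ground_field))"
  using cyclic_homology_degree_0 cyclic_homology_positive_degree by blast

end
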